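(* Consider the random walk $\mathbf{X}$ that changes its environment once, on a Galton--Watson tree $\mathcal{G}$ with offspring mean $b>1$, with parameters $L,p>0$, as described in the context. Suppose that the kernel $K^*$ satisfies Assumption 1 of the context and that Assumption 2 of the context also holds. Suppose that $L\ge1$ and $p\ge1$. Then the condition $$\ln(1-\eta)\;>\;-\ln b$$ implies the transience of $\mathbf{X}$ on $\mathcal{G}$.
   Context: Tree: $\mathcal{G}$ is a Galton--Watson tree with root $\varrho$ and offspring mean $b>1$, augmented by a vertex $\varrho^{-1}$ adjoined as parent of $\varrho$. A vertex $\nu\ne\varrho^{-1}$ has $b(\nu)$ offspring $\nu1,\dots,\nu b(\nu)$ and parent $\nu^{-1}$. Initial environment: fix parameters $L,p>0$ and a Polish space $\Sigma$. Each vertex $\nu$ carries a triple $(A_\nu,B_\nu,M_\nu)$ with $A_\nu\in(0,\infty)$, $B_\nu\in[p,\infty)$, $M_\nu\in\Sigma$, which is a Markov process along each line of descent $\sigma=(\sigma_0=\varrho,\sigma_1,\dots)$. As in a Markovian environment generally, it is built sequentially along the tree from any initial value at $\varrho$: for each $\nu$, the values at the offspring of $\nu$ are generated from some joint distribution whose marginals, conditionally on the value at $\nu$ and the further past, are given by the transition kernel (independence among siblings is not required). Put $D_{\sigma_i}=L$ if $A_{\sigma_i}\le B_{\sigma_i}$ and $D_{\sigma_i}=A_{\sigma_i}$ if $A_{\sigma_i}>B_{\sigma_i}$. Let $\Sigma^*=\mathbb{R}_+^2\times\Sigma$ be the state space of $(B_{\sigma_i},A_{\sigma_i},M_{\sigma_i})$,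 and let $K^*$ be the transition kernel on $\mathbb{R}_+\times\Sigma^*$ of the Markov chain $\Gamma^*_{\sigma_i}=(D_{\sigma_i},B_{\sigma_i},A_{\sigma_i},M_{\sigma_i})$. $K^{*(m)}$ is its $m$-step iterate. Walk: let $S_\nu=\inf\{n\ge0:X_n=\nu\}$ and $$G(\nu,n)=\begin{cases}A_\nu&\text{if }A_\nu>B_\nu\text{ or }S_\nu>n,\\ L&\text{if }A_\nu\le B_\nu\text{ and }S_\nu\le n.\end{cases}$$ The walk starts at $X_0=\varrho$. If $X_n=\nu$ then, given the environment and $X_1,\dots,X_n$, the probability that $X_{n+1}=\nu i$ is $G(\nu i,n)/(1+\sum_{j=1}^{b(\nu)}G(\nu j,n))$, and the probability that $X_{n+1}=\nu^{-1}$ is $1/(1+\sum_{j=1}^{b(\nu)}G(\nu j,n))$. The walk is absorbed at $\varrho^{-1}$. Transience means that with positive (annealed) probability the walk never hits $\varrho^{-1}$. Assumption 1 (for $K^*$): there exist integers $0<\ell\le N$ and $\kappa\ge1$ such that for all $x,y\in\mathbb{R}_+\times\Sigma^*$ and Borel sets $B$, $K^{*(\ell)}(x,B)\le\frac{\kappa}{N}\sum_{m=1}^NK^{*(m)}(y,B)$. Assumption 2: with $\eta_{\varepsilon,r}=1-\inf_{y\in\mathbb{R}_+\times\Sigma^*}\mathbb{P}(\varepsilon<A_{\sigma_1}\le r\mid\Gamma^*_{\sigma_0}=y)$ and $\eta=\lim_{\varepsilon\to0,\,r\to\infty}\eta_{\varepsilon,r}$, one has $\eta<1$. Here $\mathbb{P}$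 is the law of the environment. *)

theory Defs
  imports "HOL-Probability.Probability" "HOL-Library.Extended_Nat"
begin

text \<open>\<open>\<Sigma>\<^sup>* = [0,\<infinity>)\<^sup>2 \<times> \<Sigma>\<close>, the points being \<open>(B, A, M)\<close>; the Polish space \<open>\<Sigma>\<close> is a
  type of class \<^class>\<open>polish_space\<close>. Both state spaces carry the trace of a Borel
  \<open>\<sigma>\<close>-algebra.\<close>

definition env_space :: "(real \<times> real \<times> 'm::polish_space) measure" where
  "env_space = restrict_space borel ({0..} \<times> {0..} \<times> UNIV)"

definition star_space :: "(real \<times> real \<times> real \<times> 'm::polish_space) measure" where
  "star_space = restrict_space borel ({0..} \<times> {0..} \<times> {0..} \<times> UNIV)"

definition Aval :: "real \<times> real \<times> 'm \<Rightarrow> real" where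
  "Aval = (\<lambda>(b, a, m). a)"

definition Bval :: "real \<times> real \<times> 'm \<Rightarrow> real" where
  "Bval = (\<lambda>(b, a, m). b)"

definition Dval :: "real \<Rightarrow> real \<times> real \<times> 'm \<Rightarrow> real" where
  "Dval L z = (if Aval z \<le> Bval z then L else Aval z)"

text \<open>The transition kernel of \<open>\<Gamma>\<^sup>* = (D, B, A, M)\<close>, where \<open>K\<close> is the transition kernel
  of \<open>(B, A, M)\<close>. As \<open>D\<close> is a function of \<open>(B, A)\<close>, the kernel does not depend on the
  \<open>D\<close>-coordinate of the starting point.\<close>

definition Kstar ::
  "real \<Rightarrow> (real \<times> real \<times> 'm::polish_space \<Rightarrow> (real \<times> real \<times> 'm) measure) \<Rightarrow>
   real \<times> real \<times> real \<times> 'm \<Rightarrow> (real \<times> real \<times> real \<times> 'm) measure" where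
  "Kstar L K = (\<lambda>(d, z). distr (K z) star_space (\<lambda>z'. (Dval L z', z')))"

primrec kernel_iter :: "'s measure \<Rightarrow> ('s \<Rightarrow> 's measure) \<Rightarrow> nat \<Rightarrow> 's \<Rightarrow> 's measure" where
  "kernel_iter S Q 0 x = return S x"
| "kernel_iter S Q (Suc m) x = kernel_iter S Q m x \<bind> Q"

definition assumption1 :: "'s measure \<Rightarrow> ('s \<Rightarrow> 's measure) \<Rightarrow> bool" where
  "assumption1 S Q \<longleftrightarrow>
    (\<exists>(l::nat) (N::nat) (\<kappa>::real). 0 < l \<and> l \<le> N \<and> 1 \<le> \<kappa> \<and>
      (\<forall>x\<in>space S. \<forall>y\<in>space S. \<forall>C\<in>sets S.
        measure (kernel_iter S Q l x) C
          \<le> \<kappa> / real N * (\<Sum>m=1..N. measure (kernel_iter S Q m y) C)))"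

definition eta_trunc ::
  "(real \<times> real \<times> real \<times> 'm::polish_space \<Rightarrow> (real \<times> real \<times> real \<times> 'm) measure) \<Rightarrow>
   real \<Rightarrow> real \<Rightarrow> real" where
  "eta_trunc Q \<epsilon> r = 1 - (INF y\<in>space star_space. \<P>((d, z) in Q y. \<epsilon> < Aval z \<and> Aval z \<le> r))"

text \<open>\<^const>\<open>eta_trunc\<close> is nondecreasing in \<open>\<epsilon>\<close> and nonincreasing in \<open>r\<close>, so the joint limit exists
  and equals either of the iterated ones.\<close>

definition eta ::
  "(real \<times> real \<times> real \<times> 'm::polish_space \<Rightarrow> (real \<times> real \<times> real \<times> 'm) measure) \<Rightarrow> real" where
  "eta Q = Lim (at_right 0 \<times>\<^sub>F at_top) (\<lambda>(\<epsilon>, r). eta_trunc Q \<epsilon> r)"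

text \<open>Vertices other than the extra vertex \<open>\<rho>\<^sup>-\<^sup>1\<close> are Ulam--Harris words: the root is \<open>[]\<close> and the
  offspring of \<open>\<nu>\<close> are \<open>\<nu> @ [1], \<dots>, \<nu> @ [bn \<nu>]\<close>. The offspring numbers \<open>bn\<close> are given for
  all words, but only those of words in the tree matter.\<close>

type_synonym vertex = "nat list"

definition tree :: "(vertex \<Rightarrow> nat) \<Rightarrow> vertex set" where
  "tree bn = {\<nu>. \<forall>k<length \<nu>. \<nu> ! k \<in> {1..bn (take k \<nu>)}}"

text \<open>Positions of the walk: \<open>None\<close> is \<open>\<rho>\<^sup>-\<^sup>1\<close>.\<close>

definition parent :: "vertex \<Rightarrow> vertex option" where
  "parent \<nu> = (if \<nu> = [] then None else Some (butlast \<nu>))"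

text \<open>The vertices whose values are present when, in a breadth-first construction of the
  environment, the values at the offspring of \<open>\<nu>\<close> are generated. They include \<open>\<nu>\<close>, all its
  ancestors, and everything else in the generations up to that of \<open>\<nu>\<close>.\<close>

definition before_offspring :: "vertex \<Rightarrow> vertex set" where
  "before_offspring \<nu> = insert [] {\<mu> @ [j] |\<mu> j. (\<mu>, \<nu>) \<in> lenlex less_than}"

definition hit_time :: "(nat \<Rightarrow> vertex option) \<Rightarrow> vertex \<Rightarrow> enat" where
  "hit_time x \<nu> = Inf {enat n |n. x n = Some \<nu>}"

definition weight ::
  "real \<Rightarrow> (vertex \<Rightarrow> real \<times> real \<times> 'm) \<Rightarrow> (nat \<Rightarrow> vertex option) \<Rightarrow> vertex \<Rightarrow> nat \<Rightarrow> real" where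
  "weight L z x \<nu> n =
    (if Aval (z \<nu>) > Bval (z \<nu>) \<or> hit_time x \<nu> > enat n then Aval (z \<nu>) else L)"

text \<open>\<open>\<sigma>\<close>-algebras are given by generating events. Values attached to words outside the
  tree carry no information: apart from measurability, nothing below refers to them.\<close>

definition tree_events :: "'w measure \<Rightarrow> (vertex \<Rightarrow> 'w \<Rightarrow> nat) \<Rightarrow> 'w set set" where
  "tree_events P bn = {{\<omega> \<in> space P. \<nu> \<in> tree (\<lambda>\<mu>. bn \<mu> \<omega>)} |\<nu>. True}"

definition env_events ::
  "'w measure \<Rightarrow> (vertex \<Rightarrow> 'w \<Rightarrow> nat) \<Rightarrow> (vertex \<Rightarrow> 'w \<Rightarrow> real \<times> real \<times> 'm::polish_space) \<Rightarrow>
   vertex set \<Rightarrow> 'w set set" where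
  "env_events P bn Z V =
    {{\<omega> \<in> space P. \<nu> \<in> tree (\<lambda>\<mu>. bn \<mu> \<omega>) \<and> Z \<nu> \<omega> \<in> C} |\<nu> C. \<nu> \<in> V \<and> C \<in> sets env_space}"

definition walk_events :: "'w measure \<Rightarrow> (nat \<Rightarrow> 'w \<Rightarrow> vertex option) \<Rightarrow> nat \<Rightarrow> 'w set set" where
  "walk_events P X n = {{\<omega> \<in> space P. X k \<omega> = v} |k v. k \<le> n}"

definition past_of_offspring ::
  "'w measure \<Rightarrow> (vertex \<Rightarrow> 'w \<Rightarrow> nat) \<Rightarrow> (vertex \<Rightarrow> 'w \<Rightarrow> real \<times> real \<times> 'm::polish_space) \<Rightarrow>
   vertex \<Rightarrow> 'w measure" where
  "past_of_offspring P bn Z \<nu> =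
    sigma (space P) (tree_events P bn \<union> env_events P bn Z (before_offspring \<nu>))"

definition past_of_walk ::
  "'w measure \<Rightarrow> (vertex \<Rightarrow> 'w \<Rightarrow> nat) \<Rightarrow> (vertex \<Rightarrow> 'w \<Rightarrow> real \<times> real \<times> 'm::polish_space) \<Rightarrow>
   (nat \<Rightarrow> 'w \<Rightarrow> vertex option) \<Rightarrow> nat \<Rightarrow> 'w measure" where
  "past_of_walk P bn Z X n =
    sigma (space P) (tree_events P bn \<union> env_events P bn Z UNIV \<union> walk_events P X n)"

definition cond_prob :: "'w measure \<Rightarrow> 'w measure \<Rightarrow> ('w \<Rightarrow> bool) \<Rightarrow> 'w \<Rightarrow> real" where
  "cond_prob P F Q = real_cond_exp P F (indicator {\<omega> \<in> space P. Q \<omega>})"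

text \<open>The measure \<open>P\<close> is the annealed law, governing tree, environment and walk together.

  The environment is built along the tree, given the tree: hypothesis \<open>env_markov\<close> says that,
  conditionally on the tree and on all values generated earlier, each single offspring of \<open>\<nu>\<close>
  has law \<open>K (Z \<nu>)\<close>. Only these marginals are prescribed; the joint law of the values at
  siblings is arbitrary, and so is the law of the value at the root.\<close>

locale once_changing_walk = prob_space P
  for P :: "'w measure" +
  fixes q :: "nat pmf"
    and K :: "real \<times> real \<times> 'm::polish_space \<Rightarrow> (real \<times> real \<times> 'm) measure"
    and L p :: real
    and bn :: "vertex \<Rightarrow> 'w \<Rightarrow> nat"
    and Z :: "vertex \<Rightarrow> 'w \<Rightarrow> real \<times> real \<times> 'm"
    and X :: "nat \<Rightarrow> 'w \<Rightarrow> vertex option"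
  assumes L_pos: "0 < L"
    and p_pos: "0 < p"
    and offspring_indep: "indep_vars (\<lambda>_. count_space UNIV) bn UNIV"
    and offspring_law: "\<And>\<nu>. distr P (count_space UNIV) (bn \<nu>) = measure_pmf q"
    and kernel: "K \<in> env_space \<rightarrow>\<^sub>M prob_algebra env_space"
    and env_measurable: "\<And>\<nu>. Z \<nu> \<in> P \<rightarrow>\<^sub>M env_space"
    and env_range: "\<And>\<nu> \<omega>. \<omega> \<in> space P \<Longrightarrow> \<nu> \<in> tree (\<lambda>\<mu>. bn \<mu> \<omega>) \<Longrightarrow>
          0 < Aval (Z \<nu> \<omega>) \<and> p \<le> Bval (Z \<nu> \<omega>)"
    and env_markov: "\<And>\<nu> i C. C \<in> sets env_space \<Longrightarrow>
          AE \<omega> in P. \<nu> @ [i] \<in> tree (\<lambda>\<mu>. bn \<mu> \<omega>) \<longrightarrow>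
            cond_prob P (past_of_offspring P bn Z \<nu>) (\<lambda>\<omega>'. Z (\<nu> @ [i]) \<omega>' \<in> C) \<omega>
              = measure (K (Z \<nu> \<omega>)) C"
    and walk_measurable: "\<And>n. X n \<in> P \<rightarrow>\<^sub>M count_space UNIV"
    and walk_start: "\<And>\<omega>. \<omega> \<in> space P \<Longrightarrow> X 0 \<omega> = Some []"
    and walk_absorbed: "\<And>n \<omega>. \<omega> \<in> space P \<Longrightarrow> X n \<omega> = None \<Longrightarrow> X (Suc n) \<omega> = None"
    and walk_down: "\<And>n \<nu> i. AE \<omega> in P. X n \<omega> = Some \<nu> \<longrightarrow> i \<in> {1..bn \<nu> \<omega>} \<longrightarrow>
          cond_prob P (past_of_walk P bn Z X n) (\<lambda>\<omega>'. X (Suc n) \<omega>' = Some (\<nu> @ [i])) \<omega>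
            = weight L (\<lambda>\<mu>. Z \<mu> \<omega>) (\<lambda>k. X k \<omega>) (\<nu> @ [i]) n
              / (1 + (\<Sum>j=1..bn \<nu> \<omega>. weight L (\<lambda>\<mu>. Z \<mu> \<omega>) (\<lambda>k. X k \<omega>) (\<nu> @ [j]) n))"
    and walk_up: "\<And>n \<nu>. AE \<omega> in P. X n \<omega> = Some \<nu> \<longrightarrow>
          cond_prob P (past_of_walk P bn Z X n) (\<lambda>\<omega>'. X (Suc n) \<omega>' = parent \<nu>) \<omega>
            = 1 / (1 + (\<Sum>j=1..bn \<nu> \<omega>. weight L (\<lambda>\<mu>. Z \<mu> \<omega>) (\<lambda>k. X k \<omega>) (\<nu> @ [j]) n))"

definition transient :: "'w measure \<Rightarrow> (nat \<Rightarrow> 'w \<Rightarrow> vertex option) \<Rightarrow> bool" where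
  "transient P X \<longleftrightarrow> \<P>(\<omega> in P. \<forall>n. X n \<omega> \<noteq> None) > 0"

end

theory Submission
  imports Defs "HOL-Library.Sublist"
begin

text \<open>Fix \<open>\<epsilon>\<close> small and \<open>r\<close> large such that every child has, whatever the value of its parent, a
  probability of at least \<open>\<delta> > 1/b\<close> of being good, i.e. of having \<open>\<epsilon> < A \<le> r\<close>.

  Given the environment, a walk on a single good line behaves at worst like a once-reinforced walk
  on the half line, and the probability of reaching depth \<open>k\<close> before returning decays only
  polynomially in \<open>k\<close>. This is captured by an explicit function. Let \<open>a\<close> be a flow along good
  vertices times a polynomial growth factor, and call an unvisited child of a visited vertex a
  frontier vertex. Then the sum, over the ancestors \<open>z\<close> of the current position \<open>x\<close>, of the mass \<open>a\<close>
  of the frontier below \<open>z\<close> is a submartingale: as visited vertices have weight at least one, only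
  steps to new vertices could decrease it on average, and the growth factor compensates for them.
  To keep the growth factor bounded by an exponential of small rate, the sums are localised in
  blocks of \<open>k\<close> consecutive levels; one minus the product over the blocks of one minus the block
  sums is a submartingale with values in \<open>[0, 1]\<close> that vanishes after absorption. So the
  probability of survival is at least a constant times the expected strength of a flow
  through good vertices with capacities \<open>\<beta>\<^sup>-\<^sup>n\<close> at level \<open>n\<close>, where \<open>\<beta> > 1\<close> is close to one.

  The strength of such a flow is at least an inverse energy. The energy only involves pairs
  of lines of descent, which after separation are conditionally independent although the values at
  siblings may be arbitrarily coupled. So the first and second moments of the number of good
  vertices, weighted by likelihood ratios, can be computed, and the condition \<open>\<beta> < b \<delta>\<close> bounds
  the expected flow from below.\<close>

text \<open>With a single block the argument would fail: the mass below an early ancestor is bounded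
  only by the flow through that ancestor, while frontier vertices far below it carry a growth factor
  that is unbounded in the level. Scaling the potential into \<open>[0, 1]\<close> would send its
  initial value to zero as the horizon grows. In blocks, the mass below an ancestor sees growth only
  up to the start of the next block, and the capacities have by then compensated all earlier blocks;
  \<open>growth_prod \<epsilon> k k \<le> \<beta> ^ k\<close> makes the bound uniform.

  The flow stops at a horizon \<open>N\<close> and is conserved only at levels less than
  \<open>N\<close>, so the potential is used at times before \<open>N\<close> and every constant
  must be free of \<open>N\<close>. A finite horizon and letters up to \<open>B\<close> leave
  finitely many sets of good words, so that conditional expectations reduce to sums over countably
  many cells.

  The threshold comes from the energy: relative to the squared first moment
  \<open>m ^ (2 * n)\<close>, pairs of lines that separate at level \<open>j\<close> contribute of
  order \<open>(\<beta> / (\<delta> * m)) ^ j\<close>, where \<open>m\<close> is the truncated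
  offspring mean. This is summable because \<open>\<beta> < m * \<delta>\<close>.\<close>

subsection \<open>Frontier mass and the block potential\<close>

text \<open>The mass \<open>a\<close> of the unvisited children of visited vertices below \<open>z\<close>. Only children at most
  \<open>r + 1\<close> levels below \<open>z\<close> count.\<close>

primrec mass :: "(vertex \<Rightarrow> real) \<Rightarrow> nat \<Rightarrow> vertex set \<Rightarrow> nat \<Rightarrow> vertex \<Rightarrow> real" where
  "mass a B V 0 z = (\<Sum>i=1..B. if z @ [i] \<in> V then 0 else a (z @ [i]))"
| "mass a B V (Suc r) z =
     (\<Sum>i=1..B. if z @ [i] \<in> V then mass a B V r (z @ [i]) else a (z @ [i]))"

lemma mass_nonneg: "(\<And>y. 0 \<le> a y) \<Longrightarrow> 0 \<le> mass a B V r z"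
  by (induction r arbitrary: z) (auto intro!: sum_nonneg)

text \<open>The frontier vertices below \<open>z\<close> form an antichain, so a flow
  \<open>\<theta>\<close> that never increases towards the children carries at most
  \<open>\<theta> z\<close> through all of them together. The level \<open>length z + Suc r\<close>
  is the deepest one that \<open>mass\<close> inspects.\<close>

lemma mass_le:
  assumes "\<And>y. 0 \<le> \<theta> y" "\<And>y. (\<Sum>i=1..B. \<theta> (y @ [i])) \<le> \<theta> y"
    and "0 \<le> c" "\<And>y. length y \<le> length z + Suc r \<Longrightarrow> a y \<le> c * \<theta> y"
  shows "mass a B V r z \<le> c * \<theta> z"
  using assms(4)
proof (induction r arbitrary: z)
  case 0
  have "mass a B V 0 z \<le> (\<Sum>i=1..B. c * \<theta> (z @ [i]))"
    using 0 assms(1,3) by (auto intro!: sum_mono)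
  also have "\<dots> \<le> c * \<theta> z"
    using mult_left_mono[OF assms(2)[of z] assms(3)] by (simp add: sum_distrib_left)
  finally show ?case .
next
  case (Suc r)
  have "mass a B V (Suc r) z \<le> (\<Sum>i=1..B. c * \<theta> (z @ [i]))"
    unfolding mass.simps
  proof (rule sum_mono)
    fix i
    show "(if z @ [i] \<in> V then mass a B V r (z @ [i]) else a (z @ [i])) \<le> c * \<theta> (z @ [i])"
      using Suc.prems by (auto intro!: Suc.IH)
  qed
  also have "\<dots> \<le> c * \<theta> z"
    using mult_left_mono[OF assms(2)[of z] assms(3)] by (simp add: sum_distrib_left)
  finally show ?case .
qed

lemma mass_fresh:
  assumes "\<And>i. z @ [i] \<notin> V"
  shows "mass a B V r z = (\<Sum>i=1..B. a (z @ [i]))"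
  using assms by (cases r) auto

lemma mass_insert_other:
  assumes "\<And>u j. length u \<le> r \<Longrightarrow> z @ u @ [j] \<noteq> y"
  shows "mass a B (insert y V) r z = mass a B V r z"
  using assms
proof (induction r arbitrary: z)
  case 0
  then have "z @ [i] \<noteq> y" for i using 0[of "[]"] by simp
  then show ?case by simp
next
  case (Suc r)
  have "z @ [i] \<noteq> y" for i using Suc.prems[of "[]"] by simp
  moreover have "mass a B (insert y V) r (z @ [i]) = mass a B V r (z @ [i])" for i
    using Suc.prems[of "i # _"] by (intro Suc.IH) auto
  ultimately show ?case by (auto intro!: sum.cong)
qed

text \<open>Visiting a frontier vertex moves the frontier down by one level there: the vertex leaves
  it, and its children enter if they are still in range, which means \<open>length u < r\<close>.
  Hypothesis \<open>vis\<close> ensures that the recursion of \<open>mass\<close> really descends to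
  the new vertex.\<close>

lemma mass_insert_below:
  assumes new: "z @ u @ [j] \<notin> V" "\<And>i. z @ u @ [j] @ [i] \<notin> V"
    and vis: "\<And>l. l \<le> length u \<Longrightarrow> z @ take l u \<in> V"
    and letters: "set (u @ [j]) \<subseteq> {1..B}"
    and r: "length u \<le> r"
  shows "mass a B (insert (z @ u @ [j]) V) r z = mass a B V r z - a (z @ u @ [j])
    + (if length u < r then \<Sum>i=1..B. a (z @ u @ [j] @ [i]) else 0)"
  using assms
proof (induction u arbitrary: z r)
  case Nil
  have j: "j \<in> {1..B}" using Nil by simp
  let ?y = "z @ [j]"
  show ?case
  proof (cases r)
    case 0
    have "mass a B (insert ?y V) 0 z
        = (\<Sum>i=1..B. (if z @ [i] \<in> V then 0 else a (z @ [i])) - (if i = j then a ?y else 0))"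
      using Nil unfolding mass.simps by (intro sum.cong) auto
    then show ?thesis using j 0 by (simp add: sum_subtractf)
  next
    case (Suc r')
    have other: "mass a B (insert ?y V) r' (z @ [i]) = mass a B V r' (z @ [i])" for i
      by (rule mass_insert_other) auto
    have fresh: "mass a B (insert ?y V) r' ?y = (\<Sum>i=1..B. a (?y @ [i]))"
      using Nil by (intro mass_fresh) auto
    have "mass a B (insert ?y V) r z
        = (\<Sum>i=1..B. (if z @ [i] \<in> V then mass a B V r' (z @ [i]) else a (z @ [i]))
            + (if i = j then (\<Sum>i=1..B. a (?y @ [i])) - a ?y else 0))"
      using Nil other fresh unfolding Suc mass.simps by (intro sum.cong) auto
    then show ?thesis using j Suc by (simp add: sum.distrib)
  qed
next
  case (Cons v u)
  obtain r' where r: "r = Suc r'" using Cons.prems by (cases r) auto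
  have v: "v \<in> {1..B}" using Cons.prems by simp
  let ?y = "z @ (v # u) @ [j]"
  have zv: "z @ [v] \<in> V" using Cons.prems(3)[of 1] by simp
  have IH: "mass a B (insert ?y V) r' (z @ [v]) = mass a B V r' (z @ [v]) - a ?y
    + (if length u < r' then \<Sum>i=1..B. a (?y @ [i]) else 0)"
  proof -
    have "mass a B (insert ((z @ [v]) @ u @ [j]) V) r' (z @ [v])
      = mass a B V r' (z @ [v]) - a ((z @ [v]) @ u @ [j])
    + (if length u < r' then \<Sum>i=1..B. a ((z @ [v]) @ u @ [j] @ [i]) else 0)"
    proof (rule Cons.IH)
      show "(z @ [v]) @ take l u \<in> V" if "l \<le> length u" for l
        using Cons.prems(3)[of "Suc l"] that by simp
    qed (use Cons.prems r in auto)
    then show ?thesis by simp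
  qed
  have other: "mass a B (insert ?y V) r' (z @ [i]) = mass a B V r' (z @ [i])" if "i \<noteq> v" for i
    using that by (intro mass_insert_other) auto
  have neq: "z @ [i] \<noteq> ?y" for i by simp
  have "mass a B (insert ?y V) r z
      = (\<Sum>i=1..B. (if z @ [i] \<in> V then mass a B V r' (z @ [i]) else a (z @ [i]))
          + (if i = v then - a ?y + (if length u < r' then \<Sum>i=1..B. a (?y @ [i]) else 0) else 0))"
    unfolding r mass.simps
  proof (rule sum.cong[OF refl])
    fix i assume "i \<in> {1..B}"
    show "(if z @ [i] \<in> insert ?y V then mass a B (insert ?y V) r' (z @ [i]) else a (z @ [i])) =
      (if z @ [i] \<in> V then mass a B V r' (z @ [i]) else a (z @ [i]))
          + (if i = v then - a ?y + (if length u < r' then \<Sum>i=1..B. a (?y @ [i]) else 0) else 0)"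
      using IH other[of i] neq[of i] zv by (cases "i = v") auto
  qed
  also have "\<dots> = mass a B V r z + (- a ?y + (if length u < r' then \<Sum>i=1..B. a (?y @ [i]) else 0))"
    using v by (simp add: sum.distrib r)
  finally show ?case using r by simp
qed

text \<open>With \<open>\<mu> l\<close> the mass below the ancestor at level \<open>l\<close>, \<open>survp k \<mu> n\<close> is the product over the
  blocks of \<open>k\<close> consecutive levels up to \<open>n\<close> of one minus the sum of \<open>\<mu>\<close> over the block.\<close>

primrec blk_sum :: "nat \<Rightarrow> (nat \<Rightarrow> real) \<Rightarrow> nat \<Rightarrow> real" where
  "blk_sum k \<mu> 0 = \<mu> 0"
| "blk_sum k \<mu> (Suc n) = (if k dvd Suc n then 0 else blk_sum k \<mu> n) + \<mu> (Suc n)"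

primrec blk_prod :: "nat \<Rightarrow> (nat \<Rightarrow> real) \<Rightarrow> nat \<Rightarrow> real" where
  "blk_prod k \<mu> 0 = 1"
| "blk_prod k \<mu> (Suc n) = blk_prod k \<mu> n * (if k dvd Suc n then 1 - blk_sum k \<mu> n else 1)"

definition survp :: "nat \<Rightarrow> (nat \<Rightarrow> real) \<Rightarrow> nat \<Rightarrow> real" where
  "survp k \<mu> n = blk_prod k \<mu> n * (1 - blk_sum k \<mu> n)"

lemma mod_Suc_not_dvd: "\<not> k dvd Suc n \<Longrightarrow> Suc n mod k = Suc (n mod k)"
  by (auto simp: mod_Suc dvd_eq_mod_eq_0)

lemma div_Suc_not_dvd: "\<not> k dvd Suc n \<Longrightarrow> Suc n div k = n div k"
  by (auto simp: div_Suc dvd_eq_mod_eq_0)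

lemma div_Suc_dvd: "k dvd Suc n \<Longrightarrow> Suc n div k = Suc (n div k)"
  by (auto simp: div_Suc dvd_eq_mod_eq_0)

text \<open>Applied with \<open>c\<close> the change of mass caused by one new vertex, which is the
  same for all ancestors in a block. The factor \<open>n mod k + 1\<close> counts the levels of the
  block up to \<open>n\<close>.\<close>

lemma blk_sum_shift:
  assumes "\<And>l. l \<le> n \<Longrightarrow> l div k = n div k \<Longrightarrow> \<mu>' l = \<mu> l + c" "0 < k"
  shows "blk_sum k \<mu>' n = blk_sum k \<mu> n + (real (n mod k) + 1) * c"
  using assms(1)
proof (induction n)
  case (Suc n)
  show ?case
  proof (cases "k dvd Suc n")
    case False
    then have "blk_sum k \<mu>' n = blk_sum k \<mu> n + (real (n mod k) + 1) * c"
      by (intro Suc.IH Suc.prems) (auto simp: div_Suc_not_dvd)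
    then show ?thesis using Suc.prems[of "Suc n"] False
      by (simp add: mod_Suc_not_dvd algebra_simps)
  qed (use Suc.prems[of "Suc n"] in auto)
qed simp

lemma blk_prod_cong:
  assumes "\<And>l. l \<le> n \<Longrightarrow> l div k < n div k \<Longrightarrow> \<mu>' l = \<mu> l" "0 < k"
  shows "blk_prod k \<mu>' n = blk_prod k \<mu> n"
  using assms(1)
proof (induction n)
  case (Suc n)
  show ?case
  proof (cases "k dvd Suc n")
    case False
    then have "blk_prod k \<mu>' n = blk_prod k \<mu> n"
      by (intro Suc.IH Suc.prems) (auto simp: div_Suc_not_dvd)
    then show ?thesis using False by simp
  next
    case True
    have eq: "\<mu>' l = \<mu> l" if "l \<le> n" for l
      using that True Suc.prems[of l] by (simp add: div_Suc_dvd div_le_mono less_Suc_eq_le)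
    have "blk_sum k \<mu>' n = blk_sum k \<mu> n" using blk_sum_shift[of n k \<mu>' \<mu> 0] eq assms(2) by simp
    moreover have "blk_prod k \<mu>' n = blk_prod k \<mu> n" using eq by (intro Suc.IH) auto
    ultimately show ?thesis by simp
  qed
qed simp

lemma blk_sum_bounds:
  assumes "\<And>l. l \<le> n \<Longrightarrow> 0 \<le> \<mu> l \<and> \<mu> l \<le> c" "0 < k"
  shows "0 \<le> blk_sum k \<mu> n \<and> blk_sum k \<mu> n \<le> (real (n mod k) + 1) * c"
  using assms(1)
proof (induction n)
  case (Suc n)
  have IH: "0 \<le> blk_sum k \<mu> n \<and> blk_sum k \<mu> n \<le> (real (n mod k) + 1) * c"
    by (rule Suc.IH) (use Suc.prems in auto)
  then show ?case using Suc.prems[of "Suc n"] by (auto simp: mod_Suc_not_dvd algebra_simps)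
qed simp

text \<open>The bound \<open>1 / (2 * real k)\<close> on each mass is chosen so that a full block of
  \<open>k\<close> levels sums to at most one half. Every factor \<open>1 - blk_sum\<close> then
  stays at least one half, which is what pays for a step into the next block.\<close>

lemma blk_sum_le_half:
  assumes "\<And>l. l \<le> n \<Longrightarrow> 0 \<le> \<mu> l \<and> \<mu> l \<le> 1 / (2 * real k)" "0 < k"
  shows "0 \<le> blk_sum k \<mu> n" "blk_sum k \<mu> n \<le> 1 / 2"
proof -
  have b: "0 \<le> blk_sum k \<mu> n" "blk_sum k \<mu> n \<le> (real (n mod k) + 1) * (1 / (2 * real k))"
    using blk_sum_bounds[of n \<mu> "1 / (2 * real k)" k] assms by blast+
  show "0 \<le> blk_sum k \<mu> n" using b by simp
  have "real (n mod k) + 1 \<le> real k" using mod_less_divisor[OF assms(2), of n] by linarith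
  then have "(real (n mod k) + 1) * (1 / (2 * real k)) \<le> real k * (1 / (2 * real k))"
    by (intro mult_right_mono) auto
  also have "\<dots> = 1 / 2" using assms(2) by simp
  finally show "blk_sum k \<mu> n \<le> 1 / 2" using b(2) by linarith
qed

lemma blk_prod_bounds:
  assumes "\<And>l. l \<le> n \<Longrightarrow> 0 \<le> \<mu> l \<and> \<mu> l \<le> 1 / (2 * real k)" "0 < k"
  shows "0 \<le> blk_prod k \<mu> n \<and> blk_prod k \<mu> n \<le> 1"
  using assms(1)
proof (induction n)
  case (Suc n)
  have IH: "0 \<le> blk_prod k \<mu> n \<and> blk_prod k \<mu> n \<le> 1" by (rule Suc.IH) (use Suc.prems in auto)
  have "0 \<le> blk_sum k \<mu> n" "blk_sum k \<mu> n \<le> 1 / 2"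
    using blk_sum_le_half[of n \<mu> k] Suc.prems assms(2) by auto
  then show ?case using IH by (auto intro!: mult_le_one)
qed simp

lemma survp_bounds:
  assumes "\<And>l. l \<le> n \<Longrightarrow> 0 \<le> \<mu> l \<and> \<mu> l \<le> 1 / (2 * real k)" "0 < k"
  shows "0 \<le> survp k \<mu> n" "survp k \<mu> n \<le> 1"
proof -
  have "0 \<le> blk_prod k \<mu> n \<and> blk_prod k \<mu> n \<le> 1" "0 \<le> blk_sum k \<mu> n" "blk_sum k \<mu> n \<le> 1 / 2"
    using blk_sum_le_half[of n \<mu> k] blk_prod_bounds[of n \<mu> k] assms by blast+
  then show "0 \<le> survp k \<mu> n" "survp k \<mu> n \<le> 1"
    unfolding survp_def by (auto intro!: mult_le_one)
qed

text \<open>One formula covers both cases: inside a block the sum grows by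
  \<open>\<mu> (Suc n)\<close>; at a boundary the finished factor moves into \<open>blk_prod\<close>
  and a new factor \<open>1 - \<mu> (Suc n)\<close> appears.\<close>

lemma survp_step: "survp k \<mu> n - survp k \<mu> (Suc n) = blk_prod k \<mu> (Suc n) * \<mu> (Suc n)"
  by (auto simp: survp_def algebra_simps)

subsection \<open>The potential decreases along the walk\<close>

text \<open>With depth \<open>k - 1 - l mod k\<close> the masses of all ancestors in one block reach
  down to the same level, the first level of the next block. A new vertex therefore changes them all
  by the same amount.\<close>

definition anc_mass :: "(vertex \<Rightarrow> real) \<Rightarrow> nat \<Rightarrow> nat \<Rightarrow> vertex set \<Rightarrow> vertex \<Rightarrow> nat \<Rightarrow> real" where
  "anc_mass a B k V x l = mass a B V (k - 1 - l mod k) (take l x)"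

definition pot :: "(vertex \<Rightarrow> real) \<Rightarrow> nat \<Rightarrow> nat \<Rightarrow> vertex set \<Rightarrow> vertex \<Rightarrow> real" where
  "pot a B k V x = survp k (anc_mass a B k V x) (length x)"

lemma blk_sum_cong:
  assumes "\<And>l. l \<le> n \<Longrightarrow> \<mu>' l = \<mu> l"
  shows "blk_sum k \<mu>' n = blk_sum k \<mu> n"
  using assms by (induction n) auto

lemma blk_prod_cong_all:
  assumes "\<And>l. l \<le> n \<Longrightarrow> \<mu>' l = \<mu> l"
  shows "blk_prod k \<mu>' n = blk_prod k \<mu> n"
  using assms
proof (induction n)
  case (Suc n)
  have "blk_prod k \<mu>' n = blk_prod k \<mu> n" using Suc by auto
  then show ?case using blk_sum_cong[of n \<mu>' \<mu> k] Suc.prems by auto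
qed simp

lemma survp_cong: "(\<And>l. l \<le> n \<Longrightarrow> \<mu>' l = \<mu> l) \<Longrightarrow> survp k \<mu>' n = survp k \<mu> n"
  using blk_sum_cong[of n \<mu>' \<mu> k] blk_prod_cong_all[of n \<mu>' \<mu> k] by (simp add: survp_def)

lemma pot_parent:
  assumes "x \<noteq> []"
  shows "pot a B k V (butlast x) - pot a B k V x
    = blk_prod k (anc_mass a B k V x) (length x) * anc_mass a B k V x (length x)"
proof -
  obtain y i where x: "x = y @ [i]" using assms by (cases x rule: rev_cases) auto
  have "pot a B k V y = survp k (anc_mass a B k V x) (length y)"
    unfolding pot_def by (rule survp_cong) (simp add: anc_mass_def x)
  then show ?thesis using survp_step[of k "anc_mass a B k V x" "length y"] by (simp add: pot_def x)
qed

lemma pot_visited: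
  assumes "x @ [i] \<in> V" and \<mu>: "\<mu> = anc_mass a B k V x" and n: "n = length x"
  shows "pot a B k V (x @ [i]) = (if k dvd Suc n
    then survp k \<mu> n * (1 - anc_mass a B k V (x @ [i]) (Suc n))
    else survp k \<mu> n - blk_prod k \<mu> n * anc_mass a B k V (x @ [i]) (Suc n))"
proof -
  let ?\<mu>' = "anc_mass a B k V (x @ [i])"
  have eq: "l \<le> n \<Longrightarrow> ?\<mu>' l = \<mu> l" for l by (simp add: \<mu> n anc_mass_def)
  show ?thesis
    using blk_sum_cong[of n ?\<mu>' \<mu> k] blk_prod_cong_all[of n ?\<mu>' \<mu> k] eq
    unfolding pot_def survp_def by (auto simp: n[symmetric] algebra_simps)
qed

text \<open>Ancestors in earlier blocks do not see the new vertex. Those in the block of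
  \<open>x\<close> all lose \<open>a (x @ [i])\<close> and, unless that block ends at
  \<open>x\<close>, gain the mass \<open>ext (x @ [i])\<close> of its children. The new vertex
  itself adds \<open>ext (x @ [i])\<close> as a last term, in the same block or in a new
  one.\<close>

lemma pot_unvisited:
  fixes a :: "vertex \<Rightarrow> real" and B :: nat
  defines "ext \<equiv> \<lambda>y. \<Sum>i=1..B. a (y @ [i])"
  assumes new: "x @ [i] \<notin> V" "\<And>j. x @ [i, j] \<notin> V" and vis: "\<And>l. l \<le> length x \<Longrightarrow> take l x \<in> V"
    and letters: "set (x @ [i]) \<subseteq> {1..B}" and k: "0 < k"
    and \<mu>: "\<mu> = anc_mass a B k V x" and n: "n = length x"
  shows "pot a B k (insert (x @ [i]) V) (x @ [i]) = (if k dvd Suc n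
    then blk_prod k \<mu> n * (1 - blk_sum k \<mu> n + real k * a (x @ [i])) * (1 - ext (x @ [i]))
    else survp k \<mu> n - blk_prod k \<mu> n *
      ((real (n mod k) + 2) * ext (x @ [i]) - (real (n mod k) + 1) * a (x @ [i])))"
proof -
  let ?y = "x @ [i]"
  let ?\<mu>' = "anc_mass a B k (insert ?y V) ?y"
  have own: "?\<mu>' (Suc n) = ext ?y"
    unfolding anc_mass_def ext_def n using new by (subst mass_fresh) auto
  \<comment> \<open>The mass at such a level \<open>l\<close> reaches at most level
    \<open>n\<close>, the new vertex is at level \<open>Suc n\<close>.\<close>
  have lower: "?\<mu>' l = \<mu> l" if "l \<le> n" "l div k < n div k" for l
  proof -
    have "l mod k + k * (l div k) = l" "n mod k + k * (n div k) = n" by auto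
    moreover have "k * (l div k) + k \<le> k * (n div k)"
      using that(2) by (metis Suc_leI mult_Suc_right mult_le_mono2 add.commute)
    ultimately have *: "l + (k - 1 - l mod k) < n" using mod_less_divisor[OF k, of l] by linarith
    have "take l x @ u @ [j] \<noteq> ?y" if "length u \<le> k - 1 - l mod k" for u j
    proof
      assume "take l x @ u @ [j] = ?y"
      then have "length (take l x @ u @ [j]) = length ?y" by (rule arg_cong)
      then show False using that * \<open>l \<le> n\<close> n by simp
    qed
    then have "mass a B (insert ?y V) (k - 1 - l mod k) (take l x) = mass a B V (k - 1 - l mod k) (take l x)"
      by (intro mass_insert_other) auto
    then show ?thesis using that n by (simp add: anc_mass_def \<mu>)
  qed
  have cur: "?\<mu>' l = \<mu> l + ((if k dvd Suc n then 0 else ext ?y) - a ?y)"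
    if "l \<le> n" "l div k = n div k" for l
  proof -
    let ?u = "drop l x"
    have td: "take l x @ ?u @ w = x @ w" for w by (metis append.assoc append_take_drop_id)
    have "l mod k + k * (l div k) = l" "n mod k + k * (n div k) = n" by auto
    then have m: "n mod k = l mod k + (n - l)" using that by (metis add_diff_inverse_nat add.assoc add.commute add_right_cancel not_less)
    have lt: "n mod k < k" using k by simp
    have iff: "length ?u < k - 1 - l mod k \<longleftrightarrow> \<not> k dvd Suc n"
      using m lt that n by (auto simp: dvd_eq_mod_eq_0 mod_Suc)
    have "mass a B (insert (take l x @ ?u @ [i]) V) (k - 1 - l mod k) (take l x)
       = mass a B V (k - 1 - l mod k) (take l x) - a (take l x @ ?u @ [i])
       + (if length ?u < k - 1 - l mod k then \<Sum>j=1..B. a (take l x @ ?u @ [i] @ [j]) else 0)"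
    proof (rule mass_insert_below)
      show "take l x @ take j ?u \<in> V" if "j \<le> length ?u" for j
        using vis[of "l + j"] that \<open>l \<le> n\<close> n by (simp add: take_add)
      show "take l x @ ?u @ [i] \<notin> V" using new(1) by (simp flip: append_assoc)
      show "take l x @ ?u @ [i] @ [j] \<notin> V" for j using new(2)[of j] by (simp flip: append_assoc)
      show "set (?u @ [i]) \<subseteq> {1..B}" using letters set_drop_subset[of l x] by auto
      show "length ?u \<le> k - 1 - l mod k" using m lt that n by simp
    qed
    then have "mass a B (insert ?y V) (k - 1 - l mod k) (take l x)
       = mass a B V (k - 1 - l mod k) (take l x) - a ?y
       + (if length ?u < k - 1 - l mod k then ext ?y else 0)"
      by (simp add: td ext_def)
    then show ?thesis using that n iff by (auto simp: anc_mass_def \<mu>)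
  qed
  have P: "blk_prod k ?\<mu>' n = blk_prod k \<mu> n" by (rule blk_prod_cong[OF lower k])
  have G: "blk_sum k ?\<mu>' n = blk_sum k \<mu> n
      + (real (n mod k) + 1) * ((if k dvd Suc n then 0 else ext ?y) - a ?y)"
    by (rule blk_sum_shift[OF cur k])
  have nm: "real (n mod k) + 1 = real k" if "k dvd Suc n"
    using that k by (auto simp: dvd_eq_mod_eq_0 mod_Suc split: if_splits)
  show ?thesis
  proof (cases "k dvd Suc n")
    case True
    have "blk_sum k ?\<mu>' n = blk_sum k \<mu> n - real k * a ?y" using G nm[OF True] True by simp
    then show ?thesis using P own True unfolding pot_def survp_def by (simp add: n[symmetric])
  next
    case False
    have "blk_sum k ?\<mu>' n = blk_sum k \<mu> n + (real (n mod k) + 1) * (ext ?y - a ?y)" using G False by simp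
    then show ?thesis using P own False unfolding pot_def survp_def
      by (simp add: n[symmetric]) (simp add: algebra_simps)
  qed
qed

lemma mass_zero: "(\<And>w. a (z @ w) = 0) \<Longrightarrow> mass a B V r z = 0"
  by (induction r arbitrary: z) (auto intro!: sum.neutral)

lemma mass_insert_null:
  assumes "y \<notin> V" "\<And>w. a (y @ w) = 0"
  shows "mass a B (insert y V) r z = mass a B V r z"
proof (induction r arbitrary: z)
  case 0
  show ?case using assms(1) assms(2)[of "[]"] by (auto intro!: sum.cong)
next
  case (Suc r)
  have "mass a B V r y = 0" using assms(2) by (rule mass_zero)
  then show ?case using assms(1) assms(2)[of "[]"] Suc by (auto intro!: sum.cong)
qed

text \<open>Covers children outside the alphabet \<open>{1..B}\<close>, for which the hypothesis on
  letters in \<open>pot_unvisited\<close> fails. A subtree on which \<open>a\<close> vanishes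
  contributes to no mass, visited or not.\<close>

lemma pot_insert_null:
  assumes "x @ [i] \<notin> V" "\<And>w. a (x @ i # w) = 0"
  shows "pot a B k (insert (x @ [i]) V) (x @ [i]) = pot a B k V x"
proof -
  let ?y = "x @ [i]" and ?n = "length x"
  let ?\<mu>' = "anc_mass a B k (insert ?y V) ?y" and ?\<mu> = "anc_mass a B k V x"
  have null: "mass a B (insert ?y V) r z = mass a B V r z" for r z
    using assms by (intro mass_insert_null) auto
  have eq: "?\<mu>' l = ?\<mu> l" if "l \<le> ?n" for l
    using null that by (simp add: anc_mass_def)
  have own: "?\<mu>' (Suc ?n) = 0"
    unfolding anc_mass_def null using assms(2) by (intro mass_zero) simp
  show ?thesis
    using blk_sum_cong[of ?n ?\<mu>' ?\<mu> k] blk_prod_cong_all[of ?n ?\<mu>' ?\<mu> k] eq own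
    unfolding pot_def survp_def by (auto simp: algebra_simps)
qed

text \<open>This is the expected change of the potential multiplied by the total weight, the parent
  having weight 1. The step to the parent costs \<open>blk_prod\<close> times the frontier mass of
  \<open>x\<close>. That mass splits into shares of the children, and each child pays for its own
  share: a visited one because its weight is at least 1, an unvisited one because its weight is at
  least \<open>\<epsilon>\<close> and the growth factor makes \<open>ext\<close> exceed
  \<open>a\<close>.\<close>

lemma pot_drift:
  fixes a wt :: "vertex \<Rightarrow> real" and b B k :: nat and V :: "vertex set" and x :: vertex and \<epsilon> :: real
  defines "ext \<equiv> \<lambda>y. \<Sum>i=1..B. a (y @ [i])"
  assumes nonneg: "\<And>y. 0 \<le> a y" and k: "0 < k" and eps: "0 < \<epsilon>"
    and mass_small: "\<And>z. mass a B V (k - 1 - length z mod k) z \<le> 1 / (2 * real k)"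
    and ext: "\<And>i. ext (x @ [i]) = (if k dvd Suc (length x) then 2 * (real k + 1 / \<epsilon>)
          else 1 + 1 / (\<epsilon> * real (Suc (length x) mod k))) * a (x @ [i])"
    and closed: "\<And>i j. x @ [i] \<notin> V \<Longrightarrow> x @ [i, j] \<notin> V" and vis: "\<And>l. l \<le> length x \<Longrightarrow> take l x \<in> V"
    and letters: "\<And>y. a y \<noteq> 0 \<Longrightarrow> set y \<subseteq> {1..B}"
    and wt_visited: "\<And>i. i \<in> {1..b} \<Longrightarrow> x @ [i] \<in> V \<Longrightarrow> 1 \<le> wt (x @ [i])"
    and wt_new: "\<And>i. i \<in> {1..b} \<Longrightarrow> 0 \<le> wt (x @ [i])"
      "\<And>i. i \<in> {1..b} \<Longrightarrow> x @ [i] \<notin> V \<Longrightarrow> a (x @ [i]) \<noteq> 0 \<Longrightarrow> \<epsilon> \<le> wt (x @ [i])"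
    and beyond: "\<And>i. b < i \<Longrightarrow> x @ [i] \<notin> V \<and> a (x @ [i]) = 0"
  shows "((if x = [] then 1 else pot a B k V (butlast x)) - pot a B k V x)
    + (\<Sum>i\<in>{1..B} \<inter> {1..b}. wt (x @ [i]) * (pot a B k (insert (x @ [i]) V) (x @ [i]) - pot a B k V x)) \<le> 0"
proof -
  define \<mu> where "\<mu> = anc_mass a B k V x"
  define n where "n = length x"
  let ?P = "blk_prod k \<mu> n" and ?g = "blk_sum k \<mu> n"
  have mass0: "0 \<le> mass a B V r z" for r z by (rule mass_nonneg[OF nonneg])
  have \<mu>b: "0 \<le> \<mu> l \<and> \<mu> l \<le> 1 / (2 * real k)" if "l \<le> n" for l
    using mass_small[of "take l x"] mass0 that by (simp add: \<mu>_def anc_mass_def n_def min_absorb2)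
  have g: "0 \<le> ?g" "?g \<le> 1 / 2" using blk_sum_le_half[of n \<mu> k] \<mu>b k by blast+
  have P: "0 \<le> ?P" using blk_prod_bounds[of n \<mu> k] \<mu>b k by blast
  have surv: "pot a B k V x = ?P * (1 - ?g)" "survp k \<mu> n = ?P * (1 - ?g)"
    by (simp_all add: pot_def survp_def \<mu>_def n_def)
  \<comment> \<open>The share of child \<open>i\<close> in the frontier mass of \<open>x\<close>. A
    visited child at the start of the next block has share 0, because the mass of \<open>x\<close>
    does not reach below that level.\<close>
  define m where "m i = (if x @ [i] \<in> V then (if k dvd Suc n then 0 else anc_mass a B k V (x @ [i]) (Suc n))
     else a (x @ [i]))" for i
  \<comment> \<open>The value 1 in the root case is the potential after absorption. It fits the
    general formula because \<open>survp\<close> at level 0 is \<open>1 - \<mu> 0\<close>.\<close>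
  have up: "(if x = [] then 1 else pot a B k V (butlast x)) - pot a B k V x = ?P * \<mu> n"
  proof (cases "x = []")
    case True then show ?thesis by (simp add: pot_def survp_def \<mu>_def n_def)
  next
    case False then show ?thesis using pot_parent[OF False, of a B k V] by (simp add: \<mu>_def n_def)
  qed
  have \<mu>n: "\<mu> n = (\<Sum>i=1..B. m i)"
  proof (cases "k dvd Suc n")
    case True
    then have "n mod k = k - 1" using k by (auto simp: dvd_eq_mod_eq_0 mod_Suc split: if_splits)
    then have "\<mu> n = mass a B V 0 x" by (simp add: \<mu>_def anc_mass_def n_def)
    then show ?thesis using True by (auto simp: m_def intro!: sum.cong)
  next
    case False
    have "Suc (n mod k) < k" using mod_less_divisor[OF k, of "Suc n"] mod_Suc_not_dvd[OF False] by simp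
    then have r: "k - 1 - n mod k = Suc (k - 1 - Suc n mod k)" using mod_Suc_not_dvd[OF False] by simp
    then have "\<mu> n = mass a B V (Suc (k - 1 - Suc n mod k)) x" by (simp add: \<mu>_def anc_mass_def n_def)
    then show ?thesis using False by (auto simp: m_def n_def anc_mass_def intro!: sum.cong)
  qed
  have m0: "0 \<le> m i" for i using mass0 nonneg by (auto simp: m_def anc_mass_def)
  have down: "wt (x @ [i]) * (pot a B k (insert (x @ [i]) V) (x @ [i]) - pot a B k V x) \<le> - (?P * m i)"
    if i: "i \<in> {1..B} \<inter> {1..b}" for i
  proof (cases "x @ [i] \<in> V")
    case True
    let ?m = "anc_mass a B k V (x @ [i]) (Suc n)"
    have ins: "insert (x @ [i]) V = V" using True by auto
    have m: "0 \<le> ?m" using mass0 by (auto simp: anc_mass_def)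
    have w: "1 \<le> wt (x @ [i])" using wt_visited i True by auto
    show ?thesis
    proof (cases "k dvd Suc n")
      case dvd: True
      have "pot a B k V (x @ [i]) - pot a B k V x = - (?P * (1 - ?g) * ?m)"
        using pot_visited[OF True \<mu>_def n_def] dvd by (simp add: surv algebra_simps)
      moreover have "0 \<le> ?P * (1 - ?g) * ?m" using P g m by simp
      ultimately show ?thesis using w dvd True by (simp add: ins m_def mult_le_0_iff)
    next
      case False
      have "pot a B k V (x @ [i]) - pot a B k V x = - (?P * ?m)"
        using pot_visited[OF True \<mu>_def n_def] False by (simp add: surv algebra_simps)
      moreover have "1 * (?P * ?m) \<le> wt (x @ [i]) * (?P * ?m)"
        using P m w by (intro mult_right_mono) auto
      ultimately show ?thesis using False True by (simp add: ins m_def)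
    qed
  next
    case False
    let ?y = "x @ [i]" and ?w = "wt (x @ [i])"
    have w0: "0 \<le> ?w" using wt_new(1) i by auto
    have mi: "m i = a ?y" using False by (simp add: m_def)
    show ?thesis
    proof (cases "a ?y = 0")
      case True
      have e0: "ext ?y = 0" using ext[of i] True by simp
      have "pot a B k (insert ?y V) ?y = pot a B k V x"
      proof (cases "set ?y \<subseteq> {1..B}")
        case l: True
        show ?thesis
          using pot_unvisited[OF False closed[OF False] vis l k \<mu>_def n_def] True e0
          by (simp add: surv ext_def)
      next
        case nl: False
        have "a (x @ i # u) = 0" for u using letters[of "x @ i # u"] nl by auto
        then show ?thesis using False by (intro pot_insert_null) auto
      qed
      then show ?thesis using True mi by simp
    next
      case a: False
      then have l: "set ?y \<subseteq> {1..B}" using letters by blast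
      have w: "\<epsilon> \<le> ?w" using wt_new(2) i False a by auto
      have apos: "0 < a ?y" using a nonneg[of ?y] by simp
      have aw: "a ?y \<le> ?w * (a ?y / \<epsilon>)"
      proof -
        have "\<epsilon> * (a ?y / \<epsilon>) \<le> ?w * (a ?y / \<epsilon>)" using w apos eps by (intro mult_right_mono) auto
        then show ?thesis using eps by simp
      qed
      note p = pot_unvisited[OF False closed[OF False] vis l k \<mu>_def n_def]
      show ?thesis
      proof (cases "k dvd Suc n")
        case True
        have e: "ext ?y = 2 * (real k + 1 / \<epsilon>) * a ?y" using ext[of i] True n_def by simp
        have e0: "0 \<le> ext ?y" using e apos eps by simp
        \<comment> \<open>\<open>T\<close> is the drop of the potential in units of
          \<open>blk_prod\<close>. Since the weight is at least \<open>\<epsilon>\<close>, a drop of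
          at least \<open>a / \<epsilon>\<close> contributes at least the share \<open>a\<close> of
          this child.\<close>
        define T where "T = ext ?y * (1 - ?g + real k * a ?y) - real k * a ?y"
        have "pot a B k (insert ?y V) ?y - pot a B k V x
            = - (?P * T)"
          using p True by (simp add: T_def surv ext_def algebra_simps)
        moreover have "a ?y / \<epsilon> \<le> T"
        proof -
          have "ext ?y * (1 / 2) \<le> ext ?y * (1 - ?g + real k * a ?y)"
            using g(2) e0 mult_nonneg_nonneg[of "real k" "a ?y"] apos
            by (intro mult_left_mono) linarith+
          then show ?thesis unfolding T_def e by (simp add: algebra_simps)
        qed
        then have "?w * (a ?y / \<epsilon>) \<le> ?w * T"
          using w0 by (rule mult_left_mono)
        then have "?P * a ?y \<le> ?P * (?w * T)"
          using aw P by (intro mult_left_mono) linarith+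
        ultimately show ?thesis by (simp add: mi mult.left_commute)
      next
        case nd: False
        let ?e = "real (n mod k) + 1"
        have e: "ext ?y = (1 + 1 / (\<epsilon> * ?e)) * a ?y"
          using ext[of i] nd n_def mod_Suc_not_dvd[of k n] by (simp add: add.commute)
        define T where "T = (?e + 1) * ext ?y - ?e * a ?y"
        have "pot a B k (insert ?y V) ?y - pot a B k V x
            = - (?P * T)"
          using p nd by (simp add: T_def surv ext_def algebra_simps)
        moreover have "a ?y / \<epsilon> \<le> T"
        proof -
          have "?e * ext ?y = ?e * a ?y + a ?y / \<epsilon>" 
          proof -
            have "e * ((1 + 1 / (\<epsilon> * e)) * b) = e * b + b / \<epsilon>" if "0 < e" for e b :: real
              using eps that by (simp add: field_simps)
            from this[of ?e "a ?y"] show ?thesis unfolding e by simp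
          qed
          moreover have "0 \<le> ext ?y" using e apos eps by simp
          ultimately show ?thesis unfolding T_def by (simp add: algebra_simps)
        qed
        then have "?w * (a ?y / \<epsilon>) \<le> ?w * T"
          using w0 by (rule mult_left_mono)
        then have "?P * a ?y \<le> ?P * (?w * T)"
          using aw P by (intro mult_left_mono) linarith+
        ultimately show ?thesis by (simp add: mi mult.left_commute)
      qed
    qed
  qed
  have "(\<Sum>i\<in>{1..B} \<inter> {1..b}. wt (x @ [i]) * (pot a B k (insert (x @ [i]) V) (x @ [i]) - pot a B k V x))
      \<le> (\<Sum>i\<in>{1..B} \<inter> {1..b}. - (?P * m i))"
    by (rule sum_mono[OF down])
  also have "\<dots> = - (?P * (\<Sum>i\<in>{1..B} \<inter> {1..b}. m i))" by (simp add: sum_negf sum_distrib_left)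
  also have "(\<Sum>i\<in>{1..B} \<inter> {1..b}. m i) = (\<Sum>i=1..B. m i)"
    by (rule sum.mono_neutral_left) (auto simp: m_def beyond)
  finally show ?thesis using up \<mu>n by simp
qed

subsection \<open>Capped flows\<close>

text \<open>The maximal strength of a flow from \<open>\<nu>\<close> through \<open>S\<close> down
  \<open>r\<close> levels, computed from the leaves, when vertices \<open>n\<close> levels below
  \<open>\<nu>\<close> have capacity \<open>(1 / \<beta>) ^ n\<close>. The minimum with 1 is the
  capacity of \<open>\<nu>\<close>, and the division by \<open>\<beta>\<close> rescales the values
  of the children.\<close>

primrec cap_flow :: "real \<Rightarrow> nat \<Rightarrow> vertex set \<Rightarrow> nat \<Rightarrow> vertex \<Rightarrow> real" where
  "cap_flow \<beta> B S 0 \<nu> = 1"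
| "cap_flow \<beta> B S (Suc r) \<nu> =
     min 1 ((\<Sum>i=1..B. if \<nu> @ [i] \<in> S then cap_flow \<beta> B S r (\<nu> @ [i]) else 0) / \<beta>)"

lemma cap_flow_bounds:
  assumes "0 < \<beta>" shows "0 \<le> cap_flow \<beta> B S r \<nu>" "cap_flow \<beta> B S r \<nu> \<le> 1"
proof -
  show "0 \<le> cap_flow \<beta> B S r \<nu>"
    using assms by (induction r arbitrary: \<nu>) (auto intro!: divide_nonneg_pos sum_nonneg)
  show "cap_flow \<beta> B S r \<nu> \<le> 1" by (cases r) auto
qed

text \<open>Splitting in proportion to what the children can carry respects all capacities at once.
  If no child can carry anything, division by zero makes every ratio 0.\<close>

definition split_ratio :: "real \<Rightarrow> nat \<Rightarrow> vertex set \<Rightarrow> nat \<Rightarrow> vertex \<Rightarrow> nat \<Rightarrow> real" where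
  "split_ratio \<beta> B S N \<nu> i = (if i \<in> {1..B} \<and> \<nu> @ [i] \<in> S
     then cap_flow \<beta> B S (N - Suc (length \<nu>)) (\<nu> @ [i])
       / (\<Sum>j=1..B. if \<nu> @ [j] \<in> S then cap_flow \<beta> B S (N - Suc (length \<nu>)) (\<nu> @ [j]) else 0)
     else 0)"

text \<open>Vertices are extended at the end of the word, so the recursion runs over the reversed
  word.\<close>

primrec flow_rev :: "real \<Rightarrow> nat \<Rightarrow> vertex set \<Rightarrow> nat \<Rightarrow> vertex \<Rightarrow> real" where
  "flow_rev \<beta> B S N [] = cap_flow \<beta> B S N []"
| "flow_rev \<beta> B S N (i # \<nu>) = flow_rev \<beta> B S N \<nu> * split_ratio \<beta> B S N (rev \<nu>) i"

definition flow :: "real \<Rightarrow> nat \<Rightarrow> vertex set \<Rightarrow> nat \<Rightarrow> vertex \<Rightarrow> real" where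
  "flow \<beta> B S N \<nu> = flow_rev \<beta> B S N (rev \<nu>)"

lemma flow_Nil: "flow \<beta> B S N [] = cap_flow \<beta> B S N []"
  by (simp add: flow_def)

lemma flow_snoc: "flow \<beta> B S N (\<nu> @ [i]) = flow \<beta> B S N \<nu> * split_ratio \<beta> B S N \<nu> i"
  by (simp add: flow_def)

lemma flow_nonneg: "0 < \<beta> \<Longrightarrow> 0 \<le> flow \<beta> B S N \<nu>"
proof (induction \<nu> rule: rev_induct)
  case (snoc i \<nu>)
  then show ?case by (auto simp: flow_snoc split_ratio_def cap_flow_bounds intro!: mult_nonneg_nonneg
        divide_nonneg_nonneg sum_nonneg)
qed (simp add: flow_Nil cap_flow_bounds)

lemma flow_support:
  assumes "flow \<beta> B S N \<nu> \<noteq> 0"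
  shows "set \<nu> \<subseteq> {1..B}" "\<nu> \<noteq> [] \<Longrightarrow> \<nu> \<in> S"
proof -
  have "set \<nu> \<subseteq> {1..B} \<and> (\<nu> \<noteq> [] \<longrightarrow> \<nu> \<in> S)"
    using assms by (induction \<nu> rule: rev_induct) (auto simp: flow_snoc split_ratio_def split: if_splits)
  then show "set \<nu> \<subseteq> {1..B}" "\<nu> \<noteq> [] \<Longrightarrow> \<nu> \<in> S" by auto
qed

text \<open>Induction on the level. With \<Sigma> the sum of the capped flows of the children, the
  flow into \<open>\<nu>\<close> is at most
  \<open>(1 / \<beta>) ^ length \<nu> * (\<Sigma> / \<beta>)\<close>. The proportional split cancels
  \<Sigma> and leaves the child's own capped flow with one more factor
  \<open>1 / \<beta>\<close>.\<close>

lemma flow_le_cap: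
  assumes "0 < \<beta>" "length \<nu> \<le> N"
  shows "flow \<beta> B S N \<nu> \<le> (1 / \<beta>) ^ length \<nu> * cap_flow \<beta> B S (N - length \<nu>) \<nu>"
  using assms(2)
proof (induction \<nu> rule: rev_induct)
  case (snoc i \<nu>)
  define \<Sigma> where "\<Sigma> = (\<Sum>j=1..B. if \<nu> @ [j] \<in> S
      then cap_flow \<beta> B S (N - Suc (length \<nu>)) (\<nu> @ [j]) else 0)"
  have N: "N - length \<nu> = Suc (N - Suc (length \<nu>))" using snoc.prems by simp
  have c: "cap_flow \<beta> B S (N - length \<nu>) \<nu> \<le> \<Sigma> / \<beta>" unfolding N \<Sigma>_def by simp
  have \<Sigma>0: "0 \<le> \<Sigma>" unfolding \<Sigma>_def using assms(1) by (auto intro!: sum_nonneg simp: cap_flow_bounds)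
  have c0: "0 \<le> cap_flow \<beta> B S r y" for r y using cap_flow_bounds(1)[OF assms(1)] .
  show ?case
  proof (cases "i \<in> {1..B} \<and> \<nu> @ [i] \<in> S \<and> \<Sigma> \<noteq> 0")
    case True
    have "flow \<beta> B S N (\<nu> @ [i])
        \<le> ((1 / \<beta>) ^ length \<nu> * (\<Sigma> / \<beta>)) * (cap_flow \<beta> B S (N - Suc (length \<nu>)) (\<nu> @ [i]) / \<Sigma>)"
      unfolding flow_snoc split_ratio_def \<Sigma>_def[symmetric]
    proof -
      have "flow \<beta> B S N \<nu> \<le> (1 / \<beta>) ^ length \<nu> * (\<Sigma> / \<beta>)"
        using snoc mult_left_mono[OF c, of "(1 / \<beta>) ^ length \<nu>"] assms(1) by simp
      then have "flow \<beta> B S N \<nu> * (cap_flow \<beta> B S (N - Suc (length \<nu>)) (\<nu> @ [i]) / \<Sigma>)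
        \<le> (1 / \<beta>) ^ length \<nu> * (\<Sigma> / \<beta>) * (cap_flow \<beta> B S (N - Suc (length \<nu>)) (\<nu> @ [i]) / \<Sigma>)"
        using \<Sigma>0 c0 by (intro mult_right_mono divide_nonneg_nonneg) auto
      then show "flow \<beta> B S N \<nu> * (if i \<in> {1..B} \<and> \<nu> @ [i] \<in> S
          then cap_flow \<beta> B S (N - Suc (length \<nu>)) (\<nu> @ [i]) / \<Sigma> else 0)
        \<le> (1 / \<beta>) ^ length \<nu> * (\<Sigma> / \<beta>) * (cap_flow \<beta> B S (N - Suc (length \<nu>)) (\<nu> @ [i]) / \<Sigma>)"
        using True by simp
    qed
    then show ?thesis using True by simp
  next
    case False
    then have "flow \<beta> B S N (\<nu> @ [i]) = 0"
      unfolding flow_snoc split_ratio_def \<Sigma>_def[symmetric] by auto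
    then show ?thesis using assms(1) c0 by simp
  qed
qed (simp add: flow_Nil)

lemma flow_le:
  assumes "1 \<le> \<beta>" "\<And>y. y \<in> S \<Longrightarrow> length y \<le> N"
  shows "flow \<beta> B S N \<nu> \<le> (1 / \<beta>) ^ length \<nu>"
proof (cases "length \<nu> \<le> N")
  case True
  have "(1 / \<beta>) ^ length \<nu> * cap_flow \<beta> B S (N - length \<nu>) \<nu> \<le> (1 / \<beta>) ^ length \<nu> * 1"
    using assms(1) cap_flow_bounds(2)[of \<beta>] by (intro mult_left_mono) auto
  then show ?thesis using flow_le_cap[of \<beta> \<nu> N B S] True assms(1) by linarith
next
  case False
  then have "flow \<beta> B S N \<nu> = 0" using flow_support(2)[of \<beta> B S N \<nu>] assms(2) by force
  then show ?thesis using assms(1) by simp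
qed

text \<open>The split loses mass only when no child can carry any. Before level \<open>N\<close> the
  capped flow of \<open>\<nu>\<close> is then zero, and by \<open>flow_le_cap\<close> there is no
  flow at \<open>\<nu>\<close> to lose.\<close>

lemma flow_children:
  assumes "0 < \<beta>"
  shows "(\<Sum>i=1..B. flow \<beta> B S N (\<nu> @ [i])) \<le> flow \<beta> B S N \<nu>"
    and "length \<nu> < N \<Longrightarrow> (\<Sum>i=1..B. flow \<beta> B S N (\<nu> @ [i])) = flow \<beta> B S N \<nu>"
proof -
  define \<Sigma> where "\<Sigma> = (\<Sum>j=1..B. if \<nu> @ [j] \<in> S
      then cap_flow \<beta> B S (N - Suc (length \<nu>)) (\<nu> @ [j]) else 0)"
  have "(\<Sum>i=1..B. split_ratio \<beta> B S N \<nu> i) = \<Sigma> / \<Sigma>"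
    unfolding \<Sigma>_def sum_divide_distrib split_ratio_def by (intro sum.cong) auto
  then have eq: "(\<Sum>i=1..B. flow \<beta> B S N (\<nu> @ [i])) = flow \<beta> B S N \<nu> * (\<Sigma> / \<Sigma>)"
    by (simp add: flow_snoc flip: sum_distrib_left)
  show "(\<Sum>i=1..B. flow \<beta> B S N (\<nu> @ [i])) \<le> flow \<beta> B S N \<nu>"
    unfolding eq using flow_nonneg[OF assms, of B S N \<nu>] by (cases "\<Sigma> = 0") auto
  assume N: "length \<nu> < N"
  show "(\<Sum>i=1..B. flow \<beta> B S N (\<nu> @ [i])) = flow \<beta> B S N \<nu>"
  proof (cases "\<Sigma> = 0")
    case True
    have "N - length \<nu> = Suc (N - Suc (length \<nu>))" using N by simp
    then have "cap_flow \<beta> B S (N - length \<nu>) \<nu> \<le> 0" using True by (simp add: \<Sigma>_def)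
    then have "flow \<beta> B S N \<nu> \<le> 0" using flow_le_cap[OF assms, of \<nu> N B S] N assms
      by (smt (verit) less_imp_le mult_nonneg_nonpos zero_le_divide_1_iff zero_le_power)
    then show ?thesis unfolding eq using flow_nonneg[OF assms, of B S N \<nu>] by simp
  next
    case False then show ?thesis unfolding eq by simp
  qed
qed

text \<open>A step to a new vertex at level \<open>e > 0\<close> of its block, where the frontier mass \<open>a\<close> is replaced by
  \<open>s\<close>, changes the block sum by \<open>(e + 1) s - e a\<close>. With \<open>s = (1 + 1 / (\<epsilon> e)) a\<close> this is at least \<open>a / \<epsilon>\<close>,
  which makes up for the loss \<open>a\<close> in a step to the parent. A step into the next block loses
  \<open>k a\<close> instead, and gains at least half of the new mass.\<close>

definition growth :: "real \<Rightarrow> nat \<Rightarrow> nat \<Rightarrow> real" where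
  "growth \<epsilon> k l = (if k dvd l then 2 * (real k + 1 / \<epsilon>) else 1 + 1 / (\<epsilon> * real (l mod k)))"

definition growth_prod :: "real \<Rightarrow> nat \<Rightarrow> nat \<Rightarrow> real" where
  "growth_prod \<epsilon> k l = (\<Prod>j<l. growth \<epsilon> k j)"

lemma growth_prod_Suc: "growth_prod \<epsilon> k (Suc l) = growth \<epsilon> k l * growth_prod \<epsilon> k l"
  by (simp add: growth_prod_def mult.commute)

lemma growth_ge_1: "0 < \<epsilon> \<Longrightarrow> 0 < k \<Longrightarrow> 1 \<le> growth \<epsilon> k l"
  by (cases k) (auto simp: growth_def)

lemma growth_prod_ge_1: "0 < \<epsilon> \<Longrightarrow> 0 < k \<Longrightarrow> 1 \<le> growth_prod \<epsilon> k l"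
  unfolding growth_prod_def by (intro prod_ge_1 growth_ge_1)

lemma growth_prod_mono:
  assumes "0 < \<epsilon>" "0 < k" "l \<le> l'" shows "growth_prod \<epsilon> k l \<le> growth_prod \<epsilon> k l'"
  using assms(3)
proof (rule lift_Suc_mono_le[rotated])
  show "growth_prod \<epsilon> k n \<le> growth_prod \<epsilon> k (Suc n)" for n
    using mult_right_mono[OF growth_ge_1[OF assms(1,2), of n], of "growth_prod \<epsilon> k n"]
      growth_prod_ge_1[OF assms(1,2), of n] by (simp add: growth_prod_Suc)
qed

lemma growth_prod_periodic: "growth_prod \<epsilon> k (j * k) = growth_prod \<epsilon> k k ^ j"
proof -
  have per: "growth \<epsilon> k (j * k + l) = growth \<epsilon> k l" for j l
    by (simp add: growth_def)
  have "growth_prod \<epsilon> k (j * k + l) = growth_prod \<epsilon> k (j * k) * growth_prod \<epsilon> k l" for j l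
    by (induction l) (simp_all add: growth_prod_Suc per, simp add: growth_prod_def)
  then show ?thesis by (induction j) (simp_all add: growth_prod_def add.commute[of k])
qed

text \<open>Within a block of length \<open>k\<close> the product of the growth factors is polynomial in \<open>k\<close>.\<close>

lemma ex_growth_prod_le_power:
  assumes eps: "0 < \<epsilon>" and lam: "1 < \<beta>"
  shows "\<exists>k>0. growth_prod \<epsilon> k k \<le> \<beta> ^ k"
proof -
  \<comment> \<open>For \<open>k > 0\<close> this is
    \<open>growth_prod \<epsilon> k k / \<beta> ^ k\<close>. Its successive quotients tend to
    \<open>1 / \<beta>\<close>, so \<open>c / \<beta>\<close> with \<open>c\<close> strictly between
    1 and \<open>\<beta>\<close> serves in the ratio test.\<close>
  define u where "u k = 2 * (real k + 1 / \<epsilon>) * (\<Prod>e\<in>{1..<k}. 1 + 1 / (\<epsilon> * real e)) / \<beta> ^ k" for k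
  define c where "c = (1 + \<beta>) / 2"
  have c: "1 < c" "c / \<beta> < 1" using lam by (auto simp: c_def field_simps)
  have upos: "0 < u k" if "0 < k" for k
    using eps lam that by (auto simp: u_def intro!: divide_pos_pos mult_pos_pos prod_pos add_pos_pos)
  have ratio: "u (Suc k) = ((real (Suc k) + 1 / \<epsilon>) / (real k + 1 / \<epsilon>) * (1 + 1 / (\<epsilon> * real k)) / \<beta>) * u k"
    if "0 < k" for k
  proof -
    have pos: "0 < real k + 1 / \<epsilon>" using eps by (simp add: add_nonneg_pos)
    have frac: "2 * d' * (p * f) / (\<beta> * b) = (d' / d * f / \<beta>) * (2 * d * p / b)"
      if "0 < d" for d d' p f b :: real using that by simp
    have prod: "(\<Prod>e\<in>{1..<Suc k}. 1 + 1 / (\<epsilon> * real e))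
        = (\<Prod>e\<in>{1..<k}. 1 + 1 / (\<epsilon> * real e)) * (1 + 1 / (\<epsilon> * real k))"
      using that by (simp add: prod.atLeastLessThan_Suc)
    show ?thesis unfolding u_def prod power_Suc by (rule frac[OF pos])
  qed
  have "(\<lambda>k. (real (Suc k) + 1 / \<epsilon>) / (real k + 1 / \<epsilon>) * (1 + 1 / (\<epsilon> * real k))) \<longlonglongrightarrow> 1"
  proof -
    have inv: "(\<lambda>k. inverse (c + real k)) \<longlonglongrightarrow> 0" for c :: real
      by (intro tendsto_inverse_0_at_top filterlim_tendsto_add_at_top[OF tendsto_const]
          filterlim_real_sequentially)
    have "(real (Suc k) + 1 / \<epsilon>) / (real k + 1 / \<epsilon>) * (1 + 1 / (\<epsilon> * real k))
        = (1 + inverse (1 / \<epsilon> + real k)) * (1 + inverse \<epsilon> * inverse (0 + real k))" for k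
    proof -
      have "0 < real k + 1 / \<epsilon>" using eps by (simp add: add_nonneg_pos)
      then have "(real (Suc k) + 1 / \<epsilon>) / (real k + 1 / \<epsilon>) = 1 + inverse (1 / \<epsilon> + real k)"
        by (simp add: divide_simps add_ac)
      then show ?thesis by (simp add: divide_inverse)
    qed
    moreover have "(\<lambda>k. (1 + inverse (1 / \<epsilon> + real k)) * (1 + inverse \<epsilon> * inverse (0 + real k)))
        \<longlonglongrightarrow> (1 + 0) * (1 + inverse \<epsilon> * 0)"
      by (intro tendsto_intros inv)
    ultimately show ?thesis by simp
  qed
  then have "\<forall>\<^sub>F k in sequentially. (real (Suc k) + 1 / \<epsilon>) / (real k + 1 / \<epsilon>) * (1 + 1 / (\<epsilon> * real k)) < c"
    using c(1) by (rule order_tendstoD)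
  then obtain k0 where k0: "\<And>k. k \<ge> k0 \<Longrightarrow>
      (real (Suc k) + 1 / \<epsilon>) / (real k + 1 / \<epsilon>) * (1 + 1 / (\<epsilon> * real k)) < c"
    unfolding eventually_sequentially by blast
  have "summable u"
  proof (rule summable_ratio_test[OF c(2), of "Suc k0"])
    fix k assume k: "Suc k0 \<le> k"
    then have "0 < k" by simp
    have "((real (Suc k) + 1 / \<epsilon>) / (real k + 1 / \<epsilon>) * (1 + 1 / (\<epsilon> * real k)) / \<beta>) * u k \<le> (c / \<beta>) * u k"
      using k0[of k] k lam upos[OF \<open>0 < k\<close>] by (intro mult_right_mono divide_right_mono) auto
    then have "u (Suc k) \<le> c / \<beta> * u k" by (simp only: ratio[OF \<open>0 < k\<close>])
    moreover have "norm (u (Suc k)) = u (Suc k)" "norm (u k) = u k"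
      using upos[OF \<open>0 < k\<close>] upos[of "Suc k"] by (simp_all only: real_norm_def abs_of_pos zero_less_Suc)
    ultimately show "norm (u (Suc k)) \<le> c / \<beta> * norm (u k)" by (simp only:)
  qed
  then have "u \<longlonglongrightarrow> 0" by (rule summable_LIMSEQ_zero)
  then have "\<forall>\<^sub>F k in sequentially. u k < 1" by (rule order_tendstoD) simp
  then obtain k1 where k1: "\<And>k. k1 \<le> k \<Longrightarrow> u k < 1" unfolding eventually_sequentially by blast
  define k where "k = Suc k1"
  have k: "0 < k" "u k < 1" using k1[of k] by (simp_all add: k_def)
  have "growth_prod \<epsilon> k k = growth \<epsilon> k 0 * (\<Prod>j\<in>{1..<k}. growth \<epsilon> k j)"
    unfolding growth_prod_def lessThan_atLeast0
    using prod.atLeast_Suc_lessThan[OF k(1), of "growth \<epsilon> k"] by simp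
  also have "(\<Prod>j\<in>{1..<k}. growth \<epsilon> k j) = (\<Prod>e\<in>{1..<k}. 1 + 1 / (\<epsilon> * real e))"
    by (intro prod.cong) (auto simp: growth_def dest: dvd_imp_le)
  finally have "growth_prod \<epsilon> k k = u k * \<beta> ^ k" using lam by (simp add: growth_def u_def)
  also have "\<dots> \<le> 1 * \<beta> ^ k" using k(2) lam by (intro mult_right_mono) auto
  finally show ?thesis using k(1) by auto
qed

text \<open>The denominator is the normalisation required by \<open>blk_sum_le_half\<close>:
  \<open>2 * real k\<close> is the factor in that bound, and
  \<open>growth_prod \<epsilon> k k\<close> pays for the growth within one block, before the
  capacities take effect.\<close>

definition potw :: "real \<Rightarrow> nat \<Rightarrow> real \<Rightarrow> nat \<Rightarrow> vertex set \<Rightarrow> nat \<Rightarrow> vertex \<Rightarrow> real" where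
  "potw \<epsilon> k \<beta> B S N \<nu> =
     flow \<beta> B S N \<nu> * growth_prod \<epsilon> k (length \<nu>) / (2 * real k * growth_prod \<epsilon> k k)"

context
  fixes \<epsilon> \<beta> :: real and k B N :: nat and S :: "vertex set"
  assumes eps: "0 < \<epsilon>" and k: "0 < k" and lam: "1 < \<beta>" and kl: "growth_prod \<epsilon> k k \<le> \<beta> ^ k"
    and SN: "\<And>y. y \<in> S \<Longrightarrow> length y \<le> N"
begin

lemma growth_prod_pos: "0 < growth_prod \<epsilon> k l"
  using growth_prod_ge_1[OF eps k, of l] by simp

lemma potw_nonneg: "0 \<le> potw \<epsilon> k \<beta> B S N y"
  unfolding potw_def using flow_nonneg[of \<beta> B S N y] lam growth_prod_pos
  by (intro divide_nonneg_nonneg mult_nonneg_nonneg less_imp_le[OF growth_prod_pos]) auto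

lemma potw_support:
  assumes "potw \<epsilon> k \<beta> B S N y \<noteq> 0" shows "set y \<subseteq> {1..B}" "y \<noteq> [] \<Longrightarrow> y \<in> S"
  using assms flow_support[of \<beta> B S N y] by (auto simp: potw_def)

text \<open>If \<open>z\<close> lies in block \<open>j\<close>, the vertices that count have level
  at most \<open>(j + 1) * k\<close>, so their growth is at most
  \<open>growth_prod \<epsilon> k k ^ (j + 1)\<close>, while the flow at \<open>z\<close> is at most
  \<open>(1 / \<beta>) ^ (j * k)\<close>. One growth factor cancels with the denominator, and
  \<open>kl\<close> bounds the other \<open>j\<close>.\<close>

lemma potw_mass_le:
  "mass (potw \<epsilon> k \<beta> B S N) B V (k - 1 - length z mod k) z \<le> 1 / (2 * real k)"
proof -
  define j where "j = length z div k"
  define C where "C = growth_prod \<epsilon> k ((j + 1) * k)"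
  let ?D = "2 * real k * growth_prod \<epsilon> k k"
  have D: "0 < ?D" using growth_prod_pos k by simp
  have "length z mod k + k * j = length z" by (simp add: j_def)
  then have le: "length z + Suc (k - 1 - length z mod k) = (j + 1) * k"
    using mod_less_divisor[OF k, of "length z"] by (simp add: algebra_simps)
  have "mass (potw \<epsilon> k \<beta> B S N) B V (k - 1 - length z mod k) z \<le> (C / ?D) * flow \<beta> B S N z"
  proof (rule mass_le)
    show "0 \<le> flow \<beta> B S N y" "(\<Sum>i=1..B. flow \<beta> B S N (y @ [i])) \<le> flow \<beta> B S N y" for y
      using flow_nonneg flow_children(1) lam by auto
    show "0 \<le> C / ?D" using D growth_prod_pos[of "(j + 1) * k"] by (simp add: C_def)
    fix y :: vertex assume "length y \<le> length z + Suc (k - 1 - length z mod k)"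
    then have "growth_prod \<epsilon> k (length y) \<le> C" unfolding C_def le by (rule growth_prod_mono[OF eps k])
    then have "flow \<beta> B S N y * growth_prod \<epsilon> k (length y) / ?D \<le> flow \<beta> B S N y * C / ?D"
      using D flow_nonneg[of \<beta> B S N y] lam by (intro divide_right_mono mult_left_mono) auto
    then show "potw \<epsilon> k \<beta> B S N y \<le> C / ?D * flow \<beta> B S N y" by (simp add: potw_def mult.commute)
  qed
  also have "\<dots> \<le> (C / ?D) * (1 / \<beta>) ^ length z"
    using D growth_prod_pos[of "(j + 1) * k"] flow_le[of \<beta> S N B z] lam SN
    by (intro mult_left_mono) (auto simp: C_def)
  also have "\<dots> \<le> (C / ?D) * (1 / \<beta>) ^ (j * k)"
    using D growth_prod_pos[of "(j + 1) * k"] lam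
    by (intro mult_left_mono power_decreasing) (auto simp: C_def j_def)
  also have "\<dots> = growth_prod \<epsilon> k k ^ j * (1 / \<beta>) ^ (j * k) / (2 * real k)"
    unfolding C_def growth_prod_periodic using growth_prod_pos[of k] by simp
  also have "\<dots> \<le> 1 / (2 * real k)"
  proof -
    have "growth_prod \<epsilon> k k ^ j \<le> (\<beta> ^ k) ^ j"
      using kl growth_prod_pos[of k] by (intro power_mono) auto
    then have "growth_prod \<epsilon> k k ^ j * (1 / \<beta>) ^ (j * k) \<le> (\<beta> ^ k) ^ j * (1 / \<beta>) ^ (j * k)"
      using lam by (intro mult_right_mono) auto
    also have "\<dots> = 1" using lam by (simp add: power_mult[symmetric] power_mult_distrib[symmetric] mult.commute flip: power_mult)
    finally show ?thesis using k by (intro divide_right_mono) auto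
  qed
  finally show ?thesis .
qed

lemma potw_children:
  assumes "length y < N"
  shows "(\<Sum>i=1..B. potw \<epsilon> k \<beta> B S N (y @ [i])) = growth \<epsilon> k (length y) * potw \<epsilon> k \<beta> B S N y"
proof -
  have "(\<Sum>i=1..B. potw \<epsilon> k \<beta> B S N (y @ [i])) = (\<Sum>i=1..B. flow \<beta> B S N (y @ [i]))
      * growth_prod \<epsilon> k (Suc (length y)) / (2 * real k * growth_prod \<epsilon> k k)"
    unfolding potw_def sum_divide_distrib sum_distrib_right length_append_singleton ..
  also have "(\<Sum>i=1..B. flow \<beta> B S N (y @ [i])) = flow \<beta> B S N y"
    using flow_children(2)[of \<beta> y N B S] lam assms by simp
  finally show ?thesis unfolding potw_def growth_prod_Suc
    by (simp only: times_divide_eq_right mult.left_commute)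
qed

lemma pot_bounds:
  "0 \<le> pot (potw \<epsilon> k \<beta> B S N) B k V x" "pot (potw \<epsilon> k \<beta> B S N) B k V x \<le> 1"
proof -
  have "0 \<le> anc_mass (potw \<epsilon> k \<beta> B S N) B k V x l \<and> anc_mass (potw \<epsilon> k \<beta> B S N) B k V x l \<le> 1 / (2 * real k)"
    if "l \<le> length x" for l
    using mass_nonneg[OF potw_nonneg] potw_mass_le[of V "take l x"] that
    by (simp add: anc_mass_def min_absorb2)
  from survp_bounds[OF this k]
  show "0 \<le> pot (potw \<epsilon> k \<beta> B S N) B k V x" "pot (potw \<epsilon> k \<beta> B S N) B k V x \<le> 1"
    by (simp_all add: pot_def)
qed

lemma pot_start:
  assumes "0 < N"
  shows "1 - pot (potw \<epsilon> k \<beta> B S N) B k {[]} []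
    = (real k + 1 / \<epsilon>) / (real k * growth_prod \<epsilon> k k) * cap_flow \<beta> B S N []"
proof -
  have "1 - pot (potw \<epsilon> k \<beta> B S N) B k {[]} [] = (\<Sum>i=1..B. potw \<epsilon> k \<beta> B S N [i])"
    using mass_fresh[of "[]" "{[]}"] by (simp add: pot_def survp_def anc_mass_def)
  also have "\<dots> = 2 * (real k + 1 / \<epsilon>) * potw \<epsilon> k \<beta> B S N []"
    using potw_children[of "[]"] assms by (simp add: growth_def)
  also have "\<dots> = (real k + 1 / \<epsilon>) / (real k * growth_prod \<epsilon> k k) * cap_flow \<beta> B S N []"
  proof -
    have cancel: "2 * c * (x * 1 / (2 * r * g)) = c / (r * g) * x" for c x r g :: real by simp
    have one: "growth_prod \<epsilon> k (length ([] :: vertex)) = 1" by (simp add: growth_prod_def)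
    show ?thesis unfolding potw_def flow_Nil one by (rule cancel)
  qed
  finally show ?thesis .
qed

end

subsection \<open>Energy bound for capped flows\<close>

abbreviation lcp :: "'a list \<Rightarrow> 'a list \<Rightarrow> nat" where
  "lcp xs ys \<equiv> length (longest_common_prefix xs ys)"

lemma lcp_snoc:
  assumes "length xs = length ys"
  shows "xs \<noteq> ys \<Longrightarrow> lcp (xs @ [a]) (ys @ [b]) = lcp xs ys"
    and "a \<noteq> b \<Longrightarrow> lcp (xs @ [a]) (xs @ [b]) = length xs"
proof -
  show "xs \<noteq> ys \<Longrightarrow> lcp (xs @ [a]) (ys @ [b]) = lcp xs ys"
    using assms by (induction xs ys rule: list_induct2) auto
  show "a \<noteq> b \<Longrightarrow> lcp (xs @ [a]) (xs @ [b]) = length xs" by (induction xs) auto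
qed

lemma lcp_same: "lcp xs xs = length xs"
  by (induction xs) auto

definition words :: "nat \<Rightarrow> nat \<Rightarrow> vertex set" where
  "words B n = {\<tau>. set \<tau> \<subseteq> {1..B} \<and> length \<tau> = n}"

lemma finite_words [simp]: "finite (words B n)"
  unfolding words_def by (rule finite_lists_length_eq) simp

lemma words_0 [simp]: "words B 0 = {[]}"
  by (auto simp: words_def)

lemma sum_words_Cons: "(\<Sum>\<tau>\<in>words B (Suc n). f \<tau>) = (\<Sum>i=1..B. \<Sum>\<tau>\<in>words B n. f (i # \<tau>))"
proof -
  have "words B (Suc n) = (\<lambda>(i, \<tau>). i # \<tau>) ` ({1..B} \<times> words B n)"
    by (auto simp: words_def length_Suc_conv image_iff)
  then show ?thesis
    by (simp add: sum.reindex inj_on_def sum.cartesian_product case_prod_unfold)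
qed

lemma sum_words_snoc: "(\<Sum>\<tau>\<in>words B (Suc n). f \<tau>) = (\<Sum>\<tau>\<in>words B n. \<Sum>i=1..B. f (\<tau> @ [i]))"
proof -
  have "words B (Suc n) = (\<lambda>(\<tau>, i). \<tau> @ [i]) ` (words B n \<times> {1..B})"
    by (auto simp: words_def length_Suc_conv_rev image_iff)
  then show ?thesis
    by (simp add: sum.reindex inj_on_def sum.cartesian_product case_prod_unfold)
qed

text \<open>The energy of the weights \<open>w\<close>, namely the sum over all vertices of \<open>\<beta>\<close> to the power of the
  level times the squared flow through the vertex, written as a sum over pairs of leaves.\<close>

definition pair_kernel :: "real \<Rightarrow> vertex \<Rightarrow> vertex \<Rightarrow> real" where
  "pair_kernel \<beta> \<sigma> \<tau> = (\<Sum>j\<le>lcp \<sigma> \<tau>. \<beta> ^ j)"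

definition energy :: "real \<Rightarrow> nat \<Rightarrow> (vertex \<Rightarrow> real) \<Rightarrow> nat \<Rightarrow> vertex \<Rightarrow> real" where
  "energy \<beta> B w r \<nu> = (\<Sum>\<sigma>\<in>words B r. \<Sum>\<tau>\<in>words B r. w (\<nu> @ \<sigma>) * w (\<nu> @ \<tau>) * pair_kernel \<beta> \<sigma> \<tau>)"

lemma pair_kernel_Cons:
  "pair_kernel \<beta> (i # \<sigma>) (j # \<tau>) = 1 + (if i = j then \<beta> * pair_kernel \<beta> \<sigma> \<tau> else 0)"
  by (simp add: pair_kernel_def sum_distrib_left sum.atMost_Suc_shift del: sum.atMost_Suc)

lemma pair_kernel_le:
  assumes "1 < \<beta>" shows "pair_kernel \<beta> \<sigma> \<tau> \<le> \<beta> / (\<beta> - 1) * \<beta> ^ lcp \<sigma> \<tau>"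
proof -
  have "(\<Sum>j\<le>n. \<beta> ^ j) \<le> \<beta> / (\<beta> - 1) * \<beta> ^ n" for n
  proof -
    have "(\<Sum>j\<le>n. \<beta> ^ j) = (\<beta> ^ Suc n - 1) / (\<beta> - 1)"
      using geometric_sum[of \<beta> "Suc n"] assms by (simp only: lessThan_Suc_atMost)
    also have "\<dots> \<le> \<beta> ^ Suc n / (\<beta> - 1)" using assms by (intro divide_right_mono) auto
    finally show ?thesis by simp
  qed
  then show ?thesis by (simp add: pair_kernel_def)
qed

text \<open>All pairs of leaves share \<open>\<nu>\<close>, which gives the square. Only pairs
  through the same child share more, and their common part is one level deeper, hence
  \<open>\<beta>\<close>.\<close>

lemma energy_Suc:
  "energy \<beta> B w (Suc r) \<nu> = (\<Sum>\<tau>\<in>words B (Suc r). w (\<nu> @ \<tau>))\<^sup>2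
     + \<beta> * (\<Sum>i=1..B. energy \<beta> B w r (\<nu> @ [i]))"
proof -
  have "energy \<beta> B w (Suc r) \<nu> = (\<Sum>i=1..B. \<Sum>\<sigma>\<in>words B r. \<Sum>j=1..B. \<Sum>\<tau>\<in>words B r.
      w (\<nu> @ i # \<sigma>) * w (\<nu> @ j # \<tau>)
      + (if i = j then \<beta> * (w (\<nu> @ i # \<sigma>) * w (\<nu> @ i # \<tau>) * pair_kernel \<beta> \<sigma> \<tau>) else 0))"
    unfolding energy_def sum_words_Cons by (intro sum.cong refl) (auto simp: pair_kernel_Cons algebra_simps)
  also have "\<dots> = (\<Sum>i=1..B. \<Sum>\<sigma>\<in>words B r. \<Sum>j=1..B. \<Sum>\<tau>\<in>words B r. w (\<nu> @ i # \<sigma>) * w (\<nu> @ j # \<tau>))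
      + (\<Sum>i=1..B. \<Sum>\<sigma>\<in>words B r. \<Sum>j=1..B. if i = j then \<Sum>\<tau>\<in>words B r.
      \<beta> * (w (\<nu> @ i # \<sigma>) * w (\<nu> @ i # \<tau>) * pair_kernel \<beta> \<sigma> \<tau>) else 0)"
    unfolding sum.distrib[symmetric] by (intro sum.cong refl) (auto simp: sum.distrib)
  also have "(\<Sum>i=1..B. \<Sum>\<sigma>\<in>words B r. \<Sum>j=1..B. \<Sum>\<tau>\<in>words B r. w (\<nu> @ i # \<sigma>) * w (\<nu> @ j # \<tau>))
      = (\<Sum>\<tau>\<in>words B (Suc r). w (\<nu> @ \<tau>))\<^sup>2"
    unfolding power2_eq_square sum_words_Cons sum_distrib_left sum_distrib_right
    by (intro sum.cong refl mult.commute)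
  also have "(\<Sum>i=1..B. \<Sum>\<sigma>\<in>words B r. \<Sum>j=1..B. if i = j then \<Sum>\<tau>\<in>words B r.
      \<beta> * (w (\<nu> @ i # \<sigma>) * w (\<nu> @ i # \<tau>) * pair_kernel \<beta> \<sigma> \<tau>) else 0)
      = \<beta> * (\<Sum>i=1..B. energy \<beta> B w r (\<nu> @ [i]))"
    unfolding energy_def by (simp add: sum_distrib_left)
  finally show ?thesis .
qed

lemma energy_nonneg: "0 \<le> \<beta> \<Longrightarrow> 0 \<le> energy \<beta> B w r \<nu>"
proof (induction r arbitrary: \<nu>)
  case (Suc r)
  then show ?case by (auto simp: energy_Suc intro!: add_nonneg_nonneg mult_nonneg_nonneg sum_nonneg)
qed (simp add: energy_def pair_kernel_def)

lemma sum_squared_le: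
  fixes x f e :: "'i \<Rightarrow> real"
  assumes "finite I" "\<And>i. i \<in> I \<Longrightarrow> 0 \<le> f i" "\<And>i. i \<in> I \<Longrightarrow> 0 \<le> e i"
    "\<And>i. i \<in> I \<Longrightarrow> (x i)\<^sup>2 \<le> f i * e i"
  shows "(\<Sum>i\<in>I. x i)\<^sup>2 \<le> (\<Sum>i\<in>I. f i) * (\<Sum>i\<in>I. e i)"
proof -
  have "\<bar>\<Sum>i\<in>I. x i\<bar> \<le> (\<Sum>i\<in>I. \<bar>sqrt (f i)\<bar> * \<bar>sqrt (e i)\<bar>)"
    using assms by (intro order_trans[OF sum_abs] sum_mono)
      (simp add: real_sqrt_mult[symmetric] real_le_rsqrt)
  also have "\<dots> \<le> L2_set (\<lambda>i. sqrt (f i)) I * L2_set (\<lambda>i. sqrt (e i)) I"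
    by (rule L2_set_mult_ineq)
  also have "\<dots> = sqrt ((\<Sum>i\<in>I. f i) * (\<Sum>i\<in>I. e i))"
    using assms by (simp add: L2_set_def real_sqrt_mult)
  finally show ?thesis
    using assms by (metis sqrt_le_D real_sqrt_abs real_sqrt_le_iff)
qed

text \<open>Induction from the leaves, with one estimate for each argument of the minimum in
  \<open>cap_flow\<close>. Cauchy-Schwarz over the children gives the bound with their capped flows
  divided by \<open>\<beta>\<close>; the square in \<open>energy_Suc\<close> alone gives the bound
  with factor 1.\<close>

lemma cap_flow_energy:
  assumes \<beta>: "1 < \<beta>" and w: "\<And>\<sigma> \<tau>. \<sigma> \<noteq> [] \<Longrightarrow> \<sigma> \<notin> S \<Longrightarrow> w (\<sigma> @ \<tau>) = 0"
  shows "(\<Sum>\<tau>\<in>words B r. w (\<nu> @ \<tau>))\<^sup>2 \<le> cap_flow \<beta> B S r \<nu> * energy \<beta> B w r \<nu>"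
proof (induction r arbitrary: \<nu>)
  case 0
  then show ?case by (simp add: energy_def pair_kernel_def power2_eq_square)
next
  case (Suc r)
  let ?c = "\<lambda>i. if \<nu> @ [i] \<in> S then cap_flow \<beta> B S r (\<nu> @ [i]) else 0"
  let ?W = "\<lambda>i. \<Sum>\<tau>\<in>words B r. w ((\<nu> @ [i]) @ \<tau>)"
  let ?T = "\<Sum>\<tau>\<in>words B (Suc r). w (\<nu> @ \<tau>)" and ?E = "\<Sum>i=1..B. energy \<beta> B w r (\<nu> @ [i])"
  have E0: "0 \<le> energy \<beta> B w r y" "0 \<le> ?E" for r y using energy_nonneg \<beta> by (auto intro!: sum_nonneg)
  have c0: "0 \<le> ?c i" for i using cap_flow_bounds[of \<beta>] \<beta> by auto
  have eT: "?T = (\<Sum>i=1..B. ?W i)" by (simp add: sum_words_Cons)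
  have "?T\<^sup>2 \<le> (\<Sum>i=1..B. ?c i) * ?E"
    unfolding eT
  proof (rule sum_squared_le)
    fix i
    show "(?W i)\<^sup>2 \<le> ?c i * energy \<beta> B w r (\<nu> @ [i])"
    proof (cases "\<nu> @ [i] \<in> S")
      case True then show ?thesis using Suc.IH[of "\<nu> @ [i]"] by simp
    next
      case False
      then have "?W i = 0" using w[of "\<nu> @ [i]"] by (intro sum.neutral) simp
      then show ?thesis using False by simp
    qed
  qed (use E0 c0 in auto)
  also have "\<dots> = ((\<Sum>i=1..B. ?c i) / \<beta>) * (\<beta> * ?E)" using \<beta> by simp
  also have "\<dots> \<le> ((\<Sum>i=1..B. ?c i) / \<beta>) * energy \<beta> B w (Suc r) \<nu>"
    using \<beta> c0 by (intro mult_left_mono) (auto simp: energy_Suc intro!: sum_nonneg divide_nonneg_pos)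
  finally have 1: "?T\<^sup>2 \<le> ((\<Sum>i=1..B. ?c i) / \<beta>) * energy \<beta> B w (Suc r) \<nu>" .
  have 2: "?T\<^sup>2 \<le> 1 * energy \<beta> B w (Suc r) \<nu>"
    using \<beta> E0 by (simp add: energy_Suc)
  show ?case using 1 2 by (simp add: min_def)
qed

subsection \<open>Probabilities in the tree\<close>

lemma tree_Nil [simp]: "[] \<in> tree f"
  by (simp add: tree_def)

lemma tree_snoc: "\<nu> @ [i] \<in> tree f \<longleftrightarrow> \<nu> \<in> tree f \<and> 1 \<le> i \<and> i \<le> f \<nu>"
proof -
  have "(\<forall>k<Suc (length \<nu>). (\<nu> @ [i]) ! k \<in> {1..f (take k (\<nu> @ [i]))})
    \<longleftrightarrow> (\<forall>k<length \<nu>. \<nu> ! k \<in> {1..f (take k \<nu>)}) \<and> i \<in> {1..f \<nu>}"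
    by (auto simp: less_Suc_eq nth_append)
  then show ?thesis by (simp add: tree_def)
qed

lemma tree_take: "\<nu> \<in> tree f \<Longrightarrow> take l \<nu> \<in> tree f"
  by (auto simp: tree_def min_def)

context once_changing_walk
begin

abbreviation in_tree :: "vertex \<Rightarrow> 'w \<Rightarrow> bool" where
  "in_tree \<nu> \<omega> \<equiv> \<nu> \<in> tree (\<lambda>\<mu>. bn \<mu> \<omega>)"

abbreviation tree_event :: "vertex \<Rightarrow> 'w set" where
  "tree_event \<nu> \<equiv> {\<omega> \<in> space P. in_tree \<nu> \<omega>}"

definition tree_algebra :: "'w measure" where
  "tree_algebra = sigma (space P) (tree_events P bn)"

lemma bn_measurable [measurable]: "bn \<nu> \<in> P \<rightarrow>\<^sub>M count_space UNIV"
  using offspring_indep unfolding indep_vars_def by auto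

lemma tree_event_sets [measurable]: "tree_event \<nu> \<in> sets P"
proof (induction \<nu> rule: rev_induct)
  case (snoc i \<nu>)
  have "tree_event (\<nu> @ [i]) = tree_event \<nu> \<inter> (bn \<nu> -` {n. 1 \<le> i \<and> i \<le> n} \<inter> space P)"
    by (auto simp: tree_snoc)
  then show ?case using snoc by (simp del: vimage_Collect_eq)
qed simp

lemma env_event_sets: "C \<in> sets env_space \<Longrightarrow> {\<omega> \<in> space P. in_tree \<nu> \<omega> \<and> Z \<nu> \<omega> \<in> C} \<in> sets P"
  using measurable_sets[OF env_measurable[of \<nu>], of C] tree_event_sets[of \<nu>]
    sets.Int[of "tree_event \<nu>" P "Z \<nu> -` C \<inter> space P"] by (auto simp: Int_def conj_ac)

lemma tree_events_sub: "tree_events P bn \<subseteq> sets P"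
  using tree_event_sets by (auto simp: tree_events_def)

lemma env_events_sub: "env_events P bn Z V \<subseteq> sets P"
  using env_event_sets by (auto simp: env_events_def)

lemma sigma_subalgebra: "A \<subseteq> sets P \<Longrightarrow> subalgebra P (sigma (space P) A)"
  using sets.space_closed[of P] sets.sigma_sets_subset[of A P]
  by (simp add: subalgebra_def space_measure_of_conv sets_measure_of[OF order_trans])

lemma sigma_generated: "A \<subseteq> sets P \<Longrightarrow> E \<in> A \<Longrightarrow> E \<in> sets (sigma (space P) A)"
  using sets.sets_into_space by (subst sets_measure_of) auto

lemma sigma_mono: "A \<subseteq> B \<Longrightarrow> B \<subseteq> sets P \<Longrightarrow> sets (sigma (space P) A) \<subseteq> sets (sigma (space P) B)"
  using sets.sets_into_space[of _ P]
  by (subst (1 2) sets_measure_of) (auto intro!: sigma_sets_mono')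

lemma past_sub: "tree_events P bn \<union> env_events P bn Z (before_offspring \<nu>) \<subseteq> sets P"
  using tree_events_sub env_events_sub by blast

lemma past_subalgebra: "subalgebra P (past_of_offspring P bn Z \<nu>)"
  unfolding past_of_offspring_def by (rule sigma_subalgebra[OF past_sub])

lemma past_space [simp]: "space (past_of_offspring P bn Z \<nu>) = space P"
  using past_subalgebra by (simp add: subalgebra_def)

lemma tree_algebra_past: "E \<in> sets tree_algebra \<Longrightarrow> E \<in> sets (past_of_offspring P bn Z \<nu>)"
  using sigma_mono[OF _ past_sub[of \<nu>], of "tree_events P bn"]
  by (auto simp: tree_algebra_def past_of_offspring_def)

lemma tree_algebra_sets: "E \<in> sets tree_algebra \<Longrightarrow> E \<in> sets P"
  using tree_algebra_past past_subalgebra by (auto simp: subalgebra_def)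

lemma tree_event_algebra: "tree_event \<nu> \<in> sets tree_algebra"
  unfolding tree_algebra_def by (rule sigma_generated[OF tree_events_sub]) (auto simp: tree_events_def)

lemma env_event_past:
  assumes "\<mu> \<in> before_offspring \<nu>" "C \<in> sets env_space"
  shows "{\<omega> \<in> space P. in_tree \<mu> \<omega> \<and> Z \<mu> \<omega> \<in> C} \<in> sets (past_of_offspring P bn Z \<nu>)"
  unfolding past_of_offspring_def using assms
  by (intro sigma_generated[OF past_sub]) (auto simp: env_events_def)

lemma before_offspring_shorter: "length \<mu> \<le> length \<nu> \<Longrightarrow> \<mu> \<in> before_offspring \<nu>"
  by (cases \<mu> rule: rev_cases) (auto simp: before_offspring_def lenlex_conv)

lemma before_offspring_lenlex: "(\<mu>, \<nu>) \<in> lenlex less_than \<Longrightarrow> \<mu> @ [i] \<in> before_offspring \<nu>"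
  by (auto simp: before_offspring_def)

text \<open>The pasts record a value only on the event that its vertex is in the tree. The default 0
  elsewhere makes the function measurable for them, and the proof distinguishes whether the test set
  contains this default.\<close>

lemma env_function_measurable:
  assumes A: "space A = space P" "\<And>C. C \<in> sets env_space \<Longrightarrow> {\<omega> \<in> space P. in_tree \<nu> \<omega> \<and> Z \<nu> \<omega> \<in> C} \<in> sets A"
    and f: "f \<in> borel_measurable env_space"
  shows "(\<lambda>\<omega>. if in_tree \<nu> \<omega> then f (Z \<nu> \<omega>) else (0::real)) \<in> borel_measurable A"
proof (rule measurableI)
  fix D :: "real set" assume D: "D \<in> sets borel"
  have Zs: "Z \<nu> \<omega> \<in> space env_space" if "\<omega> \<in> space P" for \<omega>
    using that env_measurable by (rule measurable_space[rotated])
  have ev: "{\<omega> \<in> space P. in_tree \<nu> \<omega> \<and> f (Z \<nu> \<omega>) \<in> D'} \<in> sets A" if "D' \<in> sets borel" for D'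
  proof -
    have "{\<omega> \<in> space P. in_tree \<nu> \<omega> \<and> f (Z \<nu> \<omega>) \<in> D'}
        = {\<omega> \<in> space P. in_tree \<nu> \<omega> \<and> Z \<nu> \<omega> \<in> f -` D' \<inter> space env_space}" using Zs by auto
    then show ?thesis using A(2)[OF measurable_sets[OF f that]] by simp
  qed
  show "(\<lambda>\<omega>. if in_tree \<nu> \<omega> then f (Z \<nu> \<omega>) else 0) -` D \<inter> space A \<in> sets A"
  proof (cases "0 \<in> D")
    case True
    have "(\<lambda>\<omega>. if in_tree \<nu> \<omega> then f (Z \<nu> \<omega>) else 0) -` D \<inter> space A
        = space A - {\<omega> \<in> space P. in_tree \<nu> \<omega> \<and> f (Z \<nu> \<omega>) \<in> - D}" using True A(1) by (auto split: if_splits)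
    then show ?thesis using ev[of "- D"] D by auto
  next
    case False
    have "(\<lambda>\<omega>. if in_tree \<nu> \<omega> then f (Z \<nu> \<omega>) else 0) -` D \<inter> space A
        = {\<omega> \<in> space P. in_tree \<nu> \<omega> \<and> f (Z \<nu> \<omega>) \<in> D}" using False A(1) by (auto split: if_splits)
    then show ?thesis using ev[of D] D by auto
  qed
qed simp

lemma integrable_bounded:
  assumes "f \<in> borel_measurable P" "\<And>\<omega>. \<omega> \<in> space P \<Longrightarrow> \<bar>f \<omega>\<bar> \<le> (c::real)"
  shows "integrable P f"
  using assms by (intro integrable_const_bound[of _ c]) auto

text \<open>\<open>env_markov\<close> tested against a bounded function of the past. The event that
  the child exists joins the test function: the whole tree belongs to the past, and off this event
  \<open>env_markov\<close> is silent.\<close>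

lemma integral_offspring_value:
  assumes F: "F \<in> borel_measurable (past_of_offspring P bn Z \<nu>)" "\<And>\<omega>. \<omega> \<in> space P \<Longrightarrow> \<bar>F \<omega>\<bar> \<le> c"
    and C: "C \<in> sets env_space"
  shows "(\<integral>\<omega>. F \<omega> * indicator {\<omega> \<in> space P. in_tree (\<nu> @ [i]) \<omega> \<and> Z (\<nu> @ [i]) \<omega> \<in> C} \<omega> \<partial>P)
    = (\<integral>\<omega>. F \<omega> * indicator (tree_event (\<nu> @ [i])) \<omega> * measure (K (Z \<nu> \<omega>)) C \<partial>P)"
proof -
  let ?F = "past_of_offspring P bn Z \<nu>" and ?T = "tree_event (\<nu> @ [i])"
  let ?f = "\<lambda>\<omega>. F \<omega> * indicator ?T \<omega>"
  let ?g = "indicator {\<omega> \<in> space P. Z (\<nu> @ [i]) \<omega> \<in> C} :: 'w \<Rightarrow> real"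
  interpret finite_measure_subalgebra P ?F by unfold_locales (rule past_subalgebra)
  have FP: "F \<in> borel_measurable P" by (rule measurable_from_subalg[OF past_subalgebra F(1)])
  have f: "?f \<in> borel_measurable ?F"
    using F(1) tree_algebra_past[OF tree_event_algebra] by (intro borel_measurable_times) auto
  have ZC: "{\<omega> \<in> space P. Z (\<nu> @ [i]) \<omega> \<in> C} \<in> sets P"
    using measurable_sets[OF env_measurable C] by (simp add: vimage_def Int_def conj_commute)
  have g: "?g \<in> borel_measurable P" using ZC by simp
  have fP: "?f \<in> borel_measurable P" by (rule measurable_from_subalg[OF past_subalgebra f])
  have "\<bar>?f \<omega> * ?g \<omega>\<bar> \<le> c" if "\<omega> \<in> space P" for \<omega>
    using F(2)[OF that] by (auto simp: indicator_def)
  then have int: "integrable P (\<lambda>\<omega>. ?f \<omega> * ?g \<omega>)"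
    using integrable_bounded[OF borel_measurable_times[OF fP g]] by blast
  have "(\<integral>\<omega>. F \<omega> * indicator {\<omega> \<in> space P. in_tree (\<nu> @ [i]) \<omega> \<and> Z (\<nu> @ [i]) \<omega> \<in> C} \<omega> \<partial>P)
      = (\<integral>\<omega>. ?f \<omega> * ?g \<omega> \<partial>P)"
    by (intro Bochner_Integration.integral_cong) (auto simp: indicator_def)
  also have "\<dots> = (\<integral>\<omega>. ?f \<omega> * real_cond_exp P ?F ?g \<omega> \<partial>P)"
    by (rule real_cond_exp_intg(2)[OF int f g, symmetric])
  also have "\<dots> = (\<integral>\<omega>. ?f \<omega> * measure (K (Z \<nu> \<omega>)) C \<partial>P)"
  proof (rule integral_cong_AE)
    show "(\<lambda>\<omega>. ?f \<omega> * real_cond_exp P ?F ?g \<omega>) \<in> borel_measurable P"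
      using fP borel_measurable_cond_exp2 by (rule borel_measurable_times)
    have "(\<lambda>\<omega>. measure (K (Z \<nu> \<omega>)) C) \<in> borel_measurable P"
      using measurable_compose[OF env_measurable measurable_compose[OF measurable_prob_algebraD[OF kernel]
          measurable_measure_subprob_algebra[OF C]]] .
    then show "(\<lambda>\<omega>. ?f \<omega> * measure (K (Z \<nu> \<omega>)) C) \<in> borel_measurable P"
      using fP by (rule borel_measurable_times[rotated])
    show "AE \<omega> in P. ?f \<omega> * real_cond_exp P ?F ?g \<omega> = ?f \<omega> * measure (K (Z \<nu> \<omega>)) C"
      using env_markov[OF C, of \<nu> i] unfolding cond_prob_def
      by eventually_elim (auto simp: indicator_def)
  qed
  finally show ?thesis .
qed

section \<open>Offspring numbers and pairs of vertices in the tree\<close>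

definition tail :: "nat \<Rightarrow> real" where
  "tail n = measure (measure_pmf q) {n..}"

lemma prob_offspring_ge: "prob {\<omega> \<in> space P. n \<le> bn \<nu> \<omega>} = tail n"
proof -
  have "tail n = measure (distr P (count_space UNIV) (bn \<nu>)) {n..}"
    by (simp add: tail_def offspring_law)
  also have "\<dots> = prob {\<omega> \<in> space P. n \<le> bn \<nu> \<omega>}"
    by (subst measure_distr) (auto intro!: arg_cong[of _ _ prob])
  finally show ?thesis by simp
qed

lemma prob_offspring_all:
  assumes "finite J"
  shows "prob {\<omega> \<in> space P. \<forall>\<eta>\<in>J. c \<eta> \<le> bn \<eta> \<omega>} = (\<Prod>\<eta>\<in>J. tail (c \<eta>))"
proof (cases "J = {}")
  case False
  have "{\<omega> \<in> space P. \<forall>\<eta>\<in>J. c \<eta> \<le> bn \<eta> \<omega>} = (\<Inter>\<eta>\<in>J. bn \<eta> -` {c \<eta>..} \<inter> space P)"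
    using False by auto
  also have "prob \<dots> = (\<Prod>\<eta>\<in>J. prob (bn \<eta> -` {c \<eta>..} \<inter> space P))"
    using False assms by (intro indep_varsD[OF offspring_indep]) auto
  also have "\<dots> = (\<Prod>\<eta>\<in>J. tail (c \<eta>))"
    using prob_offspring_ge by (intro prod.cong) (auto simp: vimage_def Int_def conj_commute)
  finally show ?thesis .
qed (simp add: prob_space)

text \<open>Membership in the tree is a set of lower bounds on offspring numbers of proper prefixes.
  A common prefix has to meet the bounds of both words, hence the maximum in \<open>?c\<close>. As
  only shorter words occur, the offspring numbers at \<open>\<mu>\<close> and \<open>\<mu>'\<close>
  remain independent of the event.\<close>

lemma pair_tree_event:
  assumes "length \<mu> = length \<mu>'" "0 \<notin> set \<mu>" "0 \<notin> set \<mu>'"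
  shows "\<exists>J c. finite J \<and> (\<forall>\<eta>\<in>J. length \<eta> < length \<mu>)
    \<and> (\<forall>f. \<mu> \<in> tree f \<and> \<mu>' \<in> tree f \<longleftrightarrow> (\<forall>\<eta>\<in>J. c \<eta> \<le> f \<eta>))"
proof -
  let ?J = "(\<lambda>l. take l \<mu>) ` {..<length \<mu>} \<union> (\<lambda>l. take l \<mu>') ` {..<length \<mu>}"
  let ?c = "\<lambda>\<eta>. max (if take (length \<eta>) \<mu> = \<eta> then \<mu> ! length \<eta> else 0)
      (if take (length \<eta>) \<mu>' = \<eta> then \<mu>' ! length \<eta> else 0)"
  have "\<mu> \<in> tree f \<and> \<mu>' \<in> tree f \<longleftrightarrow> (\<forall>\<eta>\<in>?J. ?c \<eta> \<le> f \<eta>)" for f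
  proof
    assume "\<mu> \<in> tree f \<and> \<mu>' \<in> tree f"
    then show "\<forall>\<eta>\<in>?J. ?c \<eta> \<le> f \<eta>" using assms(1) by (auto simp: tree_def min_def)
  next
    assume *: "\<forall>\<eta>\<in>?J. ?c \<eta> \<le> f \<eta>"
    have "\<mu> ! l \<le> f (take l \<mu>) \<and> \<mu>' ! l \<le> f (take l \<mu>')" if "l < length \<mu>" for l
    proof -
      have "?c (take l \<mu>) \<le> f (take l \<mu>)" "?c (take l \<mu>') \<le> f (take l \<mu>')"
        by (rule bspec[OF *]; use that in blast)+
      then show ?thesis using that assms(1) by (simp add: min_def)
    qed
    moreover have "1 \<le> \<mu> ! l \<and> 1 \<le> \<mu>' ! l" if "l < length \<mu>" for l
      using assms that by (metis nth_mem One_nat_def Suc_leI gr0I)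
    ultimately show "\<mu> \<in> tree f \<and> \<mu>' \<in> tree f" using assms(1) by (auto simp: tree_def)
  qed
  then show ?thesis by (intro exI[of _ ?J] exI[of _ ?c]) auto
qed

lemma prob_pair_snoc:
  assumes "length \<mu> = length \<mu>'" "0 \<notin> set \<mu>" "0 \<notin> set \<mu>'" "\<mu> \<noteq> \<mu>'" "1 \<le> i" "1 \<le> j"
  shows "prob (tree_event (\<mu> @ [i]) \<inter> tree_event (\<mu>' @ [j]))
    = prob (tree_event \<mu> \<inter> tree_event \<mu>') * (tail i * tail j)"
proof -
  obtain J c where J: "finite J" "\<forall>\<eta>\<in>J. length \<eta> < length \<mu>"
    and tr: "\<And>f. \<mu> \<in> tree f \<and> \<mu>' \<in> tree f \<longleftrightarrow> (\<forall>\<eta>\<in>J. c \<eta> \<le> f \<eta>)"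
    using pair_tree_event[OF assms(1-3)] by blast
  have nJ: "\<mu> \<notin> J" "\<mu>' \<notin> J" using J assms(1) by auto
  let ?c = "c(\<mu> := i, \<mu>' := j)"
  have "tree_event (\<mu> @ [i]) \<inter> tree_event (\<mu>' @ [j])
      = {\<omega> \<in> space P. \<forall>\<eta>\<in>insert \<mu> (insert \<mu>' J). ?c \<eta> \<le> bn \<eta> \<omega>}"
  proof -
    have "(\<forall>\<eta>\<in>J. ?c \<eta> \<le> bn \<eta> \<omega>) \<longleftrightarrow> in_tree \<mu> \<omega> \<and> in_tree \<mu>' \<omega>" for \<omega>
      unfolding tr using nJ by (intro ball_cong) auto
    moreover have ball2: "(\<forall>\<eta>\<in>insert \<mu> (insert \<mu>' J). R \<eta>) \<longleftrightarrow> R \<mu> \<and> R \<mu>' \<and> (\<forall>\<eta>\<in>J. R \<eta>)" for R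
      by blast
    ultimately have "(\<forall>\<eta>\<in>insert \<mu> (insert \<mu>' J). ?c \<eta> \<le> bn \<eta> \<omega>) \<longleftrightarrow>
        i \<le> bn \<mu> \<omega> \<and> j \<le> bn \<mu>' \<omega> \<and> in_tree \<mu> \<omega> \<and> in_tree \<mu>' \<omega>" for \<omega>
      unfolding ball2 using assms(4) by simp
    then show ?thesis using assms(5,6) by (auto simp only: tree_snoc)
  qed
  also have "prob \<dots> = (\<Prod>\<eta>\<in>insert \<mu> (insert \<mu>' J). tail (?c \<eta>))"
    using J by (intro prob_offspring_all) auto
  also have "\<dots> = tail i * (tail j * (\<Prod>\<eta>\<in>J. tail (?c \<eta>)))"
    using J nJ assms(4) by simp
  also have "(\<Prod>\<eta>\<in>J. tail (?c \<eta>)) = (\<Prod>\<eta>\<in>J. tail (c \<eta>))"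
    using nJ by (intro prod.cong) auto
  also have "\<dots> = prob {\<omega> \<in> space P. \<forall>\<eta>\<in>J. c \<eta> \<le> bn \<eta> \<omega>}"
    using J by (simp add: prob_offspring_all)
  also have "{\<omega> \<in> space P. \<forall>\<eta>\<in>J. c \<eta> \<le> bn \<eta> \<omega>} = tree_event \<mu> \<inter> tree_event \<mu>'"
    unfolding tr[symmetric] by auto
  finally show ?thesis by simp
qed

lemma prob_tree_snoc:
  assumes "0 \<notin> set \<mu>" "1 \<le> i"
  shows "prob (tree_event (\<mu> @ [i])) = prob (tree_event \<mu>) * tail i"
proof -
  obtain J c where J: "finite J" "\<forall>\<eta>\<in>J. length \<eta> < length \<mu>"
    and tr: "\<And>f. \<mu> \<in> tree f \<longleftrightarrow> (\<forall>\<eta>\<in>J. c \<eta> \<le> f \<eta>)"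
    using pair_tree_event[OF refl assms(1,1)] by blast
  have nJ: "\<mu> \<notin> J" using J by auto
  let ?c = "c(\<mu> := i)"
  have "tree_event (\<mu> @ [i]) = {\<omega> \<in> space P. \<forall>\<eta>\<in>insert \<mu> J. ?c \<eta> \<le> bn \<eta> \<omega>}"
  proof -
    have "(\<forall>\<eta>\<in>J. ?c \<eta> \<le> bn \<eta> \<omega>) \<longleftrightarrow> in_tree \<mu> \<omega>" for \<omega>
      unfolding tr using nJ by (intro ball_cong) auto
    moreover have ball1: "(\<forall>\<eta>\<in>insert \<mu> J. R \<eta>) \<longleftrightarrow> R \<mu> \<and> (\<forall>\<eta>\<in>J. R \<eta>)" for R
      by blast
    ultimately have "(\<forall>\<eta>\<in>insert \<mu> J. ?c \<eta> \<le> bn \<eta> \<omega>) \<longleftrightarrow> i \<le> bn \<mu> \<omega> \<and> in_tree \<mu> \<omega>" for \<omega>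
      unfolding ball1 by simp
    then show ?thesis using assms(2) by (auto simp only: tree_snoc)
  qed
  also have "prob \<dots> = (\<Prod>\<eta>\<in>insert \<mu> J. tail (?c \<eta>))"
    using J by (intro prob_offspring_all) auto
  also have "\<dots> = tail i * (\<Prod>\<eta>\<in>J. tail (?c \<eta>))"
    using J nJ by simp
  also have "(\<Prod>\<eta>\<in>J. tail (?c \<eta>)) = (\<Prod>\<eta>\<in>J. tail (c \<eta>))"
    using nJ by (intro prod.cong) auto
  also have "\<dots> = prob {\<omega> \<in> space P. \<forall>\<eta>\<in>J. c \<eta> \<le> bn \<eta> \<omega>}"
    using J by (simp add: prob_offspring_all)
  also have "{\<omega> \<in> space P. \<forall>\<eta>\<in>J. c \<eta> \<le> bn \<eta> \<omega>} = tree_event \<mu>"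
    unfolding tr[symmetric] by auto
  finally show ?thesis by simp
qed

text \<open>The mean of the offspring number truncated at \<open>B\<close>, as a sum of tails. It is
  the growth rate of the part of the tree with letters up to \<open>B\<close>.\<close>

definition trunc_mean :: "nat \<Rightarrow> real" where
  "trunc_mean B = (\<Sum>i=1..B. tail i)"

lemma words_letters: "\<tau> \<in> words B n \<Longrightarrow> 0 \<notin> set \<tau>" "\<tau> \<in> words B n \<Longrightarrow> length \<tau> = n"
  by (auto simp: words_def)

lemma sum_prob_tree: "(\<Sum>\<tau>\<in>words B n. prob (tree_event \<tau>)) = trunc_mean B ^ n"
proof (induction n)
  case (Suc n)
  have "(\<Sum>\<tau>\<in>words B (Suc n). prob (tree_event \<tau>)) = (\<Sum>\<tau>\<in>words B n. prob (tree_event \<tau>) * trunc_mean B)"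
    unfolding sum_words_snoc trunc_mean_def sum_distrib_left
    by (intro sum.cong refl prob_tree_snoc) (auto simp: words_letters)
  then show ?case using Suc by (simp flip: sum_distrib_right)
qed (simp add: prob_space)

text \<open>A weighted second moment of the size of generation \<open>n\<close>. It is applied with
  \<open>\<xi> = \<beta> / \<delta>\<close>: on the shared path, \<open>\<beta>\<close> comes from
  the energy and \<open>1 / \<delta>\<close> from the likelihood ratios.\<close>

definition pair_sum :: "real \<Rightarrow> nat \<Rightarrow> nat \<Rightarrow> real" where
  "pair_sum \<xi> B n = (\<Sum>\<sigma>\<in>words B n. \<Sum>\<tau>\<in>words B n. \<xi> ^ lcp \<sigma> \<tau> * prob (tree_event \<sigma> \<inter> tree_event \<tau>))"

text \<open>Distinct words keep their common prefix and have independent offspring, which yields the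
  squared mean. A word paired with itself has at most \<open>B\<close> squared pairs of children,
  with common prefix of length \<open>n\<close> or \<open>n + 1\<close>, hence
  \<open>1 + \<xi>\<close>; such words are counted by the first moment.\<close>

lemma pair_sum_Suc:
  assumes "0 < \<xi>"
  shows "pair_sum \<xi> B (Suc n) \<le> (trunc_mean B)\<^sup>2 * pair_sum \<xi> B n
    + (real B)\<^sup>2 * (1 + \<xi>) * (\<xi> * trunc_mean B) ^ n"
proof -
  let ?t = "\<lambda>\<sigma> \<tau>. \<xi> ^ lcp \<sigma> \<tau> * prob (tree_event \<sigma> \<inter> tree_event \<tau>)"
  let ?d = "(real B)\<^sup>2 * (1 + \<xi>) * \<xi> ^ n"
  let ?m = "trunc_mean B"
  have step: "(\<Sum>i=1..B. \<Sum>j=1..B. ?t (\<sigma> @ [i]) (\<tau> @ [j]))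
      \<le> ?m\<^sup>2 * ?t \<sigma> \<tau> + (if \<tau> = \<sigma> then ?d * prob (tree_event \<sigma>) else 0)"
    if \<sigma>: "\<sigma> \<in> words B n" and \<tau>: "\<tau> \<in> words B n" for \<sigma> \<tau>
  proof (cases "\<tau> = \<sigma>")
    case False
    have "(\<Sum>i=1..B. \<Sum>j=1..B. ?t (\<sigma> @ [i]) (\<tau> @ [j])) = (\<Sum>i=1..B. \<Sum>j=1..B. ?t \<sigma> \<tau> * (tail i * tail j))"
    proof (intro sum.cong refl)
      fix i j assume "i \<in> {1..B}" "j \<in> {1..B}"
      then show "?t (\<sigma> @ [i]) (\<tau> @ [j]) = ?t \<sigma> \<tau> * (tail i * tail j)"
        using prob_pair_snoc[of \<sigma> \<tau> i j] lcp_snoc(1)[of \<sigma> \<tau> i j] \<sigma> \<tau> False by (simp add: words_letters)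
    qed
    also have "\<dots> = ?t \<sigma> \<tau> * ?m\<^sup>2"
      unfolding trunc_mean_def power2_eq_square sum_product by (simp only: sum_distrib_left)
    finally show ?thesis using False by (simp only: if_False mult.commute order_refl add_0_right)
  next
    case True
    have "?t (\<sigma> @ [i]) (\<sigma> @ [j]) \<le> (1 + \<xi>) * \<xi> ^ n * prob (tree_event \<sigma>)" for i j
    proof -
      have "\<xi> ^ lcp (\<sigma> @ [i]) (\<sigma> @ [j]) \<le> (1 + \<xi>) * \<xi> ^ n"
        using lcp_snoc(2)[of \<sigma> \<sigma> i j] lcp_same[of "\<sigma> @ [i]"] words_letters(2)[OF \<sigma>] assms
        by (cases "i = j") (auto simp: algebra_simps)
      moreover have "prob (tree_event (\<sigma> @ [i]) \<inter> tree_event (\<sigma> @ [j])) \<le> prob (tree_event \<sigma>)"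
        by (intro finite_measure_mono) (auto simp: tree_snoc)
      ultimately show ?thesis using assms by (intro mult_mono) auto
    qed
    then have "(\<Sum>i=1..B. \<Sum>j=1..B. ?t (\<sigma> @ [i]) (\<tau> @ [j]))
        \<le> (\<Sum>i=1..B. \<Sum>j=1..B. (1 + \<xi>) * \<xi> ^ n * prob (tree_event \<sigma>))"
      unfolding True by (intro sum_mono)
    also have "\<dots> = ?d * prob (tree_event \<sigma>)" by (simp add: power2_eq_square)
    also have "\<dots> \<le> ?m\<^sup>2 * ?t \<sigma> \<tau> + ?d * prob (tree_event \<sigma>)" using assms by simp
    finally show ?thesis using True by simp
  qed
  have "pair_sum \<xi> B (Suc n) = (\<Sum>\<sigma>\<in>words B n. \<Sum>i=1..B. \<Sum>\<tau>\<in>words B n. \<Sum>j=1..B. ?t (\<sigma> @ [i]) (\<tau> @ [j]))"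
    by (simp only: pair_sum_def sum_words_snoc)
  also have "\<dots> = (\<Sum>\<sigma>\<in>words B n. \<Sum>\<tau>\<in>words B n. \<Sum>i=1..B. \<Sum>j=1..B. ?t (\<sigma> @ [i]) (\<tau> @ [j]))"
    by (intro sum.cong refl sum.swap)
  also have "\<dots> \<le> (\<Sum>\<sigma>\<in>words B n. \<Sum>\<tau>\<in>words B n. ?m\<^sup>2 * ?t \<sigma> \<tau> + (if \<tau> = \<sigma> then ?d * prob (tree_event \<sigma>) else 0))"
    by (intro sum_mono step)
  also have "\<dots> = ?m\<^sup>2 * pair_sum \<xi> B n + ?d * (\<Sum>\<sigma>\<in>words B n. prob (tree_event \<sigma>))"
    by (simp add: sum.distrib pair_sum_def sum_distrib_left)
  finally show ?thesis by (simp add: sum_prob_tree power_mult_distrib mult_ac)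
qed

text \<open>Divided by \<open>(m ^ n)\<^sup>2\<close>, the recursion has increments
  \<open>c * (\<xi> / m) ^ n\<close>, a convergent geometric series.\<close>

lemma pair_sum_bounded:
  assumes \<xi>: "0 < \<xi>" "\<xi> < trunc_mean B"
  shows "\<exists>C>0. \<forall>n. pair_sum \<xi> B n \<le> C * (trunc_mean B ^ n)\<^sup>2"
proof -
  define m where "m = trunc_mean B"
  define c where "c = (real B)\<^sup>2 * (1 + \<xi>) / m\<^sup>2"
  have m: "0 < m" "\<xi> / m < 1" using \<xi> by (simp_all add: m_def)
  have c: "0 \<le> c" using \<xi> by (simp add: c_def)
  have "pair_sum \<xi> B n \<le> (1 + c * (\<Sum>i<n. (\<xi> / m) ^ i)) * (m ^ n)\<^sup>2" for n
  proof (induction n)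
    case 0 show ?case by (simp add: pair_sum_def prob_space)
  next
    case (Suc n)
    have "pair_sum \<xi> B (Suc n) \<le> m\<^sup>2 * ((1 + c * (\<Sum>i<n. (\<xi> / m) ^ i)) * (m ^ n)\<^sup>2)
        + (real B)\<^sup>2 * (1 + \<xi>) * (\<xi> * m) ^ n"
      using pair_sum_Suc[OF \<xi>(1), of B n] mult_left_mono[OF Suc, of "m\<^sup>2"] unfolding m_def by simp
    also have "(real B)\<^sup>2 * (1 + \<xi>) * (\<xi> * m) ^ n = c * (\<xi> / m) ^ n * (m ^ Suc n)\<^sup>2"
      using m(1) by (simp add: c_def power_mult_distrib power_divide power2_eq_square field_simps)
    finally show ?case by (simp add: algebra_simps power_mult_distrib)
  qed
  moreover have "(\<Sum>i<n. (\<xi> / m) ^ i) \<le> 1 / (1 - \<xi> / m)" for n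
  proof -
    have "(\<Sum>i<n. (\<xi> / m) ^ i) \<le> (\<Sum>i. (\<xi> / m) ^ i)"
      using m \<xi> by (intro sum_le_suminf summable_geometric) auto
    then show ?thesis using suminf_geometric[of "\<xi> / m"] m \<xi> by simp
  qed
  ultimately have "pair_sum \<xi> B n \<le> (1 + c * (1 / (1 - \<xi> / m))) * (m ^ n)\<^sup>2" for n
    using c by (meson order_trans mult_right_mono add_left_mono mult_left_mono zero_le_power2)
  moreover have "0 < 1 + c * (1 / (1 - \<xi> / m))" using c m(2) by (simp add: add_pos_nonneg)
  ultimately show ?thesis unfolding m_def by blast
qed

end

subsection \<open>Second moment method for the environment\<close>

text \<open>The inequality between arithmetic and geometric mean. Its right-hand side is linear in
  \<open>f\<close> and \<open>e\<close>, so it can be integrated term by term.\<close>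

lemma two_le_of_square_le:
  fixes w f e c m :: real
  assumes "w\<^sup>2 \<le> f * e" "0 \<le> f" "0 \<le> e" "0 < c" "0 < m"
  shows "2 * (w / m) \<le> c * f + e / (c * m\<^sup>2)"
proof -
  define u v where "u = c * f" and "v = e / (c * m\<^sup>2)"
  have "u * v = f * e / m\<^sup>2" using assms(4,5) by (simp add: u_def v_def)
  then have "(w / m)\<^sup>2 \<le> u * v" using assms(1) by (simp add: power_divide divide_right_mono)
  moreover have "4 * (u * v) \<le> (u + v)\<^sup>2"
    using zero_le_power2[of "u - v"] by (simp add: power2_eq_square algebra_simps)
  ultimately have "(2 * (w / m))\<^sup>2 \<le> (u + v)\<^sup>2" unfolding power_mult_distrib by simp
  moreover have "0 \<le> u + v" using assms by (simp add: u_def v_def)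
  ultimately show ?thesis unfolding u_def v_def by (rule power2_le_imp_le)
qed

definition all_words :: "nat \<Rightarrow> nat \<Rightarrow> vertex set" where
  "all_words B N = (\<Union>n\<le>N. words B n)"

lemma finite_all_words [simp]: "finite (all_words B N)"
  by (simp add: all_words_def)

context once_changing_walk
begin

lemma env_value [simp]: "\<omega> \<in> space P \<Longrightarrow> Z \<nu> \<omega> \<in> space env_space"
  using env_measurable by (rule measurable_space)

text \<open>The good words of length at most \<open>N\<close> form a finite random set that carries everything that
  matters about tree and environment.\<close>

definition good_words :: "(real \<times> real \<times> 'm) set \<Rightarrow> nat \<Rightarrow> nat \<Rightarrow> 'w \<Rightarrow> vertex set" where
  "good_words G B N \<omega> = {y \<in> all_words B N. in_tree y \<omega> \<and> Z y \<omega> \<in> G}"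

context
  fixes G :: "(real \<times> real \<times> 'm) set" and \<delta> :: real
  assumes G: "G \<in> sets env_space" and \<delta>: "0 < \<delta>" "\<delta> \<le> 1"
    and K_G: "\<And>z. z \<in> space env_space \<Longrightarrow> \<delta> \<le> measure (K z) G"
begin

text \<open>Likelihood ratio of the event that all values along the path to \<open>\<tau>\<close> lie in \<open>G\<close>; given the
  tree, it has mean one on the event that \<open>\<tau>\<close> is a vertex.\<close>

definition inv_kernel :: "vertex \<Rightarrow> 'w \<Rightarrow> real" where
  "inv_kernel \<nu> \<omega> = (if in_tree \<nu> \<omega> then 1 / measure (K (Z \<nu> \<omega>)) G else 0)"

abbreviation good_event :: "vertex \<Rightarrow> 'w set" where
  "good_event \<nu> \<equiv> {\<omega> \<in> space P. in_tree \<nu> \<omega> \<and> Z \<nu> \<omega> \<in> G}"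

definition path_ratio :: "vertex \<Rightarrow> 'w \<Rightarrow> real" where
  "path_ratio \<tau> \<omega> = (\<Prod>l<length \<tau>. inv_kernel (take l \<tau>) \<omega> * indicator (good_event (take (Suc l) \<tau>)) \<omega>)"

lemma path_ratio_Nil [simp]: "path_ratio [] \<omega> = 1"
  by (simp add: path_ratio_def)

lemma path_ratio_snoc:
  "path_ratio (\<nu> @ [i]) \<omega> = path_ratio \<nu> \<omega> * (inv_kernel \<nu> \<omega> * indicator (good_event (\<nu> @ [i])) \<omega>)"
proof -
  have "path_ratio (\<nu> @ [i]) \<omega> = (\<Prod>l<length \<nu>. inv_kernel (take l (\<nu> @ [i])) \<omega> *
      indicator (good_event (take (Suc l) (\<nu> @ [i]))) \<omega>) * (inv_kernel \<nu> \<omega> * indicator (good_event (\<nu> @ [i])) \<omega>)"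
    by (simp add: path_ratio_def)
  also have "(\<Prod>l<length \<nu>. inv_kernel (take l (\<nu> @ [i])) \<omega> *
      indicator (good_event (take (Suc l) (\<nu> @ [i]))) \<omega>) = path_ratio \<nu> \<omega>"
    unfolding path_ratio_def by (intro prod.cong) (auto simp: Suc_le_eq)
  finally show ?thesis .
qed

lemma inv_kernel_bounds:
  assumes "\<omega> \<in> space P" shows "0 \<le> inv_kernel \<nu> \<omega>" "inv_kernel \<nu> \<omega> \<le> 1 / \<delta>"
  using K_G[OF env_value[OF assms, of \<nu>]] \<delta>
  by (auto simp: inv_kernel_def divide_simps mult_imp_less_div_pos frac_le)

lemma path_ratio_nonneg: "\<omega> \<in> space P \<Longrightarrow> 0 \<le> path_ratio \<nu> \<omega>"
  unfolding path_ratio_def by (intro prod_nonneg) (auto simp: inv_kernel_bounds)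

lemma path_ratio_le: "\<omega> \<in> space P \<Longrightarrow> path_ratio \<nu> \<omega> \<le> (1 / \<delta>) ^ length \<nu>"
proof (induction \<nu> rule: rev_induct)
  case (snoc i \<nu>)
  have "path_ratio (\<nu> @ [i]) \<omega> \<le> (1 / \<delta>) ^ length \<nu> * ((1 / \<delta>) * 1)"
    unfolding path_ratio_snoc using snoc \<delta> inv_kernel_bounds[of \<omega> \<nu>]
    by (intro mult_mono) (auto simp: path_ratio_nonneg indicator_def)
  then show ?case by (simp add: mult.commute)
qed simp

lemma inv_kernel_measurable:
  assumes "space A = space P" "\<And>C. C \<in> sets env_space \<Longrightarrow> {\<omega> \<in> space P. in_tree \<nu> \<omega> \<and> Z \<nu> \<omega> \<in> C} \<in> sets A"
  shows "inv_kernel \<nu> \<in> borel_measurable A"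
proof -
  have [measurable]: "(\<lambda>z. measure (K z) G) \<in> borel_measurable env_space"
    by (rule measurable_compose[OF measurable_prob_algebraD[OF kernel] measurable_measure_subprob_algebra[OF G]])
  have "(\<lambda>z. 1 / measure (K z) G) \<in> borel_measurable env_space" by measurable
  from env_function_measurable[OF assms this] show ?thesis by (simp add: inv_kernel_def[abs_def])
qed

lemma path_ratio_measurable_gen:
  assumes "space A = space P"
    "\<And>l C. l \<le> length \<tau> \<Longrightarrow> C \<in> sets env_space \<Longrightarrow>
      {\<omega> \<in> space P. in_tree (take l \<tau>) \<omega> \<and> Z (take l \<tau>) \<omega> \<in> C} \<in> sets A"
  shows "path_ratio \<tau> \<in> borel_measurable A"
  unfolding path_ratio_def[abs_def]
proof (intro borel_measurable_prod borel_measurable_times)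
  fix l assume l: "l \<in> {..<length \<tau>}"
  show "inv_kernel (take l \<tau>) \<in> borel_measurable A"
    using l assms by (intro inv_kernel_measurable) auto
  show "indicator (good_event (take (Suc l) \<tau>)) \<in> borel_measurable A"
    using assms(2)[of "Suc l" G] l G by (intro borel_measurable_indicator) auto
qed

lemma path_ratio_measurable [measurable]: "path_ratio \<tau> \<in> borel_measurable P"
  by (rule path_ratio_measurable_gen) (auto intro: env_event_sets)

lemma path_ratio_past:
  "length \<tau> \<le> length \<nu> \<Longrightarrow> path_ratio \<tau> \<in> borel_measurable (past_of_offspring P bn Z \<nu>)"
  by (rule path_ratio_measurable_gen) (auto intro!: env_event_past before_offspring_shorter)

text \<open>In the breadth-first order the offspring of \<open>\<mu>\<close> come before those of
  \<open>\<nu>\<close>, so even the last factor of this ratio is known when the offspring of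
  \<open>\<nu>\<close> are generated.\<close>

lemma path_ratio_past_lenlex:
  assumes "(\<mu>, \<nu>) \<in> lenlex less_than" "length \<mu> = length \<nu>"
  shows "path_ratio (\<mu> @ [i]) \<in> borel_measurable (past_of_offspring P bn Z \<nu>)"
proof (rule path_ratio_measurable_gen)
  fix l and C :: "(real \<times> real \<times> 'm) set" assume "l \<le> length (\<mu> @ [i])" "C \<in> sets env_space"
  then show "{\<omega> \<in> space P. in_tree (take l (\<mu> @ [i])) \<omega> \<and> Z (take l (\<mu> @ [i])) \<omega> \<in> C}
      \<in> sets (past_of_offspring P bn Z \<nu>)"
    using assms by (intro env_event_past)
      (cases "l \<le> length \<mu>"; auto intro!: before_offspring_shorter before_offspring_lenlex)
qed simp

text \<open>Given the past, an existing child is good with probability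
  \<open>measure (K (Z \<nu> \<omega>)) G\<close>, which cancels the reciprocal in
  \<open>inv_kernel\<close>. Only the event that the child exists remains.\<close>

lemma integral_peel:
  assumes F: "F \<in> borel_measurable (past_of_offspring P bn Z \<nu>)" "\<And>\<omega>. \<omega> \<in> space P \<Longrightarrow> \<bar>F \<omega>\<bar> \<le> c"
  shows "(\<integral>\<omega>. F \<omega> * (inv_kernel \<nu> \<omega> * indicator (good_event (\<nu> @ [i])) \<omega>) \<partial>P)
    = (\<integral>\<omega>. F \<omega> * indicator (tree_event (\<nu> @ [i])) \<omega> \<partial>P)"
proof -
  let ?F = "\<lambda>\<omega>. F \<omega> * inv_kernel \<nu> \<omega>"
  have m: "?F \<in> borel_measurable (past_of_offspring P bn Z \<nu>)"
    using F(1) by (intro borel_measurable_times inv_kernel_measurable)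
      (auto intro!: env_event_past before_offspring_shorter)
  have "\<bar>?F \<omega>\<bar> \<le> c * (1 / \<delta>)" if "\<omega> \<in> space P" for \<omega>
    unfolding abs_mult using F(2)[OF that] inv_kernel_bounds[OF that, of \<nu>]
    by (intro mult_mono) auto
  note eq = integral_offspring_value[OF m this G, of i]
  have "(\<integral>\<omega>. F \<omega> * (inv_kernel \<nu> \<omega> * indicator (good_event (\<nu> @ [i])) \<omega>) \<partial>P)
    = (\<integral>\<omega>. ?F \<omega> * indicator (tree_event (\<nu> @ [i])) \<omega> * measure (K (Z \<nu> \<omega>)) G \<partial>P)"
    using eq by (simp add: mult.assoc)
  also have "\<dots> = (\<integral>\<omega>. F \<omega> * indicator (tree_event (\<nu> @ [i])) \<omega> \<partial>P)"
  proof (intro Bochner_Integration.integral_cong refl)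
    fix \<omega> assume "\<omega> \<in> space P"
    then have "0 < measure (K (Z \<nu> \<omega>)) G" using K_G[of "Z \<nu> \<omega>"] \<delta> by simp
    then show "?F \<omega> * indicator (tree_event (\<nu> @ [i])) \<omega> * measure (K (Z \<nu> \<omega>)) G
        = F \<omega> * indicator (tree_event (\<nu> @ [i])) \<omega>"
      by (auto simp: inv_kernel_def tree_snoc indicator_def)
  qed
  finally show ?thesis .
qed

text \<open>Each peeling adds a tree event, so the induction needs a general \<open>E\<close>. Tree
  events belong to the past of every vertex and never obstruct the next peeling.\<close>

lemma integral_path_ratio:
  "E \<in> sets tree_algebra \<Longrightarrow> (\<integral>\<omega>. indicator E \<omega> * path_ratio \<tau> \<omega> \<partial>P) = prob (E \<inter> tree_event \<tau>)"
proof (induction \<tau> arbitrary: E rule: rev_induct)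
  case Nil
  then have "E \<in> sets P" by (rule tree_algebra_sets)
  then show ?case using sets.sets_into_space[of E P] by (simp add: Int_absorb2)
next
  case (snoc i \<nu>)
  have E': "E \<inter> tree_event (\<nu> @ [i]) \<in> sets tree_algebra"
    using snoc.prems tree_event_algebra by (intro sets.Int)
  have "(\<integral>\<omega>. indicator E \<omega> * path_ratio (\<nu> @ [i]) \<omega> \<partial>P)
      = (\<integral>\<omega>. (indicator E \<omega> * path_ratio \<nu> \<omega>) * (inv_kernel \<nu> \<omega> * indicator (good_event (\<nu> @ [i])) \<omega>) \<partial>P)"
    by (simp add: path_ratio_snoc mult.assoc)
  also have "\<dots> = (\<integral>\<omega>. (indicator E \<omega> * path_ratio \<nu> \<omega>) * indicator (tree_event (\<nu> @ [i])) \<omega> \<partial>P)"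
  proof (rule integral_peel[where c = "(1 / \<delta>) ^ length \<nu>"])
    show "(\<lambda>\<omega>. indicator E \<omega> * path_ratio \<nu> \<omega>) \<in> borel_measurable (past_of_offspring P bn Z \<nu>)"
      using tree_algebra_past[OF snoc.prems] by (intro borel_measurable_times path_ratio_past) auto
    show "\<bar>indicator E \<omega> * path_ratio \<nu> \<omega>\<bar> \<le> (1 / \<delta>) ^ length \<nu>" if "\<omega> \<in> space P" for \<omega>
      using path_ratio_le[OF that, of \<nu>] path_ratio_nonneg[OF that, of \<nu>] \<delta> by (auto simp: indicator_def)
  qed
  also have "\<dots> = (\<integral>\<omega>. indicator (E \<inter> tree_event (\<nu> @ [i])) \<omega> * path_ratio \<nu> \<omega> \<partial>P)"
    by (intro Bochner_Integration.integral_cong refl) (simp add: indicator_inter_arith)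
  also have "\<dots> = prob (E \<inter> tree_event (\<nu> @ [i]) \<inter> tree_event \<nu>)"
    by (rule snoc.IH[OF E'])
  also have "E \<inter> tree_event (\<nu> @ [i]) \<inter> tree_event \<nu> = E \<inter> tree_event (\<nu> @ [i])"
    by (auto simp: tree_snoc)
  finally show ?case .
qed

lemma integrable_ind_ratio:
  assumes "E \<in> sets P"
  shows "integrable P (\<lambda>\<omega>. indicator E \<omega> * path_ratio \<tau> \<omega>)"
    "integrable P (\<lambda>\<omega>. indicator E \<omega> * (path_ratio \<sigma> \<omega> * path_ratio \<tau> \<omega>))"
proof -
  have b: "\<bar>path_ratio \<nu> \<omega>\<bar> \<le> (1 / \<delta>) ^ length \<nu>" if "\<omega> \<in> space P" for \<omega> \<nu>
    using path_ratio_le[OF that, of \<nu>] path_ratio_nonneg[OF that, of \<nu>] by simp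
  have i: "\<bar>indicator E \<omega> :: real\<bar> \<le> 1" for \<omega> by (simp add: indicator_def)
  have "\<bar>indicator E \<omega> * path_ratio \<tau> \<omega>\<bar> \<le> 1 * (1 / \<delta>) ^ length \<tau>" if "\<omega> \<in> space P" for \<omega>
    unfolding abs_mult using b[OF that] i by (intro mult_mono) auto
  moreover have "(\<lambda>\<omega>. indicator E \<omega> * path_ratio \<tau> \<omega>) \<in> borel_measurable P" using assms by measurable
  ultimately show "integrable P (\<lambda>\<omega>. indicator E \<omega> * path_ratio \<tau> \<omega>)" by (intro integrable_bounded)
  have "\<bar>indicator E \<omega> * (path_ratio \<sigma> \<omega> * path_ratio \<tau> \<omega>)\<bar> \<le> 1 * ((1 / \<delta>) ^ length \<sigma> * (1 / \<delta>) ^ length \<tau>)"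
    if "\<omega> \<in> space P" for \<omega>
    unfolding abs_mult using b[OF that] i \<delta> by (intro mult_mono) auto
  moreover have "(\<lambda>\<omega>. indicator E \<omega> * (path_ratio \<sigma> \<omega> * path_ratio \<tau> \<omega>)) \<in> borel_measurable P"
    using assms by measurable
  ultimately show "integrable P (\<lambda>\<omega>. indicator E \<omega> * (path_ratio \<sigma> \<omega> * path_ratio \<tau> \<omega>))"
    by (intro integrable_bounded)
qed

text \<open>As long as the parents differ, both last factors are peeled off exactly, first the one
  whose parent comes later in the breadth-first order, since its past contains the other child. At a
  common parent the two values may be dependent; there one ratio is replaced by its largest possible
  value, a power of \<open>1 / \<delta>\<close> with exponent at most
  \<open>Suc (lcp \<sigma> \<tau>)\<close>, and the other is integrated exactly.\<close>

lemma integral_path_ratio_pair: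
  assumes E: "E \<in> sets tree_algebra" and len: "length \<sigma> = length \<tau>"
  shows "(\<integral>\<omega>. indicator E \<omega> * (path_ratio \<sigma> \<omega> * path_ratio \<tau> \<omega>) \<partial>P)
    \<le> (1 / \<delta>) ^ Suc (lcp \<sigma> \<tau>) * prob (E \<inter> tree_event \<sigma> \<inter> tree_event \<tau>)"
proof -
  let ?D = "1 / \<delta>"
  have D1: "1 \<le> ?D" using \<delta> by simp
  have ordered: "(\<integral>\<omega>. indicator E \<omega> * (path_ratio (\<mu> @ [i]) \<omega> * path_ratio (\<nu> @ [j]) \<omega>) \<partial>P)
      = (\<integral>\<omega>. indicator (E \<inter> tree_event (\<mu> @ [i]) \<inter> tree_event (\<nu> @ [j])) \<omega> *
           (path_ratio \<mu> \<omega> * path_ratio \<nu> \<omega>) \<partial>P)"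
    if E: "E \<in> sets tree_algebra" and lx: "(\<mu>, \<nu>) \<in> lenlex less_than" and len: "length \<mu> = length \<nu>"
    for E \<mu> \<nu> i j
  proof -
    have b: "\<bar>path_ratio \<nu> \<omega>\<bar> \<le> ?D ^ length \<nu>" if "\<omega> \<in> space P" for \<omega> \<nu>
      using path_ratio_le[OF that, of \<nu>] path_ratio_nonneg[OF that, of \<nu>] by simp
    have ind: "\<bar>indicator E \<omega> :: real\<bar> \<le> 1" for E and \<omega> :: 'w by (simp add: indicator_def)
    let ?E1 = "E \<inter> tree_event (\<nu> @ [j])"
    have E1: "?E1 \<in> sets tree_algebra" using E tree_event_algebra by (intro sets.Int)
    have "(\<integral>\<omega>. indicator E \<omega> * (path_ratio (\<mu> @ [i]) \<omega> * path_ratio (\<nu> @ [j]) \<omega>) \<partial>P)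
        = (\<integral>\<omega>. (indicator E \<omega> * path_ratio (\<mu> @ [i]) \<omega> * path_ratio \<nu> \<omega>)
            * (inv_kernel \<nu> \<omega> * indicator (good_event (\<nu> @ [j])) \<omega>) \<partial>P)"
      by (simp add: path_ratio_snoc[of \<nu>] mult.assoc)
    also have "\<dots> = (\<integral>\<omega>. (indicator E \<omega> * path_ratio (\<mu> @ [i]) \<omega> * path_ratio \<nu> \<omega>)
        * indicator (tree_event (\<nu> @ [j])) \<omega> \<partial>P)"
    proof (rule integral_peel[where c = "1 * ?D ^ length (\<mu> @ [i]) * ?D ^ length \<nu>"])
      show "(\<lambda>\<omega>. indicator E \<omega> * path_ratio (\<mu> @ [i]) \<omega> * path_ratio \<nu> \<omega>)
          \<in> borel_measurable (past_of_offspring P bn Z \<nu>)"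
        using tree_algebra_past[OF E] lx len
        by (intro borel_measurable_times path_ratio_past path_ratio_past_lenlex) auto
      show "\<bar>indicator E \<omega> * path_ratio (\<mu> @ [i]) \<omega> * path_ratio \<nu> \<omega>\<bar> \<le> 1 * ?D ^ length (\<mu> @ [i]) * ?D ^ length \<nu>"
        if "\<omega> \<in> space P" for \<omega>
        unfolding abs_mult using b[OF that] ind \<delta> by (intro mult_mono) (auto simp del: length_append)
    qed
    also have "\<dots> = (\<integral>\<omega>. (indicator ?E1 \<omega> * path_ratio \<mu> \<omega> * path_ratio \<nu> \<omega>)
        * (inv_kernel \<mu> \<omega> * indicator (good_event (\<mu> @ [i])) \<omega>) \<partial>P)"
      by (intro Bochner_Integration.integral_cong refl)
        (simp add: path_ratio_snoc[of \<mu>] indicator_inter_arith mult_ac)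
    also have "\<dots> = (\<integral>\<omega>. (indicator ?E1 \<omega> * path_ratio \<mu> \<omega> * path_ratio \<nu> \<omega>)
        * indicator (tree_event (\<mu> @ [i])) \<omega> \<partial>P)"
    proof (rule integral_peel[where c = "1 * ?D ^ length \<mu> * ?D ^ length \<nu>"])
      show "(\<lambda>\<omega>. indicator ?E1 \<omega> * path_ratio \<mu> \<omega> * path_ratio \<nu> \<omega>)
          \<in> borel_measurable (past_of_offspring P bn Z \<mu>)"
        using tree_algebra_past[OF E1] len
        by (intro borel_measurable_times path_ratio_past) auto
      show "\<bar>indicator ?E1 \<omega> * path_ratio \<mu> \<omega> * path_ratio \<nu> \<omega>\<bar> \<le> 1 * ?D ^ length \<mu> * ?D ^ length \<nu>"
        if "\<omega> \<in> space P" for \<omega>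
        unfolding abs_mult using b[OF that] ind \<delta> by (intro mult_mono) auto
    qed
    finally show ?thesis by (simp add: indicator_inter_arith mult_ac)
  qed
  show ?thesis
    using E len
  proof (induction \<sigma> arbitrary: \<tau> E rule: rev_induct)
    case Nil
    have "prob E * 1 \<le> prob E * ?D" using D1 by (intro mult_left_mono) auto
    then show ?case using Nil integral_path_ratio[of E "[]"]
        sets.sets_into_space[OF tree_algebra_sets[of E]]
      by (simp add: Int_absorb2 lcp_same)
  next
    case (snoc i \<mu>)
    obtain \<nu> j where \<tau>: "\<tau> = \<nu> @ [j]" and len: "length \<mu> = length \<nu>"
      using snoc.prems(2) by (cases \<tau> rule: rev_cases) auto
    let ?Ei = "tree_event (\<mu> @ [i])" and ?Ej = "tree_event (\<nu> @ [j])"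
    have EP: "E \<in> sets P" using snoc.prems(1) by (rule tree_algebra_sets)
    show ?case
    proof (cases "\<mu> = \<nu>")
      case False
      let ?E' = "E \<inter> ?Ei \<inter> ?Ej"
      have E': "?E' \<in> sets tree_algebra"
        using snoc.prems(1) tree_event_algebra by (intro sets.Int)
      have "(\<mu>, \<nu>) \<in> lenlex less_than \<or> (\<nu>, \<mu>) \<in> lenlex less_than"
        using total_lenlex[OF total_less_than] False by (auto simp: total_on_def)
      then have "(\<integral>\<omega>. indicator E \<omega> * (path_ratio (\<mu> @ [i]) \<omega> * path_ratio (\<nu> @ [j]) \<omega>) \<partial>P)
          = (\<integral>\<omega>. indicator ?E' \<omega> * (path_ratio \<mu> \<omega> * path_ratio \<nu> \<omega>) \<partial>P)"
      proof
        assume "(\<mu>, \<nu>) \<in> lenlex less_than"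
        from ordered[OF snoc.prems(1) this len] show ?thesis .
      next
        assume "(\<nu>, \<mu>) \<in> lenlex less_than"
        from ordered[OF snoc.prems(1) this len[symmetric], of j i] show ?thesis
          by (simp only: mult.commute[of "path_ratio (\<mu> @ [i]) _"] mult.commute[of "path_ratio \<mu> _"] Int_assoc
              Int_commute[of ?Ei])
      qed
      also have "\<dots> \<le> ?D ^ Suc (lcp \<mu> \<nu>) * prob (?E' \<inter> tree_event \<mu> \<inter> tree_event \<nu>)"
        by (rule snoc.IH[OF E' len])
      also have "?E' \<inter> tree_event \<mu> \<inter> tree_event \<nu> = ?E'" by (auto simp: tree_snoc)
      finally show ?thesis using lcp_snoc(1)[OF len False, of i j] by (simp add: \<tau>)
    next
      case True
      have "(\<integral>\<omega>. indicator E \<omega> * (path_ratio (\<mu> @ [i]) \<omega> * path_ratio (\<mu> @ [j]) \<omega>) \<partial>P)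
         \<le> (\<integral>\<omega>. ?D ^ Suc (lcp (\<mu> @ [i]) (\<mu> @ [j])) * (indicator (E \<inter> ?Ej) \<omega> * path_ratio (\<mu> @ [i]) \<omega>) \<partial>P)"
      proof (rule integral_mono)
        show "integrable P (\<lambda>\<omega>. indicator E \<omega> * (path_ratio (\<mu> @ [i]) \<omega> * path_ratio (\<mu> @ [j]) \<omega>))"
          using EP by (rule integrable_ind_ratio)
        show "integrable P (\<lambda>\<omega>. ?D ^ Suc (lcp (\<mu> @ [i]) (\<mu> @ [j])) * (indicator (E \<inter> ?Ej) \<omega> * path_ratio (\<mu> @ [i]) \<omega>))"
          using EP by (intro integrable_mult_right integrable_ind_ratio) auto
        fix \<omega> assume \<omega>: "\<omega> \<in> space P"
        have le: "path_ratio (\<mu> @ [j]) \<omega> \<le> ?D ^ Suc (lcp (\<mu> @ [i]) (\<mu> @ [j])) * indicator ?Ej \<omega>"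
        proof (cases "\<omega> \<in> ?Ej")
          case in_t: True
          have "path_ratio (\<mu> @ [j]) \<omega> \<le> ?D ^ Suc (length \<mu>)" using path_ratio_le[OF \<omega>, of "\<mu> @ [j]"] by simp
          also have "\<dots> \<le> ?D ^ Suc (lcp (\<mu> @ [i]) (\<mu> @ [j]))"
            using lcp_snoc(2)[of \<mu> \<mu> i j] lcp_same[of "\<mu> @ [i]"] D1
            by (intro power_increasing) (cases "i = j"; simp)+
          finally show ?thesis using in_t by simp
        next
          case False
          then have "path_ratio (\<mu> @ [j]) \<omega> = 0" using \<omega> True by (simp add: path_ratio_snoc indicator_def)
          then show ?thesis using False by simp
        qed
        have "indicator E \<omega> * path_ratio (\<mu> @ [i]) \<omega> * path_ratio (\<mu> @ [j]) \<omega>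
            \<le> indicator E \<omega> * path_ratio (\<mu> @ [i]) \<omega> * (?D ^ Suc (lcp (\<mu> @ [i]) (\<mu> @ [j])) * indicator ?Ej \<omega>)"
          by (intro mult_left_mono le) (simp add: path_ratio_nonneg[OF \<omega>])
        then show "indicator E \<omega> * (path_ratio (\<mu> @ [i]) \<omega> * path_ratio (\<mu> @ [j]) \<omega>)
            \<le> ?D ^ Suc (lcp (\<mu> @ [i]) (\<mu> @ [j])) * (indicator (E \<inter> ?Ej) \<omega> * path_ratio (\<mu> @ [i]) \<omega>)"
          by (simp add: indicator_inter_arith mult_ac)
      qed
      also have "\<dots> = ?D ^ Suc (lcp (\<mu> @ [i]) (\<mu> @ [j])) * prob (E \<inter> ?Ej \<inter> ?Ei)"
        using integral_path_ratio[of "E \<inter> ?Ej" "\<mu> @ [i]"] snoc.prems(1) tree_event_algebra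
        by (simp add: sets.Int)
      finally show ?thesis using True by (simp add: \<tau> Int_ac)
    qed
  qed
qed

section \<open>Expected strength of the capped flow through good words\<close>

lemma good_words_event: "{\<omega> \<in> space P. good_words G B N \<omega> = s} \<in> sets P"
proof -
  have "{\<omega> \<in> space P. good_words G B N \<omega> = s} =
    (if s \<subseteq> all_words B N then {\<omega> \<in> space P. \<forall>y\<in>all_words B N. \<omega> \<in> good_event y \<longleftrightarrow> y \<in> s} else {})"
    by (auto simp: good_words_def)
  also have "\<dots> \<in> sets P"
  proof -
    have [measurable]: "good_event y \<in> sets P" for y by (rule env_event_sets[OF G])
    have "{\<omega> \<in> space P. \<forall>y\<in>all_words B N. \<omega> \<in> good_event y \<longleftrightarrow> y \<in> s} \<in> sets P"
      by (intro sets.sets_Collect_finite_All) auto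
    then show ?thesis by simp
  qed
  finally show ?thesis .
qed

lemma good_words_measurable [measurable]: "good_words G B N \<in> P \<rightarrow>\<^sub>M count_space UNIV"
proof (rule measurable_compose[where N = "count_space (Pow (all_words B N))"])
  show "good_words G B N \<in> P \<rightarrow>\<^sub>M count_space (Pow (all_words B N))"
  proof (subst measurable_count_space_eq2, simp, intro conjI ballI)
    show "good_words G B N \<in> space P \<rightarrow> Pow (all_words B N)" by (auto simp: good_words_def)
    show "good_words G B N -` {s} \<inter> space P \<in> sets P" for s
      using good_words_event[of B N s] by (simp add: vimage_def Int_def conj_commute)
  qed
qed simp

text \<open>The total ratio \<open>W\<close> has mean \<open>m ^ n\<close> and the energy
  \<open>En\<close> has mean at most \<open>C * (m ^ n)\<^sup>2\<close>. Integrating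
  \<open>key\<close> bounds 2 by \<open>C\<close> times the expected capped flow plus 1; the
  constant in \<open>key\<close> is chosen so that the energy term is at most 1.\<close>

lemma expected_cap_flow:
  assumes \<beta>: "1 < \<beta>" "\<beta> < trunc_mean B * \<delta>"
  shows "\<exists>c>0. \<forall>n. c \<le> (\<integral>\<omega>. cap_flow \<beta> B (good_words G B n \<omega>) n [] \<partial>P)"
proof -
  define m where "m = trunc_mean B"
  have "\<beta> / \<delta> < m" "0 < \<beta> / \<delta>" using \<beta> \<delta> by (simp_all add: m_def field_simps)
  then obtain C0 where C0: "0 < C0" "\<And>n. pair_sum (\<beta> / \<delta>) B n \<le> C0 * (m ^ n)\<^sup>2"
    using pair_sum_bounded[of "\<beta> / \<delta>" B] by (auto simp: m_def)
  have m: "0 < m" using \<open>\<beta> / \<delta> < m\<close> \<open>0 < \<beta> / \<delta>\<close> by simp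
  \<comment> \<open>The factors come from the geometric series in \<open>pair_kernel_le\<close>,
    from the extra power in \<open>Suc (lcp \<sigma> \<tau>)\<close>, and from the bound on
    \<open>pair_sum\<close>.\<close>
  define C where "C = \<beta> / (\<beta> - 1) * (1 / \<delta>) * C0"
  have C: "0 < C" using \<beta> \<delta> C0 by (simp add: C_def)
  have "1 / C \<le> (\<integral>\<omega>. cap_flow \<beta> B (good_words G B n \<omega>) n [] \<partial>P)" for n
  proof -
    define w where "w \<omega> \<tau> = (if \<tau> \<in> words B n then path_ratio \<tau> \<omega> else 0)" for \<omega> \<tau>
    define W where "W \<omega> = (\<Sum>\<tau>\<in>words B n. path_ratio \<tau> \<omega>)" for \<omega>
    define En where "En \<omega> = (\<Sum>\<sigma>\<in>words B n. \<Sum>\<tau>\<in>words B n.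
        path_ratio \<sigma> \<omega> * path_ratio \<tau> \<omega> * pair_kernel \<beta> \<sigma> \<tau>)" for \<omega>
    define \<phi> where "\<phi> \<omega> = cap_flow \<beta> B (good_words G B n \<omega>) n []" for \<omega>
    have pk0: "0 \<le> pair_kernel \<beta> \<sigma> \<tau>" for \<sigma> \<tau> using \<beta> by (auto simp: pair_kernel_def intro!: sum_nonneg)
    have key: "2 * (W \<omega> / m ^ n) \<le> C * \<phi> \<omega> + En \<omega> / (C * (m ^ n)\<^sup>2)" if \<omega>: "\<omega> \<in> space P" for \<omega>
    proof -
      have "(\<Sum>\<tau>\<in>words B n. w \<omega> ([] @ \<tau>))\<^sup>2 \<le> cap_flow \<beta> B (good_words G B n \<omega>) n [] * energy \<beta> B (w \<omega>) n []"
      proof (rule cap_flow_energy[OF \<beta>(1)])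
        fix \<sigma> \<tau> :: vertex assume \<sigma>: "\<sigma> \<noteq> []" "\<sigma> \<notin> good_words G B n \<omega>"
        show "w \<omega> (\<sigma> @ \<tau>) = 0"
        proof (cases "\<sigma> @ \<tau> \<in> words B n")
          case True
          then have "\<sigma> \<in> all_words B n" by (auto simp: all_words_def words_def)
          then have ng: "\<omega> \<notin> good_event \<sigma>" using \<sigma>(2) by (auto simp: good_words_def)
          have lt: "length \<sigma> - Suc 0 < length \<sigma> + length \<tau>" "Suc (length \<sigma> - Suc 0) = length \<sigma>"
            using \<sigma>(1) by (cases \<sigma>; simp)+
          have "path_ratio (\<sigma> @ \<tau>) \<omega> = 0" unfolding path_ratio_def
          proof (rule prod_zero)
            show "\<exists>l\<in>{..<length (\<sigma> @ \<tau>)}. inv_kernel (take l (\<sigma> @ \<tau>)) \<omega> *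
                indicator (good_event (take (Suc l) (\<sigma> @ \<tau>))) \<omega> = (0::real)"
              \<comment> \<open>The vanishing factor belongs to the step into \<sigma>, which is not
                good.\<close>
              using ng lt by (intro bexI[of _ "length \<sigma> - 1"]) (auto simp: Suc_diff_1 indicator_def)
          qed simp
          then show ?thesis by (simp add: w_def)
        qed (simp add: w_def)
      qed
      moreover have "(\<Sum>\<tau>\<in>words B n. w \<omega> ([] @ \<tau>)) = W \<omega>" by (simp add: w_def W_def)
      moreover have "energy \<beta> B (w \<omega>) n [] = En \<omega>" by (simp add: energy_def w_def En_def)
      ultimately have W2: "(W \<omega>)\<^sup>2 \<le> \<phi> \<omega> * En \<omega>" by (simp add: \<phi>_def)
      have \<phi>0: "0 \<le> \<phi> \<omega>" using cap_flow_bounds(1)[of \<beta>] \<beta> by (simp add: \<phi>_def)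
      have En0: "0 \<le> En \<omega>" unfolding En_def
        using pk0 path_ratio_nonneg[OF \<omega>] by (intro sum_nonneg mult_nonneg_nonneg)
      show ?thesis using W2 \<phi>0 En0 C m by (intro two_le_of_square_le) auto
    qed
    have iP: "integrable P (path_ratio \<tau>)" "integrable P (\<lambda>\<omega>. path_ratio \<sigma> \<omega> * path_ratio \<tau> \<omega>)" for \<sigma> \<tau>
    proof -
      have 1: "path_ratio \<tau> \<omega> = indicator (space P) \<omega> * path_ratio \<tau> \<omega>"
        "path_ratio \<sigma> \<omega> * path_ratio \<tau> \<omega> = indicator (space P) \<omega> * (path_ratio \<sigma> \<omega> * path_ratio \<tau> \<omega>)"
        if "\<omega> \<in> space P" for \<omega> using that by auto
      show "integrable P (path_ratio \<tau>)"
        using integrable_ind_ratio(1)[of "space P" \<tau>] by (subst Bochner_Integration.integrable_cong[OF refl 1(1)]) auto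
      show "integrable P (\<lambda>\<omega>. path_ratio \<sigma> \<omega> * path_ratio \<tau> \<omega>)"
        using integrable_ind_ratio(2)[of "space P" \<sigma> \<tau>] by (subst Bochner_Integration.integrable_cong[OF refl 1(2)]) auto
    qed
    have spE: "space P \<in> sets tree_algebra"
      using sets.top[of tree_algebra] by (simp add: tree_algebra_def space_measure_of_conv)
    have EW: "(\<integral>\<omega>. W \<omega> \<partial>P) = m ^ n"
    proof -
      have "(\<integral>\<omega>. W \<omega> \<partial>P) = (\<Sum>\<tau>\<in>words B n. \<integral>\<omega>. path_ratio \<tau> \<omega> \<partial>P)"
        unfolding W_def by (rule Bochner_Integration.integral_sum) (rule iP)
      also have "\<dots> = (\<Sum>\<tau>\<in>words B n. prob (tree_event \<tau>))"
      proof (intro sum.cong refl)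
        fix \<tau>
        have "(\<integral>\<omega>. path_ratio \<tau> \<omega> \<partial>P) = (\<integral>\<omega>. indicator (space P) \<omega> * path_ratio \<tau> \<omega> \<partial>P)"
          by (intro Bochner_Integration.integral_cong) auto
        also have "\<dots> = prob (tree_event \<tau>)"
          using integral_path_ratio[OF spE, of \<tau>] by (simp add: Int_absorb1 Collect_subset)
        finally show "(\<integral>\<omega>. path_ratio \<tau> \<omega> \<partial>P) = prob (tree_event \<tau>)" .
      qed
      finally show ?thesis by (simp add: sum_prob_tree m_def)
    qed
    have EE: "(\<integral>\<omega>. En \<omega> \<partial>P) \<le> C * (m ^ n)\<^sup>2"
    proof -
      have "(\<integral>\<omega>. En \<omega> \<partial>P) = (\<Sum>\<sigma>\<in>words B n. \<Sum>\<tau>\<in>words B n.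
          (\<integral>\<omega>. path_ratio \<sigma> \<omega> * path_ratio \<tau> \<omega> \<partial>P) * pair_kernel \<beta> \<sigma> \<tau>)"
        unfolding En_def using iP
        by (simp add: Bochner_Integration.integral_sum Bochner_Integration.integrable_sum)
      also have "\<dots> \<le> (\<Sum>\<sigma>\<in>words B n. \<Sum>\<tau>\<in>words B n. \<beta> / (\<beta> - 1) * (1 / \<delta>) *
          ((\<beta> / \<delta>) ^ lcp \<sigma> \<tau> * prob (tree_event \<sigma> \<inter> tree_event \<tau>)))"
      proof (intro sum_mono)
        fix \<sigma> \<tau> assume w: "\<sigma> \<in> words B n" "\<tau> \<in> words B n"
        have "(\<integral>\<omega>. path_ratio \<sigma> \<omega> * path_ratio \<tau> \<omega> \<partial>P)
            = (\<integral>\<omega>. indicator (space P) \<omega> * (path_ratio \<sigma> \<omega> * path_ratio \<tau> \<omega>) \<partial>P)"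
          by (intro Bochner_Integration.integral_cong) auto
        also have "\<dots> \<le> (1 / \<delta>) ^ Suc (lcp \<sigma> \<tau>) * prob (space P \<inter> tree_event \<sigma> \<inter> tree_event \<tau>)"
          using w by (intro integral_path_ratio_pair[OF spE]) (simp add: words_letters)
        finally have 1: "(\<integral>\<omega>. path_ratio \<sigma> \<omega> * path_ratio \<tau> \<omega> \<partial>P)
            \<le> (1 / \<delta>) ^ Suc (lcp \<sigma> \<tau>) * prob (tree_event \<sigma> \<inter> tree_event \<tau>)"
          by (simp add: Int_absorb1 Collect_subset)
        have "(\<integral>\<omega>. path_ratio \<sigma> \<omega> * path_ratio \<tau> \<omega> \<partial>P) * pair_kernel \<beta> \<sigma> \<tau>
            \<le> ((1 / \<delta>) ^ Suc (lcp \<sigma> \<tau>) * prob (tree_event \<sigma> \<inter> tree_event \<tau>)) * (\<beta> / (\<beta> - 1) * \<beta> ^ lcp \<sigma> \<tau>)"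
          using 1 pair_kernel_le[OF \<beta>(1)] \<delta> pk0 by (intro mult_mono) auto
        then show "(\<integral>\<omega>. path_ratio \<sigma> \<omega> * path_ratio \<tau> \<omega> \<partial>P) * pair_kernel \<beta> \<sigma> \<tau>
            \<le> \<beta> / (\<beta> - 1) * (1 / \<delta>) * ((\<beta> / \<delta>) ^ lcp \<sigma> \<tau> * prob (tree_event \<sigma> \<inter> tree_event \<tau>))"
          by (simp add: power_divide mult_ac)
      qed
      also have "\<dots> = \<beta> / (\<beta> - 1) * (1 / \<delta>) * pair_sum (\<beta> / \<delta>) B n"
        unfolding pair_sum_def sum_distrib_left ..
      also have "\<dots> \<le> \<beta> / (\<beta> - 1) * (1 / \<delta>) * (C0 * (m ^ n)\<^sup>2)"
        using C0 \<beta> \<delta> by (intro mult_left_mono) auto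
      finally show ?thesis by (simp add: C_def)
    qed
    have i\<phi>: "integrable P \<phi>"
    proof (rule integrable_bounded[where c = 1])
      show "\<phi> \<in> borel_measurable P" unfolding \<phi>_def
        by (rule measurable_compose[OF good_words_measurable]) simp
      show "\<bar>\<phi> \<omega>\<bar> \<le> 1" for \<omega>
        using cap_flow_bounds[of \<beta> B "good_words G B n \<omega>" n "[]"] \<beta> by (simp add: \<phi>_def)
    qed
    have iW: "integrable P W" unfolding W_def using iP by (intro Bochner_Integration.integrable_sum)
    have iE: "integrable P En" unfolding En_def
      using iP by (intro Bochner_Integration.integrable_sum integrable_mult_left)
    have "2 * ((\<integral>\<omega>. W \<omega> \<partial>P) / m ^ n) = (\<integral>\<omega>. 2 * (W \<omega> / m ^ n) \<partial>P)" by simp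
    also have "\<dots> \<le> (\<integral>\<omega>. C * \<phi> \<omega> + En \<omega> / (C * (m ^ n)\<^sup>2) \<partial>P)"
      using key i\<phi> iE iW by (intro integral_mono) auto
    also have "\<dots> = C * (\<integral>\<omega>. \<phi> \<omega> \<partial>P) + (\<integral>\<omega>. En \<omega> \<partial>P) / (C * (m ^ n)\<^sup>2)"
      using i\<phi> iE by simp
    also have "(\<integral>\<omega>. En \<omega> \<partial>P) / (C * (m ^ n)\<^sup>2) \<le> 1"
      using EE C m by (simp add: divide_le_eq)
    finally have "2 \<le> C * (\<integral>\<omega>. \<phi> \<omega> \<partial>P) + 1" using m by (simp add: EW)
    then show ?thesis using C by (simp add: \<phi>_def[abs_def] divide_le_eq mult.commute)
  qed
  then show ?thesis using C by (intro exI[of _ "1 / C"]) auto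
qed

end

end

subsection \<open>Truncation of the environment and of the offspring law\<close>

lemma Aval_measurable [measurable]: "Aval \<in> borel_measurable (env_space :: (real \<times> real \<times> 'm::polish_space) measure)"
  and Bval_measurable [measurable]: "Bval \<in> borel_measurable (env_space :: (real \<times> real \<times> 'm) measure)"
proof -
  have "Aval = (\<lambda>z::real \<times> real \<times> 'm. fst (snd z))" "Bval = (\<lambda>z::real \<times> real \<times> 'm. fst z)"
    by (auto simp: Aval_def Bval_def)
  note eq = this
  show "Aval \<in> borel_measurable (env_space :: (real \<times> real \<times> 'm) measure)"
    "Bval \<in> borel_measurable (env_space :: (real \<times> real \<times> 'm) measure)"
    unfolding env_space_def eq
    by (auto intro!: measurable_restrict_space1 borel_measurable_continuous_onI continuous_intros)
qed

lemma space_env_space: "space env_space = {0..} \<times> {0..} \<times> UNIV"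
  and space_star_space: "space star_space = {0..} \<times> {0..} \<times> {0..} \<times> UNIV"
  by (auto simp: env_space_def star_space_def space_restrict_space)

lemma Dval_pair_measurable:
  assumes "0 \<le> L"
  shows "(\<lambda>z. (Dval L z, z)) \<in> env_space \<rightarrow>\<^sub>M (star_space :: (real \<times> real \<times> real \<times> 'm::polish_space) measure)"
  unfolding star_space_def
proof (rule measurable_restrict_space2)
  show "(\<lambda>z. (Dval L z, z)) \<in> space env_space \<rightarrow> {0..} \<times> {0..} \<times> {0..} \<times> (UNIV :: 'm set)"
    using assms by (auto simp: space_env_space Dval_def Aval_def)
  have "(\<lambda>z. Dval L z) \<in> borel_measurable (env_space :: (real \<times> real \<times> 'm) measure)"
    unfolding Dval_def by measurable
  moreover have "(\<lambda>z. z) \<in> env_space \<rightarrow>\<^sub>M (borel :: (real \<times> real \<times> 'm) measure)"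
    unfolding env_space_def by (intro measurable_restrict_space1) simp
  ultimately show "(\<lambda>z. (Dval L z, z)) \<in> env_space \<rightarrow>\<^sub>M (borel :: (real \<times> real \<times> real \<times> 'm) measure)"
    by (rule borel_measurable_Pair)
qed

text \<open>\<open>Lim\<close> carries information only after convergence is known. By monotonicity
  the joint limit is the infimum, and an infimum below \<open>u\<close> is undercut at some
  point.\<close>

lemma antimono_Lim_witness:
  fixes f :: "real \<Rightarrow> real \<Rightarrow> real"
  assumes mono: "\<And>\<epsilon> \<epsilon>' r r'. 0 < \<epsilon> \<Longrightarrow> \<epsilon> \<le> \<epsilon>' \<Longrightarrow> r' \<le> r \<Longrightarrow> f \<epsilon> r \<le> f \<epsilon>' r'"
    and bdd: "\<And>\<epsilon> r. 0 < \<epsilon> \<Longrightarrow> c \<le> f \<epsilon> r"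
    and Lim: "Lim (at_right 0 \<times>\<^sub>F at_top) (\<lambda>(\<epsilon>, r). f \<epsilon> r) < u"
  shows "\<exists>\<epsilon> r. 0 < \<epsilon> \<and> f \<epsilon> r < u"
proof -
  define e where "e = (INF z\<in>{0<..} \<times> UNIV. f (fst z) (snd z))"
  have bb: "bdd_below ((\<lambda>z. f (fst z) (snd z)) ` ({0<..} \<times> UNIV))"
    by (rule bdd_belowI2[where m = c]) (auto intro: bdd)
  have ne: "{0<..} \<times> UNIV \<noteq> ({} :: (real \<times> real) set)" by auto
  have "((\<lambda>(\<epsilon>, r). f \<epsilon> r) \<longlongrightarrow> e) (at_right 0 \<times>\<^sub>F at_top)"
  proof (rule order_tendstoI)
    fix a assume "a < e"
    have "\<forall>\<^sub>F z in at_right 0 \<times>\<^sub>F at_top. (0::real) < fst z \<and> (0::real) \<le> snd z"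
      by (intro eventually_conj filterlim_fst[THEN filterlim_iff[THEN iffD1], rule_format]
          filterlim_snd[THEN filterlim_iff[THEN iffD1], rule_format] eventually_at_right_less eventually_ge_at_top)
    then show "\<forall>\<^sub>F z in at_right 0 \<times>\<^sub>F at_top. a < (case z of (\<epsilon>, r) \<Rightarrow> f \<epsilon> r)"
    proof eventually_elim
      case (elim z)
      then have "e \<le> f (fst z) (snd z)" unfolding e_def by (intro cINF_lower[OF bb]) (auto simp: mem_Times_iff)
      then show ?case using \<open>a < e\<close> by (simp add: case_prod_unfold)
    qed
  next
    fix a assume "e < a"
    then obtain z0 where z0: "0 < fst z0" "f (fst z0) (snd z0) < a"
      using cINF_less_iff[OF ne bb, of a] by (auto simp: e_def)
    have "\<forall>\<^sub>F z in at_right 0 \<times>\<^sub>F at_top. ((0::real) < fst z \<and> fst z < fst z0) \<and> snd z0 \<le> snd z"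
      using z0(1)
      by (intro eventually_conj filterlim_fst[THEN filterlim_iff[THEN iffD1], rule_format]
          filterlim_snd[THEN filterlim_iff[THEN iffD1], rule_format] eventually_at_right_less eventually_ge_at_top
          eventually_at_right_real[THEN eventually_mono, of 0 "fst z0"])
        auto
    then show "\<forall>\<^sub>F z in at_right 0 \<times>\<^sub>F at_top. (case z of (\<epsilon>, r) \<Rightarrow> f \<epsilon> r) < a"
    proof eventually_elim
      case (elim z)
      then have "f (fst z) (snd z) \<le> f (fst z0) (snd z0)" by (intro mono) auto
      then show ?case using z0(2) by (simp add: case_prod_unfold)
    qed
  qed
  then have "Lim (at_right 0 \<times>\<^sub>F at_top) (\<lambda>(\<epsilon>, r). f \<epsilon> r) = e"
    by (intro tendsto_Lim) (simp_all add: prod_filter_eq_bot)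
  then have "e < u" using Lim by simp
  then show ?thesis using cINF_less_iff[OF ne bb, of u] by (auto simp: e_def)
qed

context once_changing_walk
begin

lemma K_prob: "z \<in> space env_space \<Longrightarrow> prob_space (K z)" "z \<in> space env_space \<Longrightarrow> sets (K z) = sets env_space"
  using measurable_space[OF kernel, of z] by (auto simp: space_prob_algebra)

lemma Kstar_prob:
  assumes "z \<in> space env_space"
  shows "\<P>((d', z') in Kstar L K (d, z). \<epsilon> < Aval z' \<and> Aval z' \<le> r)
    = measure (K z) {z' \<in> space env_space. \<epsilon> < Aval z' \<and> Aval z' \<le> r}"
proof -
  have L: "0 \<le> L" using L_pos by simp
  have meas: "(\<lambda>z. (Dval L z, z)) \<in> K z \<rightarrow>\<^sub>M star_space"
    using Dval_pair_measurable[OF L] K_prob(2)[OF assms] by (simp cong: measurable_cong_sets)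
  let ?S = "{y \<in> space star_space. case y of (d', z') \<Rightarrow> \<epsilon> < Aval z' \<and> Aval z' \<le> (r::real)}"
  have "?S \<in> sets (star_space :: (real \<times> real \<times> real \<times> 'm) measure)"
  proof -
    have "(\<lambda>y. Aval (snd y)) \<in> borel_measurable (star_space :: (real \<times> real \<times> real \<times> 'm) measure)"
      unfolding star_space_def Aval_def case_prod_unfold
      by (intro measurable_restrict_space1 borel_measurable_continuous_onI continuous_intros)
    then have "{y \<in> space (star_space :: (real \<times> real \<times> real \<times> 'm) measure). \<epsilon> < Aval (snd y) \<and> Aval (snd y) \<le> r}
        \<in> sets star_space" by measurable
    then show ?thesis by (simp add: case_prod_unfold)
  qed
  then have "measure (distr (K z) star_space (\<lambda>z. (Dval L z, z))) ?S
      = measure (K z) ((\<lambda>z. (Dval L z, z)) -` ?S \<inter> space (K z))"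
    by (rule measure_distr[OF meas])
  also have "(\<lambda>z. (Dval L z, z)) -` ?S \<inter> space (K z) = {z' \<in> space env_space. \<epsilon> < Aval z' \<and> Aval z' \<le> r}"
    using measurable_space[OF meas] sets_eq_imp_space_eq[OF K_prob(2)[OF assms]] by auto
  finally show ?thesis by (simp add: Kstar_def case_prod_unfold)
qed

text \<open>\<open>\<delta>\<close> is the infimum of the kernel probabilities for a suitable pair
  \<open>\<epsilon>\<close>, \<open>r\<close>. As \<open>Kstar\<close> ignores the first coordinate
  of its starting point, the infimum over \<open>star_space\<close> is one over
  \<open>env_space\<close>.\<close>

lemma ex_good_set:
  assumes "eta (Kstar L K) < 1 - u" "0 \<le> u"
  shows "\<exists>\<epsilon> r \<delta>. 0 < \<epsilon> \<and> u < \<delta> \<and> \<delta> \<le> 1 \<and> (\<forall>z\<in>space env_space.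
    \<delta> \<le> measure (K z) {z' \<in> space env_space. \<epsilon> < Aval z' \<and> Aval z' \<le> r})"
proof -
  let ?G = "\<lambda>\<epsilon> r. {z' \<in> space (env_space :: (real \<times> real \<times> 'm) measure). \<epsilon> < Aval z' \<and> Aval z' \<le> r}"
  have GS [measurable]: "?G \<epsilon> r \<in> sets env_space" for \<epsilon> r :: real by measurable
  define I where "I \<epsilon> r = (INF z\<in>space env_space. measure (K z) (?G \<epsilon> r))" for \<epsilon> r
  have bb: "bdd_below ((\<lambda>z. measure (K z) (?G \<epsilon> r)) ` space env_space)" for \<epsilon> r
    by (rule bdd_belowI2[where m = 0]) simp
  have ne: "space (env_space :: (real \<times> real \<times> 'm) measure) \<noteq> {}" by (auto simp: space_env_space)
  have et: "eta_trunc (Kstar L K) \<epsilon> r = 1 - I \<epsilon> r" for \<epsilon> r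
  proof -
    have "(\<lambda>y. \<P>((d, z) in Kstar L K y. \<epsilon> < Aval z \<and> Aval z \<le> r)) ` space star_space
       = (\<lambda>z. measure (K z) (?G \<epsilon> r)) ` space env_space"
    proof (intro equalityI subsetI)
      fix p assume "p \<in> (\<lambda>y. \<P>((d, z) in Kstar L K y. \<epsilon> < Aval z \<and> Aval z \<le> r)) ` space star_space"
      then obtain d z where dz: "(d, z) \<in> space star_space"
        "p = \<P>((d', z') in Kstar L K (d, z). \<epsilon> < Aval z' \<and> Aval z' \<le> r)" by auto
      then have z: "z \<in> space env_space" by (auto simp: space_star_space space_env_space)
      show "p \<in> (\<lambda>z. measure (K z) (?G \<epsilon> r)) ` space env_space"
        using Kstar_prob[OF z, where \<epsilon> = \<epsilon> and r = r and d = d] z dz(2) by auto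
    next
      fix p assume "p \<in> (\<lambda>z. measure (K z) (?G \<epsilon> r)) ` space env_space"
      then obtain z where z: "z \<in> space env_space" "p = measure (K z) (?G \<epsilon> r)" by auto
      then have "(0, z) \<in> space star_space" by (auto simp: space_star_space space_env_space)
      then show "p \<in> (\<lambda>y. \<P>((d, z) in Kstar L K y. \<epsilon> < Aval z \<and> Aval z \<le> r)) ` space star_space"
        using Kstar_prob[OF z(1), where \<epsilon> = \<epsilon> and r = r and d = 0] z(2) by (intro image_eqI[of _ _ "(0, z)"]) auto
    qed
    then show ?thesis by (simp add: eta_trunc_def I_def)
  qed
  have "\<exists>\<epsilon> r. 0 < \<epsilon> \<and> eta_trunc (Kstar L K) \<epsilon> r < 1 - u"
  proof (rule antimono_Lim_witness[where c = 0])
    show "Lim (at_right 0 \<times>\<^sub>F at_top) (\<lambda>(\<epsilon>, r). eta_trunc (Kstar L K) \<epsilon> r) < 1 - u"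
      using assms(1) by (simp add: eta_def)
    show "eta_trunc (Kstar L K) \<epsilon> r \<le> eta_trunc (Kstar L K) \<epsilon>' r'"
      if "0 < \<epsilon>" "\<epsilon> \<le> \<epsilon>'" "r' \<le> r" for \<epsilon> \<epsilon>' r r'
    proof -
      have "I \<epsilon>' r' \<le> I \<epsilon> r" unfolding I_def
      proof (rule cINF_mono[OF ne bb])
        fix z assume z: "z \<in> space (env_space :: (real \<times> real \<times> 'm) measure)"
        interpret Kz: prob_space "K z" by (rule K_prob[OF z])
        have "measure (K z) (?G \<epsilon>' r') \<le> measure (K z) (?G \<epsilon> r)"
          using that GS K_prob(2)[OF z] by (intro Kz.finite_measure_mono) auto
        then show "\<exists>z'\<in>space env_space. measure (K z') (?G \<epsilon>' r') \<le> measure (K z) (?G \<epsilon> r)" using z by blast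
      qed
      then show ?thesis by (simp add: et)
    qed
    show "0 \<le> eta_trunc (Kstar L K) \<epsilon> r" for \<epsilon> r
    proof -
      obtain z where z: "z \<in> space (env_space :: (real \<times> real \<times> 'm) measure)" using ne by auto
      interpret Kz: prob_space "K z" by (rule K_prob[OF z])
      have "I \<epsilon> r \<le> measure (K z) (?G \<epsilon> r)" unfolding I_def by (rule cINF_lower[OF bb z])
      also have "\<dots> \<le> 1" by simp
      finally show ?thesis by (simp add: et)
    qed
  qed
  then obtain \<epsilon> r where er: "0 < \<epsilon>" "u < I \<epsilon> r" by (auto simp: et)
  have low: "I \<epsilon> r \<le> measure (K z) (?G \<epsilon> r)" if "z \<in> space env_space" for z
    unfolding I_def by (rule cINF_lower[OF bb that])
  moreover have "I \<epsilon> r \<le> 1"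
  proof -
    obtain z where z: "z \<in> space (env_space :: (real \<times> real \<times> 'm) measure)" using ne by auto
    interpret Kz: prob_space "K z" by (rule K_prob[OF z])
    show ?thesis using low[OF z] Kz.prob_le_1[of "?G \<epsilon> r"] by linarith
  qed
  ultimately show ?thesis using er by blast
qed

lemma trunc_mean_tendsto:
  assumes "integrable (measure_pmf q) real"
  shows "trunc_mean \<longlonglongrightarrow> measure_pmf.expectation q real"
proof -
  have eq: "trunc_mean B = measure_pmf.expectation q (\<lambda>n. real (min n B))" for B
  proof -
    have "trunc_mean B = (\<Sum>i=1..B. measure_pmf.expectation q (indicator {i..}))"
      by (simp add: trunc_mean_def tail_def)
    also have "\<dots> = measure_pmf.expectation q (\<lambda>n. \<Sum>i=1..B. indicator {i..} n)"
      by (rule Bochner_Integration.integral_sum[symmetric])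
        (auto intro!: measure_pmf.integrable_const_bound[where B = 1])
    also have "(\<lambda>n. \<Sum>i=1..B. indicator {i..} n :: real) = (\<lambda>n. real (min n B))"
    proof
      fix n
      have "(\<Sum>i=1..B. indicator {i..} n :: real) = (\<Sum>i\<in>{1..B} \<inter> {..n}. 1)"
        by (intro sum.mono_neutral_cong_right) (auto simp: indicator_def)
      also have "{1..B} \<inter> {..n} = {1..min n B}" by auto
      finally show "(\<Sum>i=1..B. indicator {i..} n :: real) = real (min n B)" by simp
    qed
    finally show ?thesis .
  qed
  have "(\<lambda>B. measure_pmf.expectation q (\<lambda>n. real (min n B))) \<longlonglongrightarrow> measure_pmf.expectation q real"
  proof (rule integral_dominated_convergence[where w = real])
    show "AE n in measure_pmf q. (\<lambda>B. real (min n B)) \<longlonglongrightarrow> real n"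
    proof (rule AE_I2)
      fix n :: nat
      have "\<forall>\<^sub>F B in sequentially. real (min n B) = real n"
        using eventually_ge_at_top[of n] by eventually_elim simp
      then show "(\<lambda>B. real (min n B)) \<longlonglongrightarrow> real n" by (rule tendsto_eventually)
    qed
  qed (use assms in auto)
  moreover have "trunc_mean = (\<lambda>B. measure_pmf.expectation q (\<lambda>n. real (min n B)))"
    by (intro ext eq)
  ultimately show ?thesis by simp
qed

end

subsection \<open>One step of the walk\<close>

definition visited :: "vertex option list \<Rightarrow> vertex set" where
  "visited h = {\<nu>. Some \<nu> \<in> set h}"

text \<open>The value 0 after absorption and the bound 1 elsewhere make its expectation a lower
  bound for the probability of not being absorbed.\<close>

definition state_value ::
  "real \<Rightarrow> nat \<Rightarrow> real \<Rightarrow> nat \<Rightarrow> nat \<Rightarrow> vertex set \<Rightarrow> vertex option list \<Rightarrow> real" where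
  "state_value \<epsilon> k \<beta> B N S h = (case last h of None \<Rightarrow> 0
     | Some x \<Rightarrow> 1 - pot (potw \<epsilon> k \<beta> B S N) B k (visited h) x)"

lemma visited_snoc: "visited (h @ [Some x]) = insert x (visited h)"
  by (auto simp: visited_def)

lemma hit_time_gt: "hit_time x \<nu> > enat n \<longleftrightarrow> (\<forall>k\<le>n. x k \<noteq> Some \<nu>)"
proof
  assume "enat n < hit_time x \<nu>"
  moreover have "hit_time x \<nu> \<le> enat k" if "x k = Some \<nu>" for k
    unfolding hit_time_def using that by (intro Inf_lower) auto
  ultimately show "\<forall>k\<le>n. x k \<noteq> Some \<nu>"
    by (metis enat_ord_simps(1) leD order_trans)
next
  assume *: "\<forall>k\<le>n. x k \<noteq> Some \<nu>"
  have "enat (Suc n) \<le> hit_time x \<nu>"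
    unfolding hit_time_def
  proof (rule Inf_greatest)
    fix e assume "e \<in> {enat n |n. x n = Some \<nu>}"
    then obtain k where "e = enat k" "x k = Some \<nu>" by auto
    then show "enat (Suc n) \<le> e" using * by (auto simp: not_less_eq_eq[symmetric])
  qed
  then show "enat n < hit_time x \<nu>" by (simp add: Suc_ile_eq)
qed

text \<open>The sum in \<open>pot_drift\<close> runs over letters up to \<open>B\<close> only. Moves
  to other children may be dropped from a lower bound for the value because they never raise the
  potential.\<close>

lemma pot_outside_support:
  assumes nonneg: "\<And>y. 0 \<le> a y" and k: "0 < k"
    and mass_small: "\<And>z. mass a B V (k - 1 - length z mod k) z \<le> 1 / (2 * real k)"
    and letters: "\<And>y. a y \<noteq> 0 \<Longrightarrow> set y \<subseteq> {1..B}" and i: "i \<notin> {1..B}"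
  shows "pot a B k (insert (x @ [i]) V) (x @ [i]) \<le> pot a B k V x"
proof (cases "x @ [i] \<in> V")
  case False
  have "a (x @ i # w) = 0" for w using letters[of "x @ i # w"] i by auto
  then show ?thesis using pot_insert_null[OF False] by simp
next
  case True
  let ?\<mu> = "anc_mass a B k V x" and ?n = "length x"
  have b: "0 \<le> ?\<mu> l \<and> ?\<mu> l \<le> 1 / (2 * real k)" if "l \<le> ?n" for l
    using mass_small[of "take l x"] mass_nonneg[OF nonneg] that by (simp add: anc_mass_def min_absorb2)
  have s: "0 \<le> survp k ?\<mu> ?n" "0 \<le> blk_prod k ?\<mu> ?n"
    using survp_bounds(1)[of ?n ?\<mu> k] blk_prod_bounds[of ?n ?\<mu> k] b k by blast+
  have m: "0 \<le> anc_mass a B k V (x @ [i]) (Suc ?n)" using mass_nonneg[OF nonneg] by (simp add: anc_mass_def)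
  have ins: "insert (x @ [i]) V = V" using True by auto
  show ?thesis
    using pot_visited[OF True refl refl, of a B k] mult_nonneg_nonneg[OF s(1) m] mult_nonneg_nonneg[OF s(2) m]
    unfolding ins by (simp add: pot_def[of a B k V x] algebra_simps split: if_splits)
qed

lemma integral_nonneg_countable_cells:
  fixes D :: "'w \<Rightarrow> real" and c :: "'w \<Rightarrow> nat"
  assumes D: "integrable M D" and c: "c \<in> M \<rightarrow>\<^sub>M count_space UNIV"
    and cell: "\<And>i. 0 \<le> (\<integral>\<omega>. indicator {\<omega> \<in> space M. c \<omega> = i} \<omega> * D \<omega> \<partial>M)"
  shows "0 \<le> (\<integral>\<omega>. D \<omega> \<partial>M)"
proof -
  define A where "A i = {\<omega> \<in> space M. c \<omega> = i}" for i
  have A [measurable]: "A i \<in> sets M" for i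
    using measurable_sets[OF c, of "{i}"] by (simp add: A_def vimage_def Int_def conj_commute)
  have int: "integrable M (\<lambda>\<omega>. indicator (A i) \<omega> * D \<omega>)" for i
    using integrable_mult_indicator[OF A D, of i] by simp
  have sum_eq: "(\<Sum>i<n. indicator (A i) \<omega> * D \<omega>) = (if c \<omega> < n then D \<omega> else 0)" if "\<omega> \<in> space M" for n \<omega>
  proof -
    have "(\<Sum>i<n. indicator (A i) \<omega> * D \<omega>) = (\<Sum>i<n. if i = c \<omega> then D \<omega> else 0)"
      using that by (intro sum.cong) (auto simp: A_def indicator_def)
    then show ?thesis by simp
  qed
  have "(\<lambda>n. \<integral>\<omega>. (\<Sum>i<n. indicator (A i) \<omega> * D \<omega>) \<partial>M) \<longlonglongrightarrow> (\<integral>\<omega>. D \<omega> \<partial>M)"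
  proof (rule integral_dominated_convergence[where w = "\<lambda>\<omega>. \<bar>D \<omega>\<bar>"])
    show "AE \<omega> in M. (\<lambda>n. \<Sum>i<n. indicator (A i) \<omega> * D \<omega>) \<longlonglongrightarrow> D \<omega>"
    proof (rule AE_I2)
      fix \<omega> assume \<omega>: "\<omega> \<in> space M"
      have "\<forall>\<^sub>F n in sequentially. (\<Sum>i<n. indicator (A i) \<omega> * D \<omega>) = D \<omega>"
        using eventually_gt_at_top[of "c \<omega>"] by eventually_elim (simp only: sum_eq[OF \<omega>] if_True)
      then show "(\<lambda>n. \<Sum>i<n. indicator (A i) \<omega> * D \<omega>) \<longlonglongrightarrow> D \<omega>" by (rule tendsto_eventually)
    qed
    show "AE \<omega> in M. norm (\<Sum>i<n. indicator (A i) \<omega> * D \<omega>) \<le> \<bar>D \<omega>\<bar>" for n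
      by (rule AE_I2) (simp only: sum_eq, simp)
    show "(\<lambda>\<omega>. \<Sum>i<n. indicator (A i) \<omega> * D \<omega>) \<in> borel_measurable M" for n
      using int by (intro borel_measurable_sum borel_measurable_integrable)
  qed (use D in auto)
  moreover have "0 \<le> (\<integral>\<omega>. (\<Sum>i<n. indicator (A i) \<omega> * D \<omega>) \<partial>M)" for n
    using int cell by (subst Bochner_Integration.integral_sum) (auto simp: A_def intro!: sum_nonneg)
  ultimately show ?thesis by (intro LIMSEQ_le_const[OF _ exI[of _ 0]]) auto
qed

context once_changing_walk
begin

section \<open>Conditioning on the past of the walk\<close>

lemma walk_past_sub: "tree_events P bn \<union> env_events P bn Z UNIV \<union> walk_events P X n \<subseteq> sets P"
proof -
  have "{\<omega> \<in> space P. X k \<omega> = v} \<in> sets P" for k v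
    using measurable_sets[OF walk_measurable[of k], of "{v}"] by (simp add: vimage_def Int_def conj_commute)
  then show ?thesis using tree_events_sub env_events_sub[of UNIV] by (auto simp: walk_events_def)
qed

lemma walk_past_subalgebra: "subalgebra P (past_of_walk P bn Z X n)"
  unfolding past_of_walk_def by (rule sigma_subalgebra[OF walk_past_sub])

lemma walk_past_space [simp]: "space (past_of_walk P bn Z X n) = space P"
  using walk_past_subalgebra by (simp add: subalgebra_def)

lemma walk_past_sets: "W \<in> sets (past_of_walk P bn Z X n) \<Longrightarrow> W \<in> sets P"
  using walk_past_subalgebra by (auto simp: subalgebra_def)

lemma walk_past_events:
  "tree_event \<nu> \<in> sets (past_of_walk P bn Z X n)"
  "C \<in> sets env_space \<Longrightarrow> {\<omega> \<in> space P. in_tree \<nu> \<omega> \<and> Z \<nu> \<omega> \<in> C} \<in> sets (past_of_walk P bn Z X n)"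
  "k \<le> n \<Longrightarrow> {\<omega> \<in> space P. X k \<omega> = v} \<in> sets (past_of_walk P bn Z X n)"
proof -
  show "tree_event \<nu> \<in> sets (past_of_walk P bn Z X n)"
    unfolding past_of_walk_def tree_events_def
    by (rule sigma_generated[OF walk_past_sub[unfolded tree_events_def]]) blast
  show "C \<in> sets env_space \<Longrightarrow> {\<omega> \<in> space P. in_tree \<nu> \<omega> \<and> Z \<nu> \<omega> \<in> C} \<in> sets (past_of_walk P bn Z X n)"
    unfolding past_of_walk_def env_events_def
    by (rule sigma_generated[OF walk_past_sub[unfolded env_events_def]]) blast
  show "k \<le> n \<Longrightarrow> {\<omega> \<in> space P. X k \<omega> = v} \<in> sets (past_of_walk P bn Z X n)"
    unfolding past_of_walk_def walk_events_def
    by (rule sigma_generated[OF walk_past_sub[unfolded walk_events_def]]) blast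
qed

abbreviation step_prob :: "nat \<Rightarrow> vertex option \<Rightarrow> 'w \<Rightarrow> real" where
  "step_prob n v \<equiv> cond_prob P (past_of_walk P bn Z X n) (\<lambda>\<omega>. X (Suc n) \<omega> = v)"

lemma X_event [measurable]: "{\<omega> \<in> space P. X k \<omega> = v} \<in> sets P"
  by (rule walk_past_sets[OF walk_past_events(3)[OF order_refl]])

lemma X_event_neq: "{\<omega> \<in> space P. X k \<omega> \<noteq> v} \<in> sets P"
proof -
  have "{\<omega> \<in> space P. X k \<omega> \<noteq> v} = space P - {\<omega> \<in> space P. X k \<omega> = v}" by auto
  then show ?thesis using sets.compl_sets[OF X_event] by simp
qed

lemma step_prob:
  assumes W: "W \<in> sets (past_of_walk P bn Z X n)"
  shows "integrable P (\<lambda>\<omega>. indicator W \<omega> * step_prob n v \<omega>)"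
    "(\<integral>\<omega>. indicator W \<omega> * step_prob n v \<omega> \<partial>P) = prob (W \<inter> {\<omega> \<in> space P. X (Suc n) \<omega> = v})"
proof -
  interpret finite_measure_subalgebra P "past_of_walk P bn Z X n"
    by unfold_locales (rule walk_past_subalgebra)
  let ?g = "indicator {\<omega> \<in> space P. X (Suc n) \<omega> = v} :: 'w \<Rightarrow> real"
  have WP: "W \<in> sets P" using W by (rule walk_past_sets)
  have g: "?g \<in> borel_measurable P" by simp
  have f: "indicator W \<in> borel_measurable (past_of_walk P bn Z X n)" using W by simp
  have int: "integrable P (\<lambda>\<omega>. indicator W \<omega> * ?g \<omega>)"
    using WP by (intro integrable_bounded[where c = 1]) (auto simp: indicator_def)
  show "integrable P (\<lambda>\<omega>. indicator W \<omega> * step_prob n v \<omega>)"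
    unfolding cond_prob_def by (rule real_cond_exp_intg(1)[OF int f g])
  have "(\<integral>\<omega>. indicator W \<omega> * step_prob n v \<omega> \<partial>P) = (\<integral>\<omega>. indicator W \<omega> * ?g \<omega> \<partial>P)"
    unfolding cond_prob_def by (rule real_cond_exp_intg(2)[OF int f g])
  also have "\<dots> = (\<integral>\<omega>. indicator (W \<inter> {\<omega> \<in> space P. X (Suc n) \<omega> = v}) \<omega> \<partial>P)"
    unfolding indicator_inter_arith ..
  also have "\<dots> = prob (W \<inter> {\<omega> \<in> space P. X (Suc n) \<omega> = v})" using WP by simp
  finally show "(\<integral>\<omega>. indicator W \<omega> * step_prob n v \<omega> \<partial>P) = prob (W \<inter> {\<omega> \<in> space P. X (Suc n) \<omega> = v})" .
qed

abbreviation wt :: "nat \<Rightarrow> vertex \<Rightarrow> 'w \<Rightarrow> real" where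
  "wt n \<nu> \<omega> \<equiv> weight L (\<lambda>\<mu>. Z \<mu> \<omega>) (\<lambda>k. X k \<omega>) \<nu> n"

definition wt_total :: "nat \<Rightarrow> vertex \<Rightarrow> 'w \<Rightarrow> real" where
  "wt_total n \<nu> \<omega> = 1 + (\<Sum>j=1..bn \<nu> \<omega>. wt n (\<nu> @ [j]) \<omega>)"

lemma wt_pos: "\<omega> \<in> space P \<Longrightarrow> in_tree \<nu> \<omega> \<Longrightarrow> 0 < wt n \<nu> \<omega>"
  using env_range[of \<omega> \<nu>] L_pos by (auto simp: weight_def)

lemma wt_total_pos: "\<omega> \<in> space P \<Longrightarrow> in_tree \<nu> \<omega> \<Longrightarrow> 0 < wt_total n \<nu> \<omega>"
  unfolding wt_total_def using wt_pos by (intro add_pos_nonneg sum_nonneg less_imp_le) (auto simp: tree_snoc)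

text \<open>The prescribed probabilities of the parent and the children add up to 1, which excludes
  all other moves almost surely. The proof fixes the offspring number \<open>b\<close> so that the
  set of targets is finite and deterministic.\<close>

lemma walk_step_AE:
  "AE \<omega> in P. X n \<omega> = Some x \<longrightarrow> in_tree x \<omega> \<longrightarrow>
     X (Suc n) \<omega> \<in> insert (parent x) ((\<lambda>i. Some (x @ [i])) ` {1..bn x \<omega>})"
proof -
  have "AE \<omega> in P. X n \<omega> = Some x \<longrightarrow> in_tree x \<omega> \<longrightarrow> bn x \<omega> = b \<longrightarrow>
      X (Suc n) \<omega> \<in> insert (parent x) ((\<lambda>i. Some (x @ [i])) ` {1..b})" for b
  proof -
    let ?F = "past_of_walk P bn Z X n"
    let ?I = "insert (parent x) ((\<lambda>i. Some (x @ [i])) ` {1..b})"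
    define W where "W = {\<omega> \<in> space P. X n \<omega> = Some x \<and> in_tree x \<omega> \<and> bn x \<omega> = b}"
    \<comment> \<open>The past contains the tree, so an offspring number is read off from which
      children exist. For \<open>b = 0\<close> the word \<open>x @ [b]\<close> is never in the tree,
      hence the case distinction.\<close>
    have "W = {\<omega> \<in> space P. X n \<omega> = Some x} \<inter>
        ((if b = 0 then tree_event x else tree_event (x @ [b])) - tree_event (x @ [Suc b]))"
      by (auto simp: W_def tree_snoc)
    also have "\<dots> \<in> sets ?F" using walk_past_events by (intro sets.Int sets.Diff) auto
    finally have W: "W \<in> sets ?F" .
    have WP: "W \<in> sets P" using W by (rule walk_past_sets)
    have inj: "inj_on (\<lambda>i. Some (x @ [i])) {1..b}" by (auto simp: inj_on_def)
    have pn: "parent x \<notin> (\<lambda>i. Some (x @ [i])) ` {1..b}"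
      by (auto simp: parent_def dest: arg_cong[of _ _ length])
    let ?E = "\<lambda>v. W \<inter> {\<omega> \<in> space P. X (Suc n) \<omega> = v}"
    have "(\<Sum>v\<in>?I. prob (?E v)) = (\<Sum>v\<in>?I. \<integral>\<omega>. indicator W \<omega> * step_prob n v \<omega> \<partial>P)"
      using step_prob(2)[OF W] by simp
    also have "\<dots> = (\<integral>\<omega>. (\<Sum>v\<in>?I. indicator W \<omega> * step_prob n v \<omega>) \<partial>P)"
      using step_prob(1)[OF W] by (intro Bochner_Integration.integral_sum[symmetric])
    also have "\<dots> = (\<integral>\<omega>. indicator W \<omega> \<partial>P)"
    proof (rule integral_cong_AE)
      have "AE \<omega> in P. \<forall>i. X n \<omega> = Some x \<longrightarrow> i \<in> {1..bn x \<omega>} \<longrightarrow>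
          step_prob n (Some (x @ [i])) \<omega> = wt n (x @ [i]) \<omega> / wt_total n x \<omega>"
        unfolding wt_total_def by (rule AE_all_countable[THEN iffD2]) (intro allI walk_down)
      moreover have "AE \<omega> in P. X n \<omega> = Some x \<longrightarrow> step_prob n (parent x) \<omega> = 1 / wt_total n x \<omega>"
        unfolding wt_total_def by (rule walk_up)
      ultimately show "AE \<omega> in P. (\<Sum>v\<in>?I. indicator W \<omega> * step_prob n v \<omega>) = indicator W \<omega>"
        using AE_space
      proof eventually_elim
        case (elim \<omega>)
        show ?case
        proof (cases "\<omega> \<in> W")
          case True
          then have x: "X n \<omega> = Some x" "in_tree x \<omega>" "bn x \<omega> = b" "\<omega> \<in> space P" by (auto simp: W_def)
          have "(\<Sum>v\<in>?I. step_prob n v \<omega>)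
              = step_prob n (parent x) \<omega> + (\<Sum>i=1..b. step_prob n (Some (x @ [i])) \<omega>)"
            using pn by (simp add: sum.reindex[OF inj] del: One_nat_def)
          also have "\<dots> = 1 / wt_total n x \<omega> + (\<Sum>i=1..b. wt n (x @ [i]) \<omega> / wt_total n x \<omega>)"
            using elim x by (intro arg_cong2[of _ _ _ _ "(+)"] sum.cong) auto
          also have "\<dots> = wt_total n x \<omega> / wt_total n x \<omega>"
            unfolding sum_divide_distrib[symmetric] add_divide_distrib[symmetric] by (simp add: wt_total_def x)
          finally show ?thesis using True wt_total_pos[of \<omega> x n] x by (simp flip: sum_distrib_left)
        qed simp
      qed
      show "(\<lambda>\<omega>. \<Sum>v\<in>?I. indicator W \<omega> * step_prob n v \<omega>) \<in> borel_measurable P"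
        using step_prob(1)[OF W] by (intro borel_measurable_sum borel_measurable_integrable)
    qed (use WP in simp)
    also have "\<dots> = prob W" using WP by simp
    finally have eq: "(\<Sum>v\<in>?I. prob (?E v)) = prob W" .
    have U: "(\<Union>v\<in>?I. ?E v) \<in> sets P" using WP by (intro sets.finite_UN) auto
    have "prob (\<Union>v\<in>?I. ?E v) = (\<Sum>v\<in>?I. prob (?E v))"
      using WP by (intro finite_measure_finite_Union) (auto simp: disjoint_family_on_def)
    then have "prob (W - (\<Union>v\<in>?I. ?E v)) = 0"
      using eq WP U by (subst finite_measure_Diff) auto
    then have "AE \<omega> in P. \<omega> \<notin> W - (\<Union>v\<in>?I. ?E v)"
      using WP U by (intro AE_not_in) (simp add: null_sets_def emeasure_eq_measure)
    then show ?thesis using AE_space by eventually_elim (auto simp: W_def)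
  qed
  then have "AE \<omega> in P. \<forall>b. X n \<omega> = Some x \<longrightarrow> in_tree x \<omega> \<longrightarrow> bn x \<omega> = b \<longrightarrow>
      X (Suc n) \<omega> \<in> insert (parent x) ((\<lambda>i. Some (x @ [i])) ` {1..b})"
    by (subst AE_all_countable) blast
  then show ?thesis by eventually_elim blast
qed

text \<open>Collects all exceptional null sets at once, so that the drift can be computed on a fixed
  trajectory.\<close>

definition regular :: "'w \<Rightarrow> bool" where
  "regular \<omega> \<longleftrightarrow> (\<forall>n x. X n \<omega> = Some x \<longrightarrow> in_tree x \<omega> \<longrightarrow>
     X (Suc n) \<omega> \<in> insert (parent x) ((\<lambda>i. Some (x @ [i])) ` {1..bn x \<omega>}))"

lemma AE_regular: "AE \<omega> in P. regular \<omega>"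
  unfolding regular_def by (subst AE_all_countable, intro allI, subst AE_all_countable) (intro allI walk_step_AE)

definition history :: "nat \<Rightarrow> 'w \<Rightarrow> vertex option list" where
  "history n \<omega> = map (\<lambda>k. X k \<omega>) [0..<Suc n]"

lemma history_Suc: "history (Suc n) \<omega> = history n \<omega> @ [X (Suc n) \<omega>]"
  by (simp add: history_def)

lemma last_history [simp]: "last (history n \<omega>) = X n \<omega>"
  by (simp add: history_def)

lemma visited_history: "visited (history n \<omega>) = {\<nu>. \<exists>k\<le>n. X k \<omega> = Some \<nu>}"
proof -
  have "set [0..<Suc n] = {..n}" by auto
  then show ?thesis by (auto simp: visited_def history_def image_iff eq_commute simp del: upt_Suc)
qed

lemma regular_visited:
  assumes \<omega>: "regular \<omega>" "\<omega> \<in> space P"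
  shows "X n \<omega> = Some x \<Longrightarrow> in_tree x \<omega> \<and> length x \<le> n"
    and "\<nu> \<in> visited (history n \<omega>) \<Longrightarrow> take l \<nu> \<in> visited (history n \<omega>)"
    and "\<nu> \<in> visited (history n \<omega>) \<Longrightarrow> in_tree \<nu> \<omega>"
proof -
  have in_t: "in_tree x \<omega> \<and> length x \<le> n" if "X n \<omega> = Some x" for n x
    using that
  proof (induction n arbitrary: x)
    case 0 then show ?case using walk_start[OF \<omega>(2)] by simp
  next
    case (Suc n)
    then obtain y where y: "X n \<omega> = Some y" using walk_absorbed[OF \<omega>(2), of n] by (cases "X n \<omega>") auto
    with Suc.IH have "in_tree y \<omega>" "length y \<le> n" by auto
    moreover from this have "Some x \<in> insert (parent y) ((\<lambda>i. Some (y @ [i])) ` {1..bn y \<omega>})"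
      using \<omega>(1) y Suc.prems unfolding regular_def by metis
    ultimately show ?case
      by (auto simp: parent_def tree_snoc tree_snoc[of "[]", simplified] butlast_conv_take tree_take split: if_splits)
  qed
  show "X n \<omega> = Some x \<Longrightarrow> in_tree x \<omega> \<and> length x \<le> n" by (rule in_t)
  show "\<nu> \<in> visited (history n \<omega>) \<Longrightarrow> in_tree \<nu> \<omega>" using in_t by (auto simp: visited_history)
  show "\<nu> \<in> visited (history n \<omega>) \<Longrightarrow> take l \<nu> \<in> visited (history n \<omega>)"
  proof (induction n arbitrary: \<nu> l)
    case 0
    then show ?case using walk_start[OF \<omega>(2)] by (auto simp: visited_history)
  next
    case (Suc n)
    have mono: "visited (history n \<omega>) \<subseteq> visited (history (Suc n) \<omega>)"
      unfolding visited_history using le_SucI by blast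
    show ?case
    proof (cases "\<nu> \<in> visited (history n \<omega>)")
      case True then show ?thesis using Suc.IH mono by blast
    next
      case False
      then have \<nu>: "X (Suc n) \<omega> = Some \<nu>" using Suc.prems by (auto simp: visited_history le_Suc_eq)
      then obtain y where y: "X n \<omega> = Some y" using walk_absorbed[OF \<omega>(2), of n] by (cases "X n \<omega>") auto
      have yV: "y \<in> visited (history n \<omega>)" using y by (auto simp: visited_history)
      have "Some \<nu> \<in> insert (parent y) ((\<lambda>i. Some (y @ [i])) ` {1..bn y \<omega>})"
        using \<omega>(1) y \<nu> in_t[OF y] unfolding regular_def by metis
      then consider "y \<noteq> []" "\<nu> = take (length y - 1) y" | i where "\<nu> = y @ [i]"
        by (auto simp: parent_def butlast_conv_take split: if_splits)
      then show ?thesis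
      proof cases
        case 1 then show ?thesis using Suc.IH[OF yV] False by auto
      next
        case 2
        show ?thesis
        proof (cases "l \<le> length y")
          case True then show ?thesis using Suc.IH[OF yV, of l] mono 2 by auto
        next
          case False then show ?thesis using 2 Suc.prems by simp
        qed
      qed
    qed
  qed
qed

end

subsection \<open>Proof of transience\<close>

definition good_set :: "real \<Rightarrow> real \<Rightarrow> (real \<times> real \<times> 'm::polish_space) set" where
  "good_set \<epsilon> r = {z \<in> space env_space. \<epsilon> < Aval z \<and> Aval z \<le> r}"

lemma good_set_sets: "good_set \<epsilon> r \<in> sets env_space"
  unfolding good_set_def by measurable

context once_changing_walk
begin

context
  fixes \<epsilon> r \<delta> \<beta> :: real and k B :: nat
  assumes L1: "1 \<le> L" and p1: "1 \<le> p" and eps: "0 < \<epsilon>" and k: "0 < k" and \<beta>: "1 < \<beta>"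
    and kb: "growth_prod \<epsilon> k k \<le> \<beta> ^ k"
begin

abbreviation gw :: "nat \<Rightarrow> 'w \<Rightarrow> vertex set" where
  "gw N \<equiv> good_words (good_set \<epsilon> r) B N"

abbreviation sv :: "nat \<Rightarrow> vertex set \<Rightarrow> vertex option list \<Rightarrow> real" where
  "sv N \<equiv> state_value \<epsilon> k \<beta> B N"

lemma gw_length: "y \<in> gw N \<omega> \<Longrightarrow> length y \<le> N"
  by (auto simp: good_words_def all_words_def words_def)

lemma gw_finite: "gw N \<omega> \<subseteq> all_words B N"
  by (auto simp: good_words_def)

lemma state_value_bounds:
  assumes "S \<subseteq> all_words B N" shows "0 \<le> sv N S h" "sv N S h \<le> 1"
proof -
  have "\<And>y. y \<in> S \<Longrightarrow> length y \<le> N" using assms by (auto simp: all_words_def words_def)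
  note b = pot_bounds[OF eps k \<beta> kb this]
  show "0 \<le> sv N S h" "sv N S h \<le> 1" using b by (auto simp: state_value_def split: option.split)
qed

text \<open>A visited vertex has weight \<open>L\<close>, which is at least 1, or keeps its value
  \<open>A\<close>, which then exceeds \<open>B\<close> and hence \<open>p\<close>.\<close>

lemma wt_ge_1:
  assumes "\<omega> \<in> space P" "in_tree \<nu> \<omega>" "j \<le> n" "X j \<omega> = Some \<nu>" shows "1 \<le> wt n \<nu> \<omega>"
  using env_range[OF assms(1,2)] L1 p1 assms(3,4) hit_time_gt[of n "\<lambda>k. X k \<omega>" \<nu>]
  by (auto simp: weight_def)

lemma wt_fresh:
  assumes "\<And>j. j \<le> n \<Longrightarrow> X j \<omega> \<noteq> Some \<nu>" shows "wt n \<nu> \<omega> = Aval (Z \<nu> \<omega>)"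
  using assms hit_time_gt[of n "\<lambda>k. X k \<omega>" \<nu>] by (auto simp: weight_def)

abbreviation val_diff :: "nat \<Rightarrow> vertex set \<Rightarrow> vertex option list \<Rightarrow> vertex option \<Rightarrow> real" where
  "val_diff N S h v \<equiv> sv N S (h @ [v]) - sv N S h"

text \<open>The walk is at level at most \<open>n\<close> at time \<open>n\<close>, so
  \<open>Suc n < N\<close> keeps the children of its position at levels less than \<open>N\<close>,
  where the growth identity \<open>potw_children\<close> holds.\<close>

lemma regular_drift:
  assumes \<omega>: "\<omega> \<in> space P" "regular \<omega>" and x: "X n \<omega> = Some x" and N: "Suc n < N"
  defines "S \<equiv> gw N \<omega>" and "h \<equiv> history n \<omega>"
  shows "0 \<le> val_diff N S h (parent x)
    + (\<Sum>i\<in>{1..B} \<inter> {1..bn x \<omega>}. wt n (x @ [i]) \<omega> * val_diff N S h (Some (x @ [i])))"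
    and "i \<notin> {1..B} \<Longrightarrow> 0 \<le> val_diff N S h (Some (x @ [i]))"
proof -
  let ?a = "potw \<epsilon> k \<beta> B S N" and ?V = "visited h"
  note reg = regular_visited[OF \<omega>(2,1)]
  have SN: "\<And>y. y \<in> S \<Longrightarrow> length y \<le> N" unfolding S_def by (rule gw_length)
  note nonneg = potw_nonneg[OF eps k \<beta> kb SN]
  note supp = potw_support[OF eps k \<beta> kb SN]
  note small = potw_mass_le[OF eps k \<beta> kb SN]
  have lenx: "length x \<le> n" using reg(1)[OF x] by simp
  have xV: "x \<in> ?V" using x by (auto simp: h_def visited_history)
  have val: "sv N S h = 1 - pot ?a B k ?V x"
    by (simp add: state_value_def h_def x)
  have down: "val_diff N S h (Some (x @ [i])) = - (pot ?a B k (insert (x @ [i]) ?V) (x @ [i]) - pot ?a B k ?V x)" for i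
    by (simp add: val) (simp add: state_value_def visited_snoc)
  have up: "val_diff N S h (parent x)
      = - ((if x = [] then 1 else pot ?a B k ?V (butlast x)) - pot ?a B k ?V x)"
  proof (cases "x = []")
    case True then show ?thesis by (simp add: val) (simp add: state_value_def parent_def)
  next
    case False
    have "butlast x \<in> ?V" using reg(2)[of x n "length x - 1"] xV by (simp add: h_def butlast_conv_take)
    then have "insert (butlast x) ?V = ?V" by auto
    then show ?thesis using False by (simp add: val) (simp add: state_value_def parent_def visited_snoc)
  qed
  have in_S: "in_tree y \<omega> \<and> Z y \<omega> \<in> good_set \<epsilon> r" if "y \<in> S" for y
    using that by (auto simp: S_def good_words_def)
  have V_tree: "y \<in> ?V \<Longrightarrow> in_tree y \<omega>" for y unfolding h_def by (rule reg(3))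
  have "((if x = [] then 1 else pot ?a B k ?V (butlast x)) - pot ?a B k ?V x)
    + (\<Sum>i\<in>{1..B} \<inter> {1..bn x \<omega>}. wt n (x @ [i]) \<omega>
        * (pot ?a B k (insert (x @ [i]) ?V) (x @ [i]) - pot ?a B k ?V x)) \<le> 0"
  proof (rule pot_drift[OF nonneg k eps small, where wt = "\<lambda>\<nu>. wt n \<nu> \<omega>"])
    show "(\<Sum>j=1..B. ?a ((x @ [i]) @ [j])) = (if k dvd Suc (length x) then 2 * (real k + 1 / \<epsilon>)
        else 1 + 1 / (\<epsilon> * real (Suc (length x) mod k))) * ?a (x @ [i])" for i
      using potw_children[OF eps k \<beta> kb SN, where y = "x @ [i]"] lenx N by (simp add: growth_def)
    show "x @ [i, j] \<notin> ?V" if "x @ [i] \<notin> ?V" for i j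
      using that reg(2)[of "x @ [i, j]" n "Suc (length x)"] by (auto simp: h_def)
    show "take l x \<in> ?V" for l using reg(2) xV unfolding h_def by blast
    show "set y \<subseteq> {1..B}" if "?a y \<noteq> 0" for y using supp(1)[OF _ that] by blast
    fix i
    show "1 \<le> wt n (x @ [i]) \<omega>" if "i \<in> {1..bn x \<omega>}" "x @ [i] \<in> ?V"
      using that V_tree wt_ge_1[OF \<omega>(1)] by (auto simp: h_def visited_history)
    show "0 \<le> wt n (x @ [i]) \<omega>" if "i \<in> {1..bn x \<omega>}"
      using that reg(1)[OF x] wt_pos[OF \<omega>(1), of "x @ [i]" n] by (simp add: tree_snoc)
    show "\<epsilon> \<le> wt n (x @ [i]) \<omega>" if "i \<in> {1..bn x \<omega>}" "x @ [i] \<notin> ?V" "?a (x @ [i]) \<noteq> 0"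
    proof -
      have "x @ [i] \<in> S" using supp(2)[OF _ that(3)] by blast
      then have "\<epsilon> < Aval (Z (x @ [i]) \<omega>)" using in_S by (auto simp: good_set_def)
      then show ?thesis using wt_fresh[of n \<omega> "x @ [i]"] that(2) by (auto simp: h_def visited_history)
    qed
    show "x @ [i] \<notin> ?V \<and> ?a (x @ [i]) = 0" if "bn x \<omega> < i"
    proof -
      have "\<not> in_tree (x @ [i]) \<omega>" using that by (simp add: tree_snoc)
      then show ?thesis using V_tree[of "x @ [i]"] in_S[of "x @ [i]"] supp(2)[where y = "x @ [i]"] by blast
    qed
  qed
  then show "0 \<le> val_diff N S h (parent x)
    + (\<Sum>i\<in>{1..B} \<inter> {1..bn x \<omega>}. wt n (x @ [i]) \<omega> * val_diff N S h (Some (x @ [i])))"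
    unfolding up down mult_minus_right sum_negf by linarith
  show "0 \<le> val_diff N S h (Some (x @ [i]))" if "i \<notin> {1..B}" for i
    unfolding down using pot_outside_support[OF nonneg k small supp(1) that, where V = ?V and x = x] by simp
qed

section \<open>Countable partition by good words and history\<close>

lemma cell_sets:
  "{\<omega> \<in> space P. gw N \<omega> = S \<and> history n \<omega> = h} \<in> sets (past_of_walk P bn Z X n)"
proof -
  let ?F = "past_of_walk P bn Z X n"
  have g: "{\<omega> \<in> space P. in_tree y \<omega> \<and> Z y \<omega> \<in> good_set \<epsilon> r} \<in> sets ?F" for y
    by (rule walk_past_events(2)[OF good_set_sets])
  have "{\<omega> \<in> space ?F. \<forall>y\<in>all_words B N. (in_tree y \<omega> \<and> Z y \<omega> \<in> good_set \<epsilon> r) \<longleftrightarrow> y \<in> S} \<in> sets ?F"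
  proof (rule sets.sets_Collect_finite_All)
    fix y
    show "{\<omega> \<in> space ?F. (in_tree y \<omega> \<and> Z y \<omega> \<in> good_set \<epsilon> r) \<longleftrightarrow> y \<in> S} \<in> sets ?F"
    proof -
      have "{\<omega> \<in> space ?F. (in_tree y \<omega> \<and> Z y \<omega> \<in> good_set \<epsilon> r) \<longleftrightarrow> y \<in> S} =
        (if y \<in> S then {\<omega> \<in> space P. in_tree y \<omega> \<and> Z y \<omega> \<in> good_set \<epsilon> r}
         else space ?F - {\<omega> \<in> space P. in_tree y \<omega> \<and> Z y \<omega> \<in> good_set \<epsilon> r})" by auto
      then show ?thesis using g[of y] sets.compl_sets[OF g[of y]] by simp
    qed
  qed simp
  moreover have "{\<omega> \<in> space ?F. \<forall>j\<in>{..n}. X j \<omega> = h ! j} \<in> sets ?F"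
    using walk_past_events(3) by (intro sets.sets_Collect_finite_All) auto
  ultimately have "{\<omega> \<in> space ?F. \<forall>y\<in>all_words B N. (in_tree y \<omega> \<and> Z y \<omega> \<in> good_set \<epsilon> r) \<longleftrightarrow> y \<in> S}
      \<inter> {\<omega> \<in> space ?F. \<forall>j\<in>{..n}. X j \<omega> = h ! j} \<in> sets ?F" by (rule sets.Int)
  moreover have "{\<omega> \<in> space P. gw N \<omega> = S \<and> history n \<omega> = h}
      = (if S \<subseteq> all_words B N \<and> length h = Suc n then
         {\<omega> \<in> space ?F. \<forall>y\<in>all_words B N. (in_tree y \<omega> \<and> Z y \<omega> \<in> good_set \<epsilon> r) \<longleftrightarrow> y \<in> S}
      \<inter> {\<omega> \<in> space ?F. \<forall>j\<in>{..n}. X j \<omega> = h ! j} else {})"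
  proof -
    have 1: "gw N \<omega> = S \<longleftrightarrow> S \<subseteq> all_words B N \<and>
        (\<forall>y\<in>all_words B N. (in_tree y \<omega> \<and> Z y \<omega> \<in> good_set \<epsilon> r) \<longleftrightarrow> y \<in> S)" for \<omega>
      unfolding good_words_def by blast
    have 2: "history n \<omega> = h \<longleftrightarrow> length h = Suc n \<and> (\<forall>j\<in>{..n}. X j \<omega> = h ! j)" for \<omega>
      unfolding history_def list_eq_iff_nth_eq by (auto simp: less_Suc_eq_le simp del: upt_Suc)
    show ?thesis unfolding 1 2 by auto
  qed
  ultimately show ?thesis by simp
qed

text \<open>On each cell the flow, the visited set and the position are constant, and the cell is an
  event of the past of the walk. One natural number per cell makes the countable decomposition
  explicit.\<close>

definition cell_code :: "nat \<Rightarrow> nat \<Rightarrow> 'w \<Rightarrow> nat" where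
  "cell_code N n \<omega> = to_nat_on (Pow (all_words B N) \<times> (UNIV :: vertex option list set)) (gw N \<omega>, history n \<omega>)"

lemma state_space_countable: "countable (Pow (all_words B N) \<times> (UNIV :: vertex option list set))"
  by (intro countable_SIGMA countableI_type countable_finite) simp

lemma cell_code_cases:
  "(\<exists>S h. {\<omega> \<in> space P. cell_code N n \<omega> = i} = {\<omega> \<in> space P. gw N \<omega> = S \<and> history n \<omega> = h})
    \<or> {\<omega> \<in> space P. cell_code N n \<omega> = i} = {}"
proof (cases "{\<omega> \<in> space P. cell_code N n \<omega> = i} = {}")
  case False
  then obtain \<omega>0 where \<omega>0: "cell_code N n \<omega>0 = i" by auto
  let ?I = "Pow (all_words B N) \<times> (UNIV :: vertex option list set)"
  have "cell_code N n \<omega> = i \<longleftrightarrow> gw N \<omega> = gw N \<omega>0 \<and> history n \<omega> = history n \<omega>0" for \<omega>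
    using inj_on_to_nat_on[OF state_space_countable[of N], THEN inj_on_eq_iff,
        of "(gw N \<omega>, history n \<omega>)" "(gw N \<omega>0, history n \<omega>0)"] gw_finite[of N] \<omega>0
    by (auto simp: cell_code_def)
  then show ?thesis by blast
qed blast

lemma cell_code_measurable: "cell_code N n \<in> P \<rightarrow>\<^sub>M count_space UNIV"
proof (subst measurable_count_space_eq2_countable, intro conjI ballI)
  fix i :: nat
  have "{\<omega> \<in> space P. cell_code N n \<omega> = i} \<in> sets P"
    using cell_code_cases[of N n i]
  proof
    assume "\<exists>S h. {\<omega> \<in> space P. cell_code N n \<omega> = i} = {\<omega> \<in> space P. gw N \<omega> = S \<and> history n \<omega> = h}"
    then obtain S h where eq: "{\<omega> \<in> space P. cell_code N n \<omega> = i} = {\<omega> \<in> space P. gw N \<omega> = S \<and> history n \<omega> = h}"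
      by blast
    show ?thesis unfolding eq by (rule walk_past_sets[OF cell_sets])
  next
    assume eq: "{\<omega> \<in> space P. cell_code N n \<omega> = i} = {}"
    show ?thesis unfolding eq by simp
  qed
  then show "cell_code N n -` {i} \<inter> space P \<in> sets P" by (simp add: vimage_def Int_def conj_commute)
qed simp_all

abbreviation value_at :: "nat \<Rightarrow> nat \<Rightarrow> 'w \<Rightarrow> real" where
  "value_at N n \<omega> \<equiv> sv N (gw N \<omega>) (history n \<omega>)"

lemma value_at_measurable: "value_at N n \<in> borel_measurable P"
proof -
  let ?I = "Pow (all_words B N) \<times> (UNIV :: vertex option list set)"
  have "value_at N n \<omega> = (\<lambda>i. case from_nat_into ?I i of (S, h) \<Rightarrow> sv N S h) (cell_code N n \<omega>)" for \<omega>
    using from_nat_into_to_nat_on[OF state_space_countable[of N], of "(gw N \<omega>, history n \<omega>)"] gw_finite[of N \<omega>]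
    by (simp add: cell_code_def)
  moreover have "(\<lambda>\<omega>. (\<lambda>i. case from_nat_into ?I i of (S, h) \<Rightarrow> sv N S h) (cell_code N n \<omega>)) \<in> borel_measurable P"
    by (rule measurable_compose[OF cell_code_measurable]) simp
  ultimately show ?thesis by simp
qed

lemma value_at_integrable: "integrable P (value_at N n)"
  using state_value_bounds[OF gw_finite] by (intro integrable_bounded[where c = 1] value_at_measurable) (simp add: abs_le_iff)

text \<open>\<open>R\<close> is the change of value with moves to letters beyond \<open>B\<close>
  left out, a lower bound by the second part of \<open>regular_drift\<close>. \<open>Q\<close>
  replaces the indicator of each move by its conditional probability, which leaves the integral
  unchanged; pointwise, \<open>Q\<close> is the drift divided by the total weight.\<close>

lemma cell_drift:
  fixes S :: "vertex set" and h :: "vertex option list"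
  assumes N: "Suc n < N"
  defines "D \<equiv> \<lambda>\<omega>. value_at N (Suc n) \<omega> - value_at N n \<omega>"
  defines "W \<equiv> {\<omega> \<in> space P. gw N \<omega> = S \<and> history n \<omega> = h}"
  shows "0 \<le> (\<integral>\<omega>. indicator W \<omega> * D \<omega> \<partial>P)"
proof (cases "last h")
  case None
  have zero: "indicator W \<omega> * D \<omega> = 0" if "\<omega> \<in> space P" for \<omega>
  proof (cases "\<omega> \<in> W")
    case True
    then have "X n \<omega> = None" using None last_history[of n \<omega>] by (simp add: W_def)
    then have "X (Suc n) \<omega> = None" by (rule walk_absorbed[OF that])
    then show ?thesis using \<open>X n \<omega> = None\<close> by (simp add: D_def state_value_def)
  qed simp
  show ?thesis by (rule Bochner_Integration.integral_nonneg) (simp only: zero order_refl)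
next
  case (Some x)
  have W: "W \<in> sets (past_of_walk P bn Z X n)" unfolding W_def by (rule cell_sets)
  have WP: "W \<in> sets P" using W by (rule walk_past_sets)
  have Wx: "X n \<omega> = Some x" "gw N \<omega> = S" "history n \<omega> = h" "\<omega> \<in> space P" if "\<omega> \<in> W" for \<omega>
    using that Some last_history[of n \<omega>] by (auto simp: W_def)
  let ?c = "val_diff N S h"
  \<comment> \<open>The good words do not determine \<open>bn x\<close>, which may vary on the cell.
    The existence of a child is therefore cut out as a separate event of the past.\<close>
  let ?T = "\<lambda>i. W \<inter> tree_event (x @ [i])"
  have T: "?T i \<in> sets (past_of_walk P bn Z X n)" for i using W walk_past_events(1) by (rule sets.Int)
  define R where "R \<omega> = ?c (parent x) * (indicator W \<omega> * indicator {\<omega> \<in> space P. X (Suc n) \<omega> = parent x} \<omega>)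
      + (\<Sum>i=1..B. ?c (Some (x @ [i])) * (indicator (?T i) \<omega> * indicator {\<omega> \<in> space P. X (Suc n) \<omega> = Some (x @ [i])} \<omega>))" for \<omega>
  define Q where "Q \<omega> = ?c (parent x) * (indicator W \<omega> * step_prob n (parent x) \<omega>)
      + (\<Sum>i=1..B. ?c (Some (x @ [i])) * (indicator (?T i) \<omega> * step_prob n (Some (x @ [i])) \<omega>))" for \<omega>
  have iEv: "integrable P (\<lambda>\<omega>. indicator A \<omega> * indicator {\<omega> \<in> space P. X (Suc n) \<omega> = v} \<omega> :: real)"
    "(\<integral>\<omega>. indicator A \<omega> * indicator {\<omega> \<in> space P. X (Suc n) \<omega> = v} \<omega> \<partial>P)
      = (\<integral>\<omega>. indicator A \<omega> * step_prob n v \<omega> \<partial>P)"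
    if "A \<in> sets (past_of_walk P bn Z X n)" for A v
  proof -
    have AP: "A \<in> sets P" using that by (rule walk_past_sets)
    show "integrable P (\<lambda>\<omega>. indicator A \<omega> * indicator {\<omega> \<in> space P. X (Suc n) \<omega> = v} \<omega> :: real)"
      using AP by (intro integrable_bounded[where c = 1]) (auto simp: indicator_def)
    show "(\<integral>\<omega>. indicator A \<omega> * indicator {\<omega> \<in> space P. X (Suc n) \<omega> = v} \<omega> \<partial>P)
      = (\<integral>\<omega>. indicator A \<omega> * step_prob n v \<omega> \<partial>P)"
      unfolding step_prob(2)[OF that] indicator_inter_arith[symmetric] using AP by simp
  qed
  have iR: "integrable P R" unfolding R_def
    using iEv(1)[OF W] iEv(1)[OF T]
    by (intro Bochner_Integration.integrable_add Bochner_Integration.integrable_sum integrable_mult_right)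
  have iQ: "integrable P Q" unfolding Q_def
    using step_prob(1)[OF W] step_prob(1)[OF T]
    by (intro Bochner_Integration.integrable_add Bochner_Integration.integrable_sum integrable_mult_right)
  have "(\<integral>\<omega>. R \<omega> \<partial>P) = (\<integral>\<omega>. Q \<omega> \<partial>P)"
    unfolding R_def Q_def
    using iEv[OF W] iEv[OF T] step_prob(1)[OF W] step_prob(1)[OF T]
    by (subst (1 2) Bochner_Integration.integral_add)
      (auto simp: Bochner_Integration.integral_sum intro!: Bochner_Integration.integrable_sum integrable_mult_right)
  moreover have "0 \<le> (\<integral>\<omega>. Q \<omega> \<partial>P)"
  proof (rule integral_nonneg_AE)
    have "AE \<omega> in P. \<forall>i. X n \<omega> = Some x \<longrightarrow> i \<in> {1..bn x \<omega>} \<longrightarrow>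
          step_prob n (Some (x @ [i])) \<omega> = wt n (x @ [i]) \<omega> / wt_total n x \<omega>"
      unfolding wt_total_def by (rule AE_all_countable[THEN iffD2]) (intro allI walk_down)
    moreover have "AE \<omega> in P. X n \<omega> = Some x \<longrightarrow> step_prob n (parent x) \<omega> = 1 / wt_total n x \<omega>"
      unfolding wt_total_def by (rule walk_up)
    ultimately show "AE \<omega> in P. 0 \<le> Q \<omega>" using AE_space AE_regular
    proof eventually_elim
      case (elim \<omega>)
      show ?case
      proof (cases "\<omega> \<in> W")
        case True
        note w = Wx[OF True]
        have xt: "in_tree x \<omega>" using regular_visited(1)[OF elim(4,3) w(1)] by simp
        have "Q \<omega> = ?c (parent x) * step_prob n (parent x) \<omega>
            + (\<Sum>i\<in>{1..B} \<inter> {1..bn x \<omega>}. ?c (Some (x @ [i])) * step_prob n (Some (x @ [i])) \<omega>)"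
        proof -
          have "(\<Sum>i=1..B. ?c (Some (x @ [i])) * (indicator (?T i) \<omega> * step_prob n (Some (x @ [i])) \<omega>))
              = (\<Sum>i\<in>{1..B} \<inter> {1..bn x \<omega>}. ?c (Some (x @ [i])) * step_prob n (Some (x @ [i])) \<omega>)"
            using True w(4) xt by (intro sum.mono_neutral_cong_right) (auto simp: tree_snoc indicator_def)
          then show ?thesis using True by (simp add: Q_def)
        qed
        also have "\<dots> = ?c (parent x) * (1 / wt_total n x \<omega>)
            + (\<Sum>i\<in>{1..B} \<inter> {1..bn x \<omega>}. ?c (Some (x @ [i])) * (wt n (x @ [i]) \<omega> / wt_total n x \<omega>))"
          using elim(1,2) w(1) by (intro arg_cong2[of _ _ _ _ "(+)"] sum.cong) auto
        also have "\<dots> = (?c (parent x)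
            + (\<Sum>i\<in>{1..B} \<inter> {1..bn x \<omega>}. wt n (x @ [i]) \<omega> * ?c (Some (x @ [i])))) / wt_total n x \<omega>"
          unfolding add_divide_distrib sum_divide_distrib
          by (intro arg_cong2[of _ _ _ _ "(+)"] sum.cong refl) (simp_all add: mult.commute)
        also have "\<dots> \<ge> 0"
          using regular_drift(1)[OF elim(3,4) w(1) N] wt_total_pos[OF elim(3) xt, of n] unfolding w(2,3)
          by (intro divide_nonneg_nonneg) auto
        finally show ?thesis .
      qed (simp add: Q_def)
    qed
  qed
  moreover have "(\<integral>\<omega>. R \<omega> \<partial>P) \<le> (\<integral>\<omega>. indicator W \<omega> * D \<omega> \<partial>P)"
  proof (rule integral_mono_AE[OF iR])
    show "integrable P (\<lambda>\<omega>. indicator W \<omega> * D \<omega>)"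
      using integrable_mult_indicator[OF WP, of D] value_at_integrable[of N] unfolding D_def
      by (simp add: Bochner_Integration.integrable_diff)
    show "AE \<omega> in P. R \<omega> \<le> indicator W \<omega> * D \<omega>"
      using AE_space AE_regular
    proof eventually_elim
      case (elim \<omega>)
      show ?case
      proof (cases "\<omega> \<in> W")
        case True
        note w = Wx[OF True]
        have xt: "in_tree x \<omega>" using regular_visited(1)[OF elim(2,1) w(1)] by simp
        have D: "D \<omega> = ?c (X (Suc n) \<omega>)"
          using w(2,3) by (simp add: D_def history_Suc)
        have R: "R \<omega> = ?c (parent x) * indicator {parent x} (X (Suc n) \<omega>)
          + (\<Sum>i=1..B. ?c (Some (x @ [i])) * (indicator (tree_event (x @ [i])) \<omega> * indicator {Some (x @ [i])} (X (Suc n) \<omega>)))"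
          using True w(4) by (simp add: R_def indicator_def)
        have np: "parent x \<noteq> Some (x @ [i])" for i
          by (auto simp: parent_def dest: arg_cong[of _ _ length])
        have "X (Suc n) \<omega> \<in> insert (parent x) ((\<lambda>i. Some (x @ [i])) ` {1..bn x \<omega>})"
          using elim(2) w(1) xt unfolding regular_def by blast
        then consider "X (Suc n) \<omega> = parent x" | i where "i \<in> {1..bn x \<omega>}" "X (Suc n) \<omega> = Some (x @ [i])"
          by blast
        then show ?thesis
        proof cases
          case 1 then show ?thesis using True np by (simp add: R D)
        next
          case (2 i)
          have "in_tree (x @ [i]) \<omega>" using 2 xt by (simp add: tree_snoc)
          have "R \<omega> = (\<Sum>j=1..B. ?c (Some (x @ [j])) *
              (indicator (tree_event (x @ [j])) \<omega> * indicator {Some (x @ [j])} (X (Suc n) \<omega>)))"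
            using np[of i, symmetric] by (simp add: R 2(2))
          also have "\<dots> = (\<Sum>j=1..B. if j = i then ?c (Some (x @ [i])) else 0)"
            using \<open>in_tree (x @ [i]) \<omega>\<close> w(4) by (intro sum.cong refl) (simp add: 2(2) indicator_def)
          also have "\<dots> = (if i \<in> {1..B} then ?c (Some (x @ [i])) else 0)" by simp
          also have "\<dots> \<le> D \<omega>"
            using regular_drift(2)[OF elim(1,2) w(1) N, of i] unfolding w(2,3) by (simp add: D 2(2))
          finally show ?thesis using True by simp
        qed
      qed (simp add: R_def)
    qed
  qed
  ultimately show ?thesis by linarith
qed

lemma expected_value_mono: "Suc n < N \<Longrightarrow> (\<integral>\<omega>. value_at N n \<omega> \<partial>P) \<le> (\<integral>\<omega>. value_at N (Suc n) \<omega> \<partial>P)"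
proof -
  assume N: "Suc n < N"
  let ?D = "\<lambda>\<omega>. value_at N (Suc n) \<omega> - value_at N n \<omega>"
  have "0 \<le> (\<integral>\<omega>. ?D \<omega> \<partial>P)"
  proof (rule integral_nonneg_countable_cells[OF _ cell_code_measurable[of N n]])
    show "integrable P ?D" using value_at_integrable by (intro Bochner_Integration.integrable_diff)
    show "0 \<le> (\<integral>\<omega>. indicator {\<omega> \<in> space P. cell_code N n \<omega> = i} \<omega> * ?D \<omega> \<partial>P)" for i
      using cell_code_cases[of N n i]
    proof
      assume "\<exists>S h. {\<omega> \<in> space P. cell_code N n \<omega> = i} = {\<omega> \<in> space P. gw N \<omega> = S \<and> history n \<omega> = h}"
      then obtain S h where eq: "{\<omega> \<in> space P. cell_code N n \<omega> = i} = {\<omega> \<in> space P. gw N \<omega> = S \<and> history n \<omega> = h}"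
        by blast
      show ?thesis unfolding eq by (rule cell_drift[OF N])
    next
      assume eq: "{\<omega> \<in> space P. cell_code N n \<omega> = i} = {}"
      show ?thesis unfolding eq by simp
    qed
  qed
  then show ?thesis using value_at_integrable by (simp add: Bochner_Integration.integral_diff)
qed

text \<open>The horizon \<open>Suc n\<close> is just large enough for
  \<open>expected_value_mono\<close> to cover the first \<open>n\<close> steps. The constant in
  front is the one from \<open>pot_start\<close>, and it does not depend on
  \<open>n\<close>.\<close>

lemma prob_alive_ge:
  "(real k + 1 / \<epsilon>) / (real k * growth_prod \<epsilon> k k) * (\<integral>\<omega>. cap_flow \<beta> B (gw (Suc n) \<omega>) (Suc n) [] \<partial>P)
    \<le> prob {\<omega> \<in> space P. X n \<omega> \<noteq> None}"
proof -
  let ?N = "Suc n" and ?c = "(real k + 1 / \<epsilon>) / (real k * growth_prod \<epsilon> k k)"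
  have ev: "{\<omega> \<in> space P. X n \<omega> \<noteq> None} \<in> sets P"
    by (rule X_event_neq)
  have "?c * (\<integral>\<omega>. cap_flow \<beta> B (gw ?N \<omega>) ?N [] \<partial>P) = (\<integral>\<omega>. ?c * cap_flow \<beta> B (gw ?N \<omega>) ?N [] \<partial>P)" by simp
  also have "\<dots> = (\<integral>\<omega>. value_at ?N 0 \<omega> \<partial>P)"
  proof (intro Bochner_Integration.integral_cong refl)
    fix \<omega> assume "\<omega> \<in> space P"
    then have "history 0 \<omega> = [Some []]" by (simp add: history_def walk_start)
    moreover have "visited [Some []] = {[]}" by (auto simp: visited_def)
    ultimately show "?c * cap_flow \<beta> B (gw ?N \<omega>) ?N [] = value_at ?N 0 \<omega>"
      using pot_start[OF eps k \<beta> kb gw_length[of _ ?N \<omega>], where B = B] by (simp add: state_value_def)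
  qed
  also have "\<dots> \<le> (\<integral>\<omega>. value_at ?N n \<omega> \<partial>P)"
  proof -
    have "(\<integral>\<omega>. value_at ?N 0 \<omega> \<partial>P) \<le> (\<integral>\<omega>. value_at ?N j \<omega> \<partial>P)" if "j \<le> n" for j
      using that
    proof (induction j)
      case (Suc j)
      then show ?case using expected_value_mono[of j ?N] by simp
    qed simp
    then show ?thesis by simp
  qed
  also have "\<dots> \<le> (\<integral>\<omega>. indicator {\<omega> \<in> space P. X n \<omega> \<noteq> None} \<omega> \<partial>P)"
  proof (rule integral_mono[OF value_at_integrable])
    show "integrable P (indicator {\<omega> \<in> space P. X n \<omega> \<noteq> None} :: 'w \<Rightarrow> real)"
      using ev by (intro integrable_bounded[where c = 1]) (auto simp: indicator_def)
    fix \<omega> assume "\<omega> \<in> space P"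
    then show "value_at ?N n \<omega> \<le> indicator {\<omega> \<in> space P. X n \<omega> \<noteq> None} \<omega>"
      using state_value_bounds(2)[OF gw_finite, of ?N \<omega> "history n \<omega>"]
      by (cases "X n \<omega>") (auto simp: state_value_def)
  qed
  also have "\<dots> = prob {\<omega> \<in> space P. X n \<omega> \<noteq> None}" using ev by simp
  finally show ?thesis .
qed

end

lemma transient_if_alive:
  assumes c: "0 < c" "\<And>n. c \<le> prob {\<omega> \<in> space P. X n \<omega> \<noteq> None}"
  shows "transient P X"
proof -
  let ?A = "\<lambda>n. {\<omega> \<in> space P. X n \<omega> \<noteq> None}"
  have ev: "?A n \<in> sets P" for n
    by (rule X_event_neq)
  have "(\<lambda>n. prob (?A n)) \<longlonglongrightarrow> prob (\<Inter>n. ?A n)"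
  proof (rule finite_Lim_measure_decseq)
    show "range ?A \<subseteq> sets P" using ev by (rule image_subsetI)
    show "decseq ?A" by (rule decseq_SucI) (auto dest: walk_absorbed)
  qed
  then have "c \<le> prob (\<Inter>n. ?A n)" using c(2) by (intro LIMSEQ_le_const) auto
  also have "(\<Inter>n. ?A n) = {\<omega> \<in> space P. \<forall>n. X n \<omega> \<noteq> None}" by auto
  finally show ?thesis using c(1) by (simp add: transient_def)
qed

end

theorem theorem4p1:
  fixes P :: "'w measure"
    and q :: "nat pmf"
    and K :: "real \<times> real \<times> 'm::polish_space \<Rightarrow> (real \<times> real \<times> 'm) measure"
    and L p b :: real
    and bn :: "vertex \<Rightarrow> 'w \<Rightarrow> nat"
    and Z :: "vertex \<Rightarrow> 'w \<Rightarrow> real \<times> real \<times> 'm"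
    and X :: "nat \<Rightarrow> 'w \<Rightarrow> vertex option"
  assumes walk: "once_changing_walk P q K L p bn Z X"
    and offspring_mean: "integrable (measure_pmf q) real"
      "b = measure_pmf.expectation q real" "b > 1"
    and assumption1: "assumption1 star_space (Kstar L K)"
    and assumption2: "eta (Kstar L K) < 1"
    and "L \<ge> 1" and "p \<ge> 1"
    and "ln (1 - eta (Kstar L K)) > - ln b"
  shows "transient P X"
proof -
  interpret once_changing_walk P q K L p bn Z X by (rule walk)
  \<comment> \<open>In the form \<open>1 - eta > 1 / b\<close> the hypothesis leaves room for a
    probability \<open>\<delta>\<close> with \<open>b * \<delta> > 1\<close>.\<close>
  have "ln (1 / b) < ln (1 - eta (Kstar L K))"
    using \<open>b > 1\<close> assms(9) by (simp add: ln_div)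
  then have "eta (Kstar L K) < 1 - 1 / b"
    using \<open>b > 1\<close> assumption2 by (simp del: ln_less_cancel_iff add: ln_less_cancel_iff[of "1 / b"])
  then obtain \<epsilon> r \<delta> where \<epsilon>: "0 < \<epsilon>" and \<delta>: "1 / b < \<delta>" "\<delta> \<le> 1"
    and KG: "\<And>z. z \<in> space env_space \<Longrightarrow> \<delta> \<le> measure (K z) (good_set \<epsilon> r)"
    using ex_good_set[of "1 / b"] \<open>b > 1\<close> unfolding good_set_def by auto
  have \<delta>0: "0 < \<delta>" using \<delta>(1) \<open>b > 1\<close> by (meson less_trans zero_less_divide_1_iff zero_less_one)
  have "1 / \<delta> < b" using \<delta>(1) \<delta>0 \<open>b > 1\<close> by (simp add: field_simps)
  then have "\<forall>\<^sub>F B in sequentially. 1 / \<delta> < trunc_mean B"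
    using trunc_mean_tendsto[OF offspring_mean(1)] unfolding offspring_mean(2) by (rule order_tendstoD(1)[rotated])
  then obtain B where "1 / \<delta> < trunc_mean B" by (auto simp: eventually_sequentially)
  then have "1 < trunc_mean B * \<delta>" using \<delta>0 by (simp add: field_simps)
  \<comment> \<open>\<open>\<beta>\<close> exceeds 1 to absorb the growth factors and stays below
    \<open>trunc_mean B * \<delta>\<close> to keep the energy bounded. The block length depends on
    \<open>\<epsilon>\<close> and \<open>\<beta>\<close>, so it is chosen afterwards.\<close>
  then obtain \<beta> where \<beta>: "1 < \<beta>" "\<beta> < trunc_mean B * \<delta>" using dense by blast
  obtain k where k: "0 < k" "growth_prod \<epsilon> k k \<le> \<beta> ^ k"
    using ex_growth_prod_le_power[OF \<epsilon> \<beta>(1)] by auto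
  obtain c where c: "0 < c"
    "\<And>n. c \<le> (\<integral>\<omega>. cap_flow \<beta> B (good_words (good_set \<epsilon> r) B n \<omega>) n [] \<partial>P)"
    using expected_cap_flow[OF good_set_sets \<delta>0 \<delta>(2) KG \<beta>] by auto
  define C where "C = (real k + 1 / \<epsilon>) / (real k * growth_prod \<epsilon> k k)"
  have C: "0 < C" unfolding C_def
    using growth_prod_ge_1[OF \<epsilon> k(1), of k] k(1) \<epsilon> by (intro divide_pos_pos mult_pos_pos add_pos_pos) auto
  have "C * c \<le> prob {\<omega> \<in> space P. X n \<omega> \<noteq> None}" for n
    using prob_alive_ge[OF assms(7,8) \<epsilon> k(1) \<beta>(1) k(2), of B r n] mult_left_mono[OF c(2)[of "Suc n"], of C] C
    unfolding C_def by linarith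
  then show ?thesis using C c(1) by (intro transient_if_alive[of "C * c"]) auto
qed

end
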